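(* Let $s>3/2$ and let $V$ be the real random function on $\mathbb{T}=\mathbb{R}/2\pi\mathbb{Z}$ of the form $$V(x) = \sum_{n\leq -1} V_n \langle n \rangle^{-s} \sin(n \, x) + \sum_{n \geq 0 } V_n \langle n \rangle^{-s} \cos(n \, x),$$ where $V_n \sim \mathcal{N}(0,1)$, $n\in\mathbb{Z}$, are independent real centered Gaussian variables of variance $1$. There exists $\rho>0$ such that, almost surely, provided that $\|V\|_{H^1(\mathbb{T})}< \rho$, the Dirichlet spectrum $(\lambda_n)_{n\ge1}$ of the Sturm--Liouville operator $-\partial_x^2 +V_{| (0,\pi)}$ is strongly non-resonant.
   Context: Notation: $\langle x\rangle=\sqrt{1+|x|^2}$; $\mathbb{Z}^*=\mathbb{Z}\setminus\{0\}$. Dirichlet spectrum: for $V\in L^2(0,\pi;\mathbb{R})$, $(\lambda_n)_{n\ge1}$ is the increasing sequence of the eigenvalues of $-\partial_x^2+V$ on $(0,\pi)$ with boundary conditions $f(0)=f(\pi)=0$. Strong non-resonance: let $\mathbf{N}_d\subset\mathbb{Z}^d$ (here $d=1$, $\mathbf{N}_d=\{1,2,\dots\}$). Frequencies $\omega\in\mathbb{R}^{\mathbf{N}_d}$ are strongly non-resonant if for all $r>0$ there exist $\gamma_r>0$, $\alpha_r>0$ such that for all integers $1\le r_\star \leq r$, all $\ell_1,\dots,\ell_{r_\star} \in \mathbb{Z}^*$, all $n \in \mathbf{N}_d^{r_\star}$ injective (pairwise distinct entries), provided that $|\ell_1|+\cdots+|\ell_{r_\star}| \leq r$ and $\langle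 n_1 \rangle \leq \cdots \leq \langle n_{r_\star} \rangle$, we have $|\ell_1 \omega_{n_1} + \cdots + \ell_{r_\star} \omega_{n_{r_\star}} | \geq \gamma_{r} \langle n_1 \rangle^{-\alpha_r}$. *)

theory Defs
  imports "HOL-Probability.Probability"
begin

definition japanese_bracket :: "real \<Rightarrow> real" where
  "japanese_bracket x = sqrt (1 + \<bar>x\<bar>\<^sup>2)"

definition square_integrable_on :: "real set \<Rightarrow> (real \<Rightarrow> real) \<Rightarrow> bool" where
  "square_integrable_on A u \<longleftrightarrow>
     set_borel_measurable lborel A u \<and> set_integrable lborel A (\<lambda>x. (u x)\<^sup>2)"


subsection \<open>The Sobolev norm on the torus\<close>

text \<open>Functions on the torus are represented by functions on the real line, of which only the
  values on one period matter here.\<close>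

definition fourier_coeff :: "(real \<Rightarrow> real) \<Rightarrow> int \<Rightarrow> complex" where
  "fourier_coeff u n =
     (LBINT x:{0..2 * pi}. complex_of_real (u x) * cis (- (of_int n * x))) / (2 * pi)"

definition in_H1_torus :: "(real \<Rightarrow> real) \<Rightarrow> bool" where
  "in_H1_torus u \<longleftrightarrow> square_integrable_on {0..2 * pi} u \<and>
     (\<lambda>n::int. (japanese_bracket (of_int n))\<^sup>2 * (cmod (fourier_coeff u n))\<^sup>2) summable_on UNIV"

text \<open>The norm is infinite outside of the Sobolev space, so that a bound on the norm includes
  membership in the space.\<close>

definition H1_norm_torus :: "(real \<Rightarrow> real) \<Rightarrow> ereal" where
  "H1_norm_torus u =
     (if in_H1_torus u
      then ereal (sqrt (\<Sum>\<^sub>\<infinity>n::int. (japanese_bracket (of_int n))\<^sup>2 * (cmod (fourier_coeff u n))\<^sup>2))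
      else \<infinity>)"


subsection \<open>The Dirichlet spectrum\<close>

text \<open>\<open>H2_derivs f f1 f2\<close>: the function \<open>f\<close> is (the continuously differentiable representative of)
  an element of the Sobolev space of order 2 on the interval from 0 to \<open>\<pi>\<close>, with first derivative
  \<open>f1\<close> and weak second derivative \<open>f2\<close>.\<close>

definition H2_derivs :: "(real \<Rightarrow> real) \<Rightarrow> (real \<Rightarrow> real) \<Rightarrow> (real \<Rightarrow> real) \<Rightarrow> bool" where
  "H2_derivs f f1 f2 \<longleftrightarrow>
     square_integrable_on {0..pi} f2 \<and>
     (\<forall>x\<in>{0..pi}. (f has_real_derivative f1 x) (at x within {0..pi})) \<and>
     (\<forall>x\<in>{0..pi}. f1 x = f1 0 + (LBINT t:{0..x}. f2 t))"

text \<open>For a square-integrable potential, the operator with Dirichlet boundary conditions has as its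
  domain all functions of Sobolev regularity 2 that vanish at both end points.\<close>

definition dirichlet_eigenvalue :: "(real \<Rightarrow> real) \<Rightarrow> real \<Rightarrow> bool" where
  "dirichlet_eigenvalue V \<mu> \<longleftrightarrow>
     (\<exists>f f1 f2. H2_derivs f f1 f2 \<and> f 0 = 0 \<and> f pi = 0 \<and>
        (\<exists>x\<in>{0<..<pi}. f x \<noteq> 0) \<and>
        (AE x in lborel. x \<in> {0<..<pi} \<longrightarrow> - f2 x + V x * f x = \<mu> * f x))"

text \<open>The sequence is indexed from 1; its value at 0 is irrelevant. All Dirichlet eigenvalues are
  simple, so there are no multiplicities to be recorded, and the sequence is unique.\<close>

definition is_dirichlet_spectrum :: "(real \<Rightarrow> real) \<Rightarrow> (nat \<Rightarrow> real) \<Rightarrow> bool" where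
  "is_dirichlet_spectrum V lam \<longleftrightarrow>
     strict_mono_on {1..} lam \<and> lam ` {1..} = {\<mu>. dirichlet_eigenvalue V \<mu>}"


subsection \<open>Strong non-resonance\<close>

definition strongly_nonresonant :: "(nat \<Rightarrow> real) \<Rightarrow> bool" where
  "strongly_nonresonant \<omega> \<longleftrightarrow>
     (\<forall>r::real. r > 0 \<longrightarrow>
       (\<exists>\<gamma> \<alpha> :: real. \<gamma> > 0 \<and> \<alpha> > 0 \<and>
         (\<forall>(k::nat) (l :: nat \<Rightarrow> int) (n :: nat \<Rightarrow> nat).
            1 \<le> k \<and> real k \<le> r \<and>
            (\<forall>j\<in>{1..k}. l j \<noteq> 0) \<and> (\<forall>j\<in>{1..k}. n j \<ge> 1) \<and> inj_on n {1..k} \<and>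
            real_of_int (\<Sum>j=1..k. \<bar>l j\<bar>) \<le> r \<and>
            mono_on {1..k} (\<lambda>j. japanese_bracket (real (n j)))
            \<longrightarrow> \<bar>\<Sum>j=1..k. real_of_int (l j) * \<omega> (n j)\<bar>
                  \<ge> \<gamma> * japanese_bracket (real (n 1)) powr (- \<alpha>))))"


subsection \<open>The random potential\<close>

text \<open>For \<open>s > 1\<close> and standard Gaussian coefficients \<open>v n\<close>, almost surely both series converge
  absolutely and uniformly, so the unordered pointwise sums are the intended ones.\<close>

definition random_potential :: "real \<Rightarrow> (int \<Rightarrow> real) \<Rightarrow> real \<Rightarrow> real" where
  "random_potential s v x =
     (\<Sum>\<^sub>\<infinity>n\<in>{..-1::int}. v n * japanese_bracket (of_int n) powr (- s) * sin (of_int n * x)) +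
     (\<Sum>\<^sub>\<infinity>n\<in>{0::int..}. v n * japanese_bracket (of_int n) powr (- s) * cos (of_int n * x))"

end

theory Submission
  imports Defs
begin

text \<open>Write a small potential as \<open>V\<close> with \<open>\<bar>V\<bar> \<le> small_size\<close>. Its \<open>n\<close>-th Dirichlet eigenvalue \<open>\<lambda>\<^sub>n\<close> is close to
\<open>n\<^sup>2\<close>, with an eigenfunction that differs from \<open>sin (n x)\<close> by a small multiple of \<open>1/n\<close>
(\<open>eigval_solution\<close>), uniformly in \<open>n\<close>. Everything about the dependence of \<open>\<lambda>\<^sub>n\<close> on \<open>V\<close> is read off
the Wronskian identity \<open>(E - E') \<integral> f g = \<integral> (V - W) f g\<close> for two potentials with eigenfunctions
\<open>f\<close> and \<open>g\<close>, an exact finite-difference form of the first variation of an eigenvalue. It gives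
three facts: \<open>\<lambda>\<^sub>n\<close> is Lipschitz in \<open>V\<close>;
\<open>\<lambda>\<^sub>n = n\<^sup>2 + c + O(n\<^sup>-\<^sup>1\<^sup>/\<^sup>2)\<close> with \<open>c\<close> the mean of \<open>V\<close> over the interval,
for almost every sample; and adding
\<open>\<tau> cos (2 m x)\<close> to \<open>V\<close> moves \<open>\<lambda>\<^sub>n\<close> by \<open>- \<tau>/2\<close> if \<open>m = n\<close>, and by \<open>0\<close> otherwise, up to an error
\<open>\<bar>\<tau>\<bar> / max m n\<close> times a small constant (\<open>eigval_cos_perturbation\<close>).

Consider the quantity \<open>G = \<Sum>l\<^sub>n \<lambda>\<^sub>n + m c + a\<close> over a finite set \<open>A\<close> of indices, with integers
\<open>l\<^sub>n\<close>, \<open>m\<close>, \<open>a\<close>. The smallness threshold must not depend on the size of the \<open>l\<^sub>n\<close>, whereas the errors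
above add up over \<open>A\<close>. The remedy is to perturb the mode \<open>2 i\<close> for the \<open>i\<close> in \<open>A\<close> that maximises
\<open>\<bar>l\<^sub>n\<bar> sqrt n\<close>: the kernel \<open>1 / max m n\<close> passes the Schur test with the weight \<open>sqrt n\<close>, so the
errors sum up to a small multiple of \<open>\<bar>l\<^sub>i\<bar>\<close> (\<open>dominant_index_exists\<close>), and \<open>G\<close> changes at least with
slope 1/4 (\<open>combination_slope\<close>). The mode \<open>cos (2 i x)\<close> is one single Gaussian coordinate of the random
potential. Along that coordinate the set of small samples with \<open>\<bar>G\<bar> < \<epsilon>\<close> therefore has diameter \<open>O(\<epsilon>)\<close>
times a power of \<open>max A\<close>, and by Fubini its probability is \<open>O(\<epsilon>)\<close> times a power of \<open>max A\<close> (\<open>resonance_event_probability\<close>).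

If \<open>max A\<close> is at most a fixed power of \<open>min A + 1\<close>, the relations with a given \<open>min A = q\<close> are
polynomially many in \<open>q\<close>, and the Borel-Cantelli lemma gives almost surely a lower bound by a power of
\<open>min A + 1\<close> (\<open>AE_nonresonant_in_range\<close>). A relation whose largest index \<open>N\<close> lies far beyond that
range reduces to a shorter one: \<open>\<lambda>\<^sub>N\<close> may be replaced by \<open>N\<^sup>2 + c\<close>, at the price of changing the
integers \<open>m\<close> and \<open>a\<close>; this is why they are part of \<open>G\<close> (\<open>nonresonant_all_ranges\<close>). Finally, the
Sobolev norm controls the sum of the absolute values of the Fourier amplitudes, hence the supremum
of the potential, so that a small norm puts the sample into the regime just described
(\<open>H1_norm_controls_mass\<close>).\<close>

section \<open>The Dirichlet problem for a small potential\<close>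

definition sl_solution :: "(real \<Rightarrow> real) \<Rightarrow> real \<Rightarrow> (real \<Rightarrow> real) \<Rightarrow> (real \<Rightarrow> real) \<Rightarrow> bool" where
  "sl_solution V E f f1 \<longleftrightarrow> f 0 = 0 \<and>
     (\<forall>x\<in>{0..pi}. (f has_real_derivative f1 x) (at x within {0..pi}) \<and>
                  (f1 has_real_derivative (V x - E) * f x) (at x within {0..pi}))"

definition dirichlet_solution :: "(real \<Rightarrow> real) \<Rightarrow> real \<Rightarrow> (real \<Rightarrow> real) \<Rightarrow> (real \<Rightarrow> real) \<Rightarrow> bool" where
  "dirichlet_solution V E f f1 \<longleftrightarrow> sl_solution V E f f1 \<and> f pi = 0"

text \<open>The size of the potential is fixed once and for all, so that \<open>6 * pi * small_size \<le> 1 / 300\<close>.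
This is the accuracy of the eigenfunctions for which the errors in \<open>combination_slope\<close> add up to
\<open>24/100\<close>, less than the main term \<open>1/2\<close>.\<close>

definition small_size :: real where "small_size = 1 / 6000"

definition small_potential :: "(real \<Rightarrow> real) \<Rightarrow> bool" where
  "small_potential V \<longleftrightarrow> continuous_on UNIV V \<and> (\<forall>x. \<bar>V x\<bar> \<le> small_size)"

text \<open>A forced oscillator \<open>f'' + k\<^sup>2 f = p\<close> stays close to the free one. For each phase \<open>\<theta>\<close> the
combination \<open>k f cos (\<theta> - k t) + f' sin (\<theta> - k t)\<close> has derivative \<open>p sin (\<theta> - k t)\<close>, hence moves by
at most \<open>pi P\<close>; at time \<open>x\<close> the phases \<open>\<theta> = k x\<close> and \<open>\<theta> = k x + pi/2\<close> read off \<open>k f\<close> and \<open>f'\<close>.\<close>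

lemma oscillator_bound:
  fixes f f1 p :: "real \<Rightarrow> real"
  assumes k: "k > 0" and f0: "f 0 = 0"
    and df: "\<And>x. x \<in> {0..pi} \<Longrightarrow> (f has_real_derivative f1 x) (at x within {0..pi})"
    and df1: "\<And>x. x \<in> {0..pi} \<Longrightarrow> (f1 has_real_derivative p x - k\<^sup>2 * f x) (at x within {0..pi})"
    and P: "\<And>x. x \<in> {0..pi} \<Longrightarrow> \<bar>p x\<bar> \<le> P"
    and x: "x \<in> {0..pi}"
  shows "\<bar>k * f x - f1 0 * sin (k * x)\<bar> \<le> pi * P"
    and "\<bar>f1 x - f1 0 * cos (k * x)\<bar> \<le> pi * P"
proof -
  have P0: "P \<ge> 0" using P[of 0] by (auto intro: order_trans[OF abs_ge_zero])
  have main: "\<bar>(k * f x * cos (\<theta> - k * x) + f1 x * sin (\<theta> - k * x)) - f1 0 * sin \<theta>\<bar> \<le> pi * P" for \<theta>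
  proof -
    let ?G = "\<lambda>t. k * f t * cos (\<theta> - k * t) + f1 t * sin (\<theta> - k * t)"
    have d: "(?G has_field_derivative p t * sin (\<theta> - k * t)) (at t within {0..pi})"
      if t: "t \<in> {0..pi}" for t
      by (rule derivative_eq_intros df df1 t refl | simp)+
         (simp add: algebra_simps power2_eq_square)
    have b: "norm (p t * sin (\<theta> - k * t)) \<le> P" if t: "t \<in> {0..pi}" for t
      using mult_mono[OF P[OF t] abs_sin_le_one P0, of "\<theta> - k * t"] by (simp add: abs_mult)
    have "norm (?G x - ?G 0) \<le> P * norm (x - 0)"
      by (rule field_differentiable_bound[of "{0..pi}", OF _ d b]) (use x in auto)
    also have "\<dots> \<le> P * pi" using x P0 by (intro mult_left_mono) auto
    finally show ?thesis using f0 by (simp add: mult.commute)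
  qed
  show "\<bar>k * f x - f1 0 * sin (k * x)\<bar> \<le> pi * P" using main[of "k * x"] by simp
  have "\<bar>f1 x - f1 0 * sin (k * x + pi/2)\<bar> \<le> pi * P" using main[of "k * x + pi/2"] by simp
  thus "\<bar>f1 x - f1 0 * cos (k * x)\<bar> \<le> pi * P" by (simp add: sin_add)
qed

lemma sl_solution_continuous:
  assumes "sl_solution V E f f1"
  shows "continuous_on {0..pi} f" "continuous_on {0..pi} f1"
  using assms unfolding sl_solution_def
  by (meson DERIV_continuous continuous_on_eq_continuous_within)+

lemma attains_abs_sup:
  fixes f :: "real \<Rightarrow> real"
  assumes "continuous_on {0..pi} f"
  obtains z where "z \<in> {0..pi}" "\<And>x. x \<in> {0..pi} \<Longrightarrow> \<bar>f x\<bar> \<le> \<bar>f z\<bar>"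
proof -
  have "\<exists>z\<in>{0..pi}. \<forall>y\<in>{0..pi}. \<bar>f y\<bar> \<le> \<bar>f z\<bar>"
    by (rule continuous_attains_sup) (auto intro: assms continuous_on_rabs)
  thus ?thesis using that by blast
qed

text \<open>Regard \<open>(V - E + n\<^sup>2) f\<close> as the force. It is bounded by \<open>Q\<close> times the maximum of \<open>\<bar>f\<bar>\<close>, and for
\<open>pi Q \<le> 1/2\<close> the oscillator bound taken at a maximum point shows that this maximum is at most 2.\<close>

lemma sl_solution_near_sine:
  assumes sol: "sl_solution V E f f1" and n: "n \<ge> 1" and init: "f1 0 = n"
    and Q: "\<And>x. x \<in> {0..pi} \<Longrightarrow> \<bar>V x - E + n\<^sup>2\<bar> \<le> Q" "pi * Q \<le> 1 / 2"
    and x: "x \<in> {0..pi}"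
  shows "\<bar>f x - sin (n * x)\<bar> \<le> 2 * pi * Q / n" "\<bar>f1 x - n * cos (n * x)\<bar> \<le> 2 * pi * Q" "\<bar>f x\<bar> \<le> 2"
proof -
  from sl_solution_continuous(1)[OF sol] obtain z where
    z: "z \<in> {0..pi}" "\<And>x. x \<in> {0..pi} \<Longrightarrow> \<bar>f x\<bar> \<le> \<bar>f z\<bar>" using attains_abs_sup by blast
  have Q0: "Q \<ge> 0" using Q(1)[of 0] by (auto intro: order_trans[OF abs_ge_zero])
  have b: "\<bar>n * f x - f1 0 * sin (n * x)\<bar> \<le> pi * (Q * \<bar>f z\<bar>)"
          "\<bar>f1 x - f1 0 * cos (n * x)\<bar> \<le> pi * (Q * \<bar>f z\<bar>)" if x: "x \<in> {0..pi}" for x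
  proof -
    have 1: "n > 0" "f 0 = 0" using n sol by (auto simp: sl_solution_def)
    have 2: "(f has_real_derivative f1 x) (at x within {0..pi})" if "x \<in> {0..pi}" for x
      using sol that by (auto simp: sl_solution_def)
    have 3: "(f1 has_real_derivative (V x - E + n\<^sup>2) * f x - n\<^sup>2 * f x) (at x within {0..pi})"
      if "x \<in> {0..pi}" for x
      using sol that by (auto simp: sl_solution_def algebra_simps)
    have 4: "\<bar>(V x - E + n\<^sup>2) * f x\<bar> \<le> Q * \<bar>f z\<bar>" if "x \<in> {0..pi}" for x
      using mult_mono[OF Q(1)[OF that] z(2)[OF that]] Q0 by (simp add: abs_mult)
    show "\<bar>n * f x - f1 0 * sin (n * x)\<bar> \<le> pi * (Q * \<bar>f z\<bar>)"
      by (rule oscillator_bound(1)[OF 1 2 3 4 x])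
    show "\<bar>f1 x - f1 0 * cos (n * x)\<bar> \<le> pi * (Q * \<bar>f z\<bar>)"
      by (rule oscillator_bound(2)[OF 1 2 3 4 x])
  qed
  have "n * \<bar>f z\<bar> \<le> n * \<bar>sin (n * z)\<bar> + pi * (Q * \<bar>f z\<bar>)"
  proof -
    have "\<bar>n * f z\<bar> \<le> \<bar>n * sin (n * z)\<bar> + pi * (Q * \<bar>f z\<bar>)"
      using b(1)[OF z(1)] unfolding init by linarith
    thus ?thesis using n by (simp add: abs_mult)
  qed
  also have "\<dots> \<le> n + (pi * Q) * \<bar>f z\<bar>" using n by (simp add: mult_left_le)
  also have "\<dots> \<le> n + (1/2) * \<bar>f z\<bar>" using Q(2) by (intro add_left_mono mult_right_mono) auto
  also have "\<dots> \<le> n + (n/2) * \<bar>f z\<bar>" using n by (intro add_left_mono mult_right_mono) auto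
  finally have "n * \<bar>f z\<bar> \<le> n * 2" by simp
  hence fz: "\<bar>f z\<bar> \<le> 2" using n by simp
  show "\<bar>f x\<bar> \<le> 2" using z(2)[OF x] fz by simp
  have c: "pi * (Q * \<bar>f z\<bar>) \<le> 2 * pi * Q" 
    using mult_left_mono[OF mult_left_mono[OF fz Q0], of pi] by (simp add: mult_ac)
  show "\<bar>f1 x - n * cos (n * x)\<bar> \<le> 2 * pi * Q" using b(2)[OF x] c unfolding init by linarith
  have "n * \<bar>f x - sin (n * x)\<bar> = \<bar>n * f x - n * sin (n * x)\<bar>"
    using n by (simp add: right_diff_distrib[symmetric] abs_mult)
  also have "\<dots> \<le> 2 * pi * Q" using b(1)[OF x] c unfolding init by linarith
  finally show "\<bar>f x - sin (n * x)\<bar> \<le> 2 * pi * Q / n" using n by (simp add: field_simps)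
qed

text \<open>The finite-difference form of the first variation of an eigenvalue: integrate the derivative of
the Wronskian \<open>f' g - f g'\<close>, which vanishes at both end points.\<close>

lemma wronskian_identity:
  assumes f: "dirichlet_solution V E f f1" and g: "dirichlet_solution W E' g g1"
    and V: "continuous_on {0..pi} V" and W: "continuous_on {0..pi} W"
  shows "(E - E') * integral {0..pi} (\<lambda>x. f x * g x) = integral {0..pi} (\<lambda>x. (V x - W x) * (f x * g x))"
proof -
  note c = sl_solution_continuous[OF f[unfolded dirichlet_solution_def, THEN conjunct1]]
           sl_solution_continuous[OF g[unfolded dirichlet_solution_def, THEN conjunct1]]
  have d: "((\<lambda>x. f1 x * g x - f x * g1 x) has_real_derivative
            (V x - W x) * (f x * g x) - (E - E') * (f x * g x)) (at x within {0..pi})"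
    if x: "x \<in> {0..pi}" for x
  proof -
    have "(f has_real_derivative f1 x) (at x within {0..pi})"
         "(f1 has_real_derivative (V x - E) * f x) (at x within {0..pi})"
         "(g has_real_derivative g1 x) (at x within {0..pi})"
         "(g1 has_real_derivative (W x - E') * g x) (at x within {0..pi})"
      using f g x unfolding dirichlet_solution_def sl_solution_def by auto
    note dd = this
    show ?thesis
      by (rule derivative_eq_intros dd refl | simp)+ (simp add: algebra_simps)
  qed
  have "((\<lambda>x. (V x - W x) * (f x * g x) - (E - E') * (f x * g x)) has_integral
          (f1 pi * g pi - f pi * g1 pi) - (f1 0 * g 0 - f 0 * g1 0)) {0..pi}"
    by (rule fundamental_theorem_of_calculus)
       (use d in \<open>auto simp: has_real_derivative_iff_has_vector_derivative\<close>)
  moreover have "(f1 pi * g pi - f pi * g1 pi) - (f1 0 * g 0 - f 0 * g1 0) = 0"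
    using f g unfolding dirichlet_solution_def sl_solution_def by auto
  ultimately have "integral {0..pi} (\<lambda>x. (V x - W x) * (f x * g x) - (E - E') * (f x * g x)) = 0"
    by (simp add: integral_unique)
  moreover have "integral {0..pi} (\<lambda>x. (V x - W x) * (f x * g x) - (E - E') * (f x * g x)) =
      integral {0..pi} (\<lambda>x. (V x - W x) * (f x * g x)) - integral {0..pi} (\<lambda>x. (E - E') * (f x * g x))"
    by (intro integral_diff integrable_continuous_real continuous_intros c V W)
  ultimately show ?thesis by simp
qed

lemma has_integral_cos_mult:
  assumes "m \<noteq> (0::real)"
  shows "((\<lambda>x. cos (m * x)) has_integral (sin (m * pi) / m)) {0..pi}"
proof -
  have "((\<lambda>x. cos (m * x)) has_integral (sin (m * pi) / m - sin (m * 0) / m)) {0..pi}"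
    by (rule fundamental_theorem_of_calculus)
       (use assms in \<open>auto intro!: derivative_eq_intros simp: has_real_derivative_iff_has_vector_derivative[symmetric]\<close>)
  thus ?thesis by simp
qed

lemma integral_cos_int:
  assumes "m \<in> \<int>" "m \<noteq> (0::real)"
  shows "integral {0..pi} (\<lambda>x. cos (m * x)) = 0"
proof -
  have "sin (m * pi) = 0" using assms(1) by (auto simp: sin_zero_iff_int2 Ints_def)
  thus ?thesis using has_integral_cos_mult[OF assms(2)] by (simp add: integral_unique)
qed

lemma integral_sin_sq:
  assumes "n \<in> \<int>" "n \<noteq> (0::real)"
  shows "integral {0..pi} (\<lambda>x. sin (n * x) * sin (n * x)) = pi / 2"
proof -
  have e: "sin (n * x) * sin (n * x) = 1/2 - cos ((2*n) * x) / 2" for x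
    using cos_double_sin[of "n * x"] by (simp add: power2_eq_square algebra_simps)
  have "integral {0..pi} (\<lambda>x. 1/2 - cos ((2*n) * x) / 2) =
        integral {0..pi} (\<lambda>x. 1/2) - integral {0..pi} (\<lambda>x. cos ((2*n) * x) / 2)"
    by (intro integral_diff integrable_continuous_real continuous_intros) auto
  also have "\<dots> = pi / 2" using integral_cos_int[of "2 * n"] assms by simp
  finally show ?thesis unfolding e .
qed

lemma integral_cos_sin_sq:
  assumes "n \<in> \<int>" "n > (0::real)" "m \<in> \<int>" "m > (0::real)"
  shows "integral {0..pi} (\<lambda>x. cos (2 * m * x) * (sin (n * x) * sin (n * x))) = (if m = n then - pi / 4 else 0)"
proof -
  have e: "cos (2 * m * x) * (sin (n * x) * sin (n * x)) =
      cos ((2*m) * x) / 2 - cos ((2*m-2*n) * x) / 4 - cos ((2*m+2*n) * x) / 4" for x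
  proof -
    have "sin (n * x) * sin (n * x) = 1/2 - cos (2*(n * x)) / 2"
      using cos_double_sin[of "n * x"] by (simp add: power2_eq_square algebra_simps)
    moreover have "cos ((2*m-2*n) * x) + cos ((2*m+2*n) * x) = 2 * cos (2*m*x) * cos (2*(n*x))"
      by (simp add: algebra_simps cos_diff cos_add)
    ultimately have "cos (2 * m * x) * (sin (n * x) * sin (n * x)) =
        cos (2*m*x) / 2 - (cos ((2*m-2*n) * x) + cos ((2*m+2*n) * x)) / 4"
      by (simp only: right_diff_distrib)
    thus ?thesis by (simp only: add_divide_distrib diff_diff_eq)
  qed
  have i: "(\<lambda>x. cos (a * x) / b) integrable_on {0..pi}" for a b :: real
    unfolding divide_inverse by (intro integrable_continuous_real continuous_intros)
  have "integral {0..pi} (\<lambda>x. cos ((2*m) * x) / 2 - cos ((2*m-2*n) * x) / 4 - cos ((2*m+2*n) * x) / 4) =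
     integral {0..pi} (\<lambda>x. cos ((2*m) * x) / 2) - integral {0..pi} (\<lambda>x. cos ((2*m-2*n) * x) / 4)
     - integral {0..pi} (\<lambda>x. cos ((2*m+2*n) * x) / 4)"
    by (simp only: integral_diff i integrable_diff)
  also have "\<dots> = (if m = n then - pi / 4 else 0)"
  proof -
    have "integral {0..pi} (\<lambda>x. cos ((2*m) * x) / 2) = 0" "integral {0..pi} (\<lambda>x. cos ((2*m+2*n) * x) / 4) = 0"
      using integral_cos_int[of "2*m"] integral_cos_int[of "2*m+2*n"] assms by simp_all
    moreover have "integral {0..pi} (\<lambda>x. cos ((2*m-2*n) * x) / 4) = 0" if "m \<noteq> n"
      using integral_cos_int[of "2*m-2*n"] assms that by simp
    moreover have "integral {0..pi} (\<lambda>x. cos ((2*m-2*n) * x) / 4) = pi / 4" if "m = n"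
      using that by simp
    ultimately show ?thesis by auto
  qed
  finally show ?thesis unfolding e .
qed

section \<open>Existence of eigenvalues near squares\<close>

text \<open>The variation-of-constants equation \<open>f x = sin (n x) + 1/n \<integral> sin (n (x - t)) q t f t\<close>, with
the integral expanded by the addition theorem. For \<open>pi Q \<le> 1/2\<close> its right-hand side is a contraction.
The Banach fixed point theorem is applied in the space of bounded continuous functions on the whole
line, so the operator is made constant outside the interval by composing with the projection \<open>c\<close>.\<close>

lemma cauchy_problem_fixed_point:
  fixes q :: "real \<Rightarrow> real" and n :: real
  assumes q: "continuous_on UNIV q" and Q: "\<And>x. \<bar>q x\<bar> \<le> Q" "pi * Q \<le> 1 / 2" and n: "n \<ge> 1"
  obtains f :: "real \<Rightarrow> real" where "continuous_on UNIV f"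
    "\<And>x. x \<in> {0..pi} \<Longrightarrow> f x = sin (n * x) +
       (sin (n * x) * integral {0..x} (\<lambda>t. cos (n * t) * (q t * f t))
        - cos (n * x) * integral {0..x} (\<lambda>t. sin (n * t) * (q t * f t))) / n"
proof -
  define c where "c = (\<lambda>x::real. max 0 (min pi x))"
  have c: "c x \<in> {0..pi}" for x by (auto simp: c_def)
  have c_id: "c x = x" if "x \<in> {0..pi}" for x using that by (auto simp: c_def)
  have c_cont: "continuous_on UNIV c" unfolding c_def by (intro continuous_intros)
  \<comment> \<open>The free solution \<open>sin (n x)\<close> has initial slope \<open>n\<close>, the normalisation used throughout.\<close>
  define U where "U = (\<lambda>(f::real\<Rightarrow>real) x. sin (n * c x) +
       (sin (n * c x) * integral {0..c x} (\<lambda>t. cos (n * t) * (q t * f t))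
        - cos (n * c x) * integral {0..c x} (\<lambda>t. sin (n * t) * (q t * f t))) / n)"
  have U_diff: "\<bar>U f x - U g x\<bar> \<le> d / 2"
    if f: "continuous_on UNIV f" and g: "continuous_on UNIV g" and d: "\<And>x. \<bar>f x - g x\<bar> \<le> d" for f g x d
  proof -
    let ?I = "\<lambda>h k. integral {0..c x} (\<lambda>t. h (n * t) * (q t * k t))"
    let ?s = "\<lambda>t. sin (n * c x) * (cos (n * t) * (q t * f t) - cos (n * t) * (q t * g t))"
    let ?c = "\<lambda>t. cos (n * c x) * (sin (n * t) * (q t * f t) - sin (n * t) * (q t * g t))"
    have i: "(\<lambda>t. h (n * t) * (q t * k t)) integrable_on {0..c x}"
      if "continuous_on UNIV h" "continuous_on UNIV k" for h k :: "real \<Rightarrow> real"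
      by (intro integrable_continuous_real continuous_intros continuous_on_subset[OF q] continuous_on_subset[OF that(2)]
           continuous_on_compose2[OF that(1)]) auto
    have cs: "continuous_on UNIV (cos::real\<Rightarrow>real)" "continuous_on UNIV (sin::real\<Rightarrow>real)"
      by (intro continuous_intros)+
    have d0: "0 \<le> d" using d[of 0] by linarith
    have "U f x - U g x = (sin (n * c x) * (?I cos f - ?I cos g)
        - cos (n * c x) * (?I sin f - ?I sin g)) / n"
      unfolding U_def using n by (simp add: field_simps)
    also have "\<dots> = (integral {0..c x} ?s
        - integral {0..c x} ?c) / n"
      by (simp only: integral_mult_right integral_diff[OF i[OF cs(1) f] i[OF cs(1) g]] integral_diff[OF i[OF cs(2) f] i[OF cs(2) g]])
    also have "\<dots> = integral {0..c x} (\<lambda>t. ?s t - ?c t) / n"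
      by (subst integral_diff) (auto intro!: integrable_on_mult_right integrable_diff i cs f g)
    also have "(\<lambda>t. ?s t - ?c t)
       = (\<lambda>t. sin (n * c x - n * t) * (q t * (f t - g t)))"
      by (rule ext) (simp add: sin_diff algebra_simps)
    finally have e: "U f x - U g x = integral {0..c x} (\<lambda>t. sin (n * c x - n * t) * (q t * (f t - g t))) / n" .
    have "norm (integral {0..c x} (\<lambda>t. sin (n * c x - n * t) * (q t * (f t - g t)))) \<le> (Q * d) * (c x - 0)"
    proof (rule integral_bound)
      show "continuous_on {0..c x} (\<lambda>t. sin (n * c x - n * t) * (q t * (f t - g t)))"
        by (intro continuous_intros continuous_on_subset[OF q] continuous_on_subset[OF f] continuous_on_subset[OF g]) auto
      fix t assume "t \<in> {0..c x}"
      have "\<bar>sin (n * c x - n * t)\<bar> * (\<bar>q t\<bar> * \<bar>f t - g t\<bar>) \<le> 1 * (Q * d)"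
        by (intro mult_mono abs_sin_le_one Q d) (auto intro: order_trans[OF abs_ge_zero Q(1)])
      thus "norm (sin (n * c x - n * t) * (q t * (f t - g t))) \<le> Q * d" by (simp add: abs_mult)
    qed (use c in auto)
    also have "\<dots> \<le> (Q * d) * pi"
      using c[of x] d0 order_trans[OF abs_ge_zero Q(1)] by (intro mult_left_mono) auto
    also have "\<dots> = (pi * Q) * d" by simp
    also have "\<dots> \<le> (1/2) * d" using Q(2) d0 by (intro mult_right_mono) auto
    finally have "\<bar>U f x - U g x\<bar> * n \<le> d / 2" unfolding e using n by (simp add: abs_mult)
    moreover have "\<bar>U f x - U g x\<bar> * 1 \<le> \<bar>U f x - U g x\<bar> * n" using n by (intro mult_left_mono) auto
    ultimately show ?thesis unfolding mult_1_right by (rule order_trans[rotated])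
  qed
  have U_cont: "continuous_on UNIV (U f)" if f: "continuous_on UNIV f" for f
  proof -
    have J: "continuous_on UNIV (\<lambda>x. integral {0..c x} g)" if "continuous_on UNIV g" for g :: "real \<Rightarrow> real"
    proof -
      have "continuous_on {0..pi} (\<lambda>x. integral {0..x} g)"
        by (intro indefinite_integral_continuous_1 integrable_continuous_real continuous_on_subset[OF that]) auto
      thus ?thesis by (rule continuous_on_compose2[OF _ c_cont]) (use c in auto)
    qed
    show ?thesis unfolding U_def by (intro continuous_intros J c_cont q f) (use n in auto)
  qed
  have U0: "\<bar>U (\<lambda>_. 0) x\<bar> \<le> 1" for x by (simp add: U_def)
  have U_b: "U (apply_bcontfun f) \<in> bcontfun" for f
  proof -
    have "\<bar>U (apply_bcontfun f) x\<bar> \<le> norm f / 2 + 1" for x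
    proof -
      have "\<bar>U (apply_bcontfun f) x - U (\<lambda>_. 0) x\<bar> \<le> norm f / 2"
        by (rule U_diff) (use norm_bounded[of f] in \<open>auto intro: continuous_intros\<close>)
      thus ?thesis using U0[of x] by linarith
    qed
    hence "bounded (range (U (apply_bcontfun f)))" by (intro boundedI) auto
    thus ?thesis by (simp add: bcontfun_def U_cont)
  qed
  define Uh where "Uh = (\<lambda>f. Bcontfun (U (apply_bcontfun f)))"
  have Uh: "apply_bcontfun (Uh f) = U (apply_bcontfun f)" for f
    unfolding Uh_def by (rule Bcontfun_inverse[OF U_b])
  have "\<exists>!f. Uh f = f"
  proof (rule banach_fix_type[of "1/2"]; (intro allI)?)
    fix f g :: "real \<Rightarrow>\<^sub>C real"
    show "dist (Uh f) (Uh g) \<le> (1/2) * dist f g"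
    proof (rule dist_bound)
      fix x
      have "\<bar>U (apply_bcontfun f) x - U (apply_bcontfun g) x\<bar> \<le> dist f g / 2"
        by (rule U_diff) (use dist_bounded[of f _ g] in \<open>auto simp: dist_real_def\<close>)
      thus "dist (apply_bcontfun (Uh f) x) (apply_bcontfun (Uh g) x) \<le> 1/2 * dist f g"
        by (simp add: Uh dist_real_def)
    qed
  qed auto
  then obtain f where "Uh f = f" by auto
  hence fx: "apply_bcontfun f = U (apply_bcontfun f)" by (metis Uh)
  show thesis
  proof (rule that[of "apply_bcontfun f"])
    show "continuous_on UNIV (apply_bcontfun f)"
      using apply_bcontfun[of f] by (simp add: bcontfun_def)
    fix x assume "x \<in> {0..pi}"
    thus "apply_bcontfun f x = sin (n * x) +
       (sin (n * x) * integral {0..x} (\<lambda>t. cos (n * t) * (q t * apply_bcontfun f t))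
        - cos (n * x) * integral {0..x} (\<lambda>t. sin (n * t) * (q t * apply_bcontfun f t))) / n"
      by (subst fx) (simp add: U_def c_id)
  qed
qed

text \<open>The fixed point equation may be differentiated twice, which turns the integral equation back into
the differential equation.\<close>

lemma sl_solution_exists:
  assumes V: "continuous_on UNIV V" and n: "n \<ge> 1"
    and Q: "\<And>x. \<bar>V x - E + n\<^sup>2\<bar> \<le> Q" "pi * Q \<le> 1 / 2"
  shows "\<exists>f f1. sl_solution V E f f1 \<and> f1 0 = n"
proof -
  define q where "q = (\<lambda>x. V x - E + n\<^sup>2)"
  have q: "continuous_on UNIV q" unfolding q_def by (intro continuous_intros V)
  obtain f where f: "continuous_on UNIV f" and
    fx: "\<And>x. x \<in> {0..pi} \<Longrightarrow> f x = sin (n * x) +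
       (sin (n * x) * integral {0..x} (\<lambda>t. cos (n * t) * (q t * f t))
        - cos (n * x) * integral {0..x} (\<lambda>t. sin (n * t) * (q t * f t))) / n"
    using cauchy_problem_fixed_point[OF q _ Q(2) n] Q(1) unfolding q_def by blast
  define C where "C = (\<lambda>x. integral {0..x} (\<lambda>t. cos (n * t) * (q t * f t)))"
  define S where "S = (\<lambda>x. integral {0..x} (\<lambda>t. sin (n * t) * (q t * f t)))"
  define f1 where "f1 = (\<lambda>x. n * cos (n * x) + cos (n * x) * C x + sin (n * x) * S x)"
  have dC: "(C has_real_derivative cos (n * x) * (q x * f x)) (at x within {0..pi})"
    if x: "x \<in> {0..pi}" for x unfolding C_def
    by (rule integral_has_real_derivative[OF _ x]) (intro continuous_intros continuous_on_subset[OF q] continuous_on_subset[OF f]; simp)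
  have dS: "(S has_real_derivative sin (n * x) * (q x * f x)) (at x within {0..pi})"
    if x: "x \<in> {0..pi}" for x unfolding S_def
    by (rule integral_has_real_derivative[OF _ x]) (intro continuous_intros continuous_on_subset[OF q] continuous_on_subset[OF f]; simp)
  define g where "g = (\<lambda>x. sin (n * x) + (sin (n * x) * C x - cos (n * x) * S x) / n)"
  have fg: "f x = g x" if "x \<in> {0..pi}" for x using fx[OF that] by (simp add: g_def C_def S_def)
  have dg: "(g has_real_derivative f1 x) (at x within {0..pi})" if x: "x \<in> {0..pi}" for x
    unfolding g_def f1_def using n
    by (auto intro!: derivative_eq_intros dC dS x simp: field_simps)
  have df1: "(f1 has_real_derivative (V x - E) * f x) (at x within {0..pi})" if x: "x \<in> {0..pi}" for x
  proof -
    have sc: "sin (n * x) * (sin (n * x) * y) + cos (n * x) * (cos (n * x) * y) = y" for y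
      by (metis (no_types, opaque_lifting) distrib_right mult.assoc mult_1 power2_eq_square sin_cos_squared_add)
    have "(f1 has_real_derivative
       - (n * n * sin (n * x)) - n * sin (n * x) * C x + n * cos (n * x) * S x
       + (sin (n * x) * (sin (n * x) * (q x * f x)) + cos (n * x) * (cos (n * x) * (q x * f x)))) (at x within {0..pi})"
      unfolding f1_def
      by (rule derivative_eq_intros dC dS x refl | simp add: algebra_simps)+
    also have "- (n * n * sin (n * x)) - n * sin (n * x) * C x + n * cos (n * x) * S x
       + (sin (n * x) * (sin (n * x) * (q x * f x)) + cos (n * x) * (cos (n * x) * (q x * f x)))
       = - (n\<^sup>2 * g x) + q x * f x"
      unfolding sc using n by (simp add: g_def field_simps power2_eq_square)
    also have "\<dots> = (V x - E) * f x" using fg[OF x] by (simp add: q_def algebra_simps)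
    finally show ?thesis .
  qed
  have "sl_solution V E f f1" unfolding sl_solution_def
  proof (intro conjI ballI df1)
    show "f 0 = 0" using fg[of 0] by (simp add: g_def S_def)
    fix x assume x: "x \<in> {0..pi}"
    show "(f has_real_derivative f1 x) (at x within {0..pi})"
      by (rule has_field_derivative_transform_within[OF dg[OF x], of 1]) (use x fg in auto)
  qed
  moreover have "f1 0 = n" by (simp add: f1_def C_def)
  ultimately show ?thesis by blast
qed

lemma pi_bounds: "pi > 3" "pi < 3.2"
  using pi_approx by auto

lemma small_potential_continuous: "small_potential V \<Longrightarrow> continuous_on S V"
  unfolding small_potential_def using continuous_on_subset by blast

lemma small_potential_bound: "small_potential V \<Longrightarrow> \<bar>V x\<bar> \<le> small_size"
  unfolding small_potential_def by blast

definition near_sine :: "real \<Rightarrow> real \<Rightarrow> (real \<Rightarrow> real) \<Rightarrow> (real \<Rightarrow> real) \<Rightarrow> bool" where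
  "near_sine \<eta> n f f1 \<longleftrightarrow> (\<forall>x\<in>{0..pi}. \<bar>f x - sin (n * x)\<bar> \<le> \<eta> / n \<and> \<bar>f1 x - n * cos (n * x)\<bar> \<le> \<eta>)"

lemma near_sineD:
  assumes "near_sine \<eta> n f f1" "x \<in> {0..pi}"
  shows "\<bar>f x - sin (n * x)\<bar> \<le> \<eta> / n" "\<bar>f1 x - n * cos (n * x)\<bar> \<le> \<eta>"
  using assms by (auto simp: near_sine_def)

text \<open>The bound on the distance of \<open>E\<close> to \<open>n\<^sup>2\<close> is used with \<open>c = 2\<close> for the eigenvalues constructed below, and
with \<open>c = 26\<close> for an arbitrary eigenvalue as located by \<open>eigenvalue_near_square\<close>.\<close>

lemma sl_solution_near_sine_small:
  assumes V: "small_potential V" and sol: "sl_solution V E f f1" and n: "n \<ge> 1" and init: "f1 0 = n"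
    and E: "\<bar>E - n\<^sup>2\<bar> \<le> c * small_size" "c \<le> 26"
  shows "near_sine (2 * pi * ((1 + c) * small_size)) n f f1"
proof -
  have q: "\<bar>V x - E + n\<^sup>2\<bar> \<le> (1 + c) * small_size" for x
    using small_potential_bound[OF V, of x] E by (simp add: algebra_simps)
  have "pi * ((1 + c) * small_size) \<le> 3.2 * (27 * small_size)"
    using pi_bounds E(2) by (intro mult_mono) (use order_trans[OF abs_ge_zero q[of 0]] in \<open>auto simp: small_size_def\<close>)
  hence p: "pi * ((1 + c) * small_size) \<le> 1/2" by (simp add: small_size_def)
  show ?thesis unfolding near_sine_def
    using sl_solution_near_sine[OF sol n init q p] by auto
qed

lemma near_sine_mono: "near_sine \<eta> n f f1 \<Longrightarrow> \<eta> \<le> \<eta>' \<Longrightarrow> n > 0 \<Longrightarrow> near_sine \<eta>' n f f1"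
  unfolding near_sine_def by (meson divide_right_mono less_imp_le order_trans)

text \<open>Products of two eigenfunctions are what enters the Wronskian identity. The second estimate has no
factor \<open>n\<close> on the right: wherever the derivative produces a factor \<open>n\<close>, the other function
contributes an error \<open>\<eta> / n\<close>.\<close>

lemma product_near_sine_sq:
  assumes f: "near_sine \<eta> n f f1" and g: "near_sine \<eta> n g g1" and n: "n \<ge> 1" and \<eta>: "\<eta> \<le> 1" and x: "x \<in> {0..pi}"
  shows "\<bar>f x * g x - sin (n * x) * sin (n * x)\<bar> \<le> 3 * \<eta> / n"
    and "\<bar>f1 x * g x + f x * g1 x - 2 * n * sin (n * x) * cos (n * x)\<bar> \<le> 6 * \<eta>"
    and "\<bar>f x * g x\<bar> \<le> 4"
proof -
  define s c a b where "s = sin (n * x)" and "c = cos (n * x)" and "a = f x - s" and "b = g x - s"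
  define a' b' where "a' = f1 x - n * c" and "b' = g1 x - n * c"
  have \<eta>0: "\<eta> \<ge> 0" using near_sineD(2)[OF f x] by linarith
  have le: "\<bar>a\<bar> \<le> \<eta> / n" "\<bar>b\<bar> \<le> \<eta> / n" "\<bar>a'\<bar> \<le> \<eta>" "\<bar>b'\<bar> \<le> \<eta>" "\<bar>s\<bar> \<le> 1" "\<bar>c\<bar> \<le> 1"
    using near_sineD[OF f x] near_sineD[OF g x] by (simp_all add: a_def b_def a'_def b'_def s_def c_def)
  have \<eta>n: "\<eta> / n \<le> \<eta>" using n \<eta>0 by (simp add: divide_le_eq mult_left_le mult.commute)
       (metis mult_le_cancel_left1 mult.commute not_less order_trans)
  have a1: "\<bar>a\<bar> \<le> 1" "\<bar>b\<bar> \<le> 1" using le \<eta>n \<eta> by linarith+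
  have e: "f x = s + a" "g x = s + b" "f1 x = n * c + a'" "g1 x = n * c + b'"
    by (simp_all add: a_def b_def a'_def b'_def)
  have "f x * g x - s * s = s * a + s * b + a * b" unfolding e by (simp add: algebra_simps)
  moreover have "\<bar>s * a\<bar> \<le> \<eta> / n" "\<bar>s * b\<bar> \<le> \<eta> / n" "\<bar>a * b\<bar> \<le> \<eta> / n"
    using mult_mono[OF le(5) le(1)] mult_mono[OF le(5) le(2)] mult_mono[OF a1(1) le(2)] by (simp_all add: abs_mult)
  ultimately show "\<bar>f x * g x - sin (n * x) * sin (n * x)\<bar> \<le> 3 * \<eta> / n"
    unfolding s_def[symmetric] by linarith
  have m: "\<bar>u * v\<bar> \<le> \<eta>" if "\<bar>u\<bar> \<le> \<eta>" "\<bar>v\<bar> \<le> 1" for u v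
    using mult_mono[OF that \<eta>0] by (simp add: abs_mult)
  have "f1 x * g x + f x * g1 x - 2 * n * s * c = (n * b) * c + (n * a) * c + a' * s + b' * s + a' * b + b' * a"
    unfolding e by (simp add: algebra_simps)
  moreover have na: "\<bar>n * a\<bar> \<le> \<eta>" "\<bar>n * b\<bar> \<le> \<eta>" using le n by (simp_all add: abs_mult field_simps)
  moreover have "\<bar>n * b * c\<bar> \<le> \<eta>" "\<bar>n * a * c\<bar> \<le> \<eta>" "\<bar>a' * s\<bar> \<le> \<eta>" "\<bar>b' * s\<bar> \<le> \<eta>" "\<bar>a' * b\<bar> \<le> \<eta>" "\<bar>b' * a\<bar> \<le> \<eta>"
    by (intro m na le a1)+
  ultimately show "\<bar>f1 x * g x + f x * g1 x - 2 * n * sin (n * x) * cos (n * x)\<bar> \<le> 6 * \<eta>"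
    unfolding s_def[symmetric] c_def[symmetric] abs_le_iff
    by - (elim conjE, intro conjI; linarith)
  have "\<bar>f x\<bar> \<le> 2" "\<bar>g x\<bar> \<le> 2" using a1 le(5) unfolding e by linarith+
  thus "\<bar>f x * g x\<bar> \<le> 4" using mult_mono[of "\<bar>f x\<bar>" 2 "\<bar>g x\<bar>" 2] by (simp add: abs_mult)
qed

lemma integral_abs_bound:
  fixes h :: "real \<Rightarrow> real"
  assumes "continuous_on {0..pi} h" "\<And>x. x \<in> {0..pi} \<Longrightarrow> \<bar>h x\<bar> \<le> B"
  shows "\<bar>integral {0..pi} h\<bar> \<le> pi * B"
  using integral_bound[of 0 pi h B] assms by (simp add: mult.commute)

lemma integral_product_near_sine:
  assumes f: "near_sine \<eta> n f f1" and g: "near_sine \<eta> n g g1" and n: "n \<ge> 1" "n \<in> \<int>" and \<eta>: "\<eta> \<le> 1"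
    and cf: "continuous_on {0..pi} f" and cg: "continuous_on {0..pi} g"
  shows "\<bar>integral {0..pi} (\<lambda>x. f x * g x) - pi / 2\<bar> \<le> 3 * pi * \<eta> / n"
proof -
  have "integral {0..pi} (\<lambda>x. f x * g x) - pi / 2 = integral {0..pi} (\<lambda>x. f x * g x - sin (n * x) * sin (n * x))"
    using integral_sin_sq[OF n(2)] n(1)
    by (subst integral_diff) (auto intro!: integrable_continuous_real continuous_intros cf cg)
  also have "\<bar>\<dots>\<bar> \<le> pi * (3 * \<eta> / n)"
    by (intro integral_abs_bound product_near_sine_sq(1)[OF f g n(1) \<eta>] continuous_intros cf cg)
  finally show ?thesis by (simp add: mult_ac)
qed

lemma integral_product_near_sine_pos:
  assumes f: "near_sine \<eta> n f f1" and g: "near_sine \<eta> n g g1" and n: "n \<ge> 1" "n \<in> \<int>" and \<eta>: "\<eta> \<le> 1/20"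
    and cf: "continuous_on {0..pi} f" and cg: "continuous_on {0..pi} g"
  shows "integral {0..pi} (\<lambda>x. f x * g x) \<ge> pi / 4"
proof -
  have \<eta>0: "\<eta> \<ge> 0" using near_sineD(2)[OF f, of 0] by (auto)
  have "3 * pi * \<eta> / n \<le> 3 * pi * \<eta>" using divide_left_mono[of 1 n "3 * pi * \<eta>"] n \<eta>0 by simp
  also have "\<dots> \<le> pi / 4" using mult_left_mono[OF \<eta>, of "3 * pi"] pi_bounds by simp
  finally show ?thesis using integral_product_near_sine[OF f g n _ cf cg] \<eta> by linarith
qed

text \<open>Continuous dependence of the boundary value on the energy. The difference of the two solutions
starts with zero value and zero slope and is an oscillator forced by \<open>(V - \<mu>) h - (\<mu> - \<nu>) g\<close>.\<close>

lemma sl_solution_boundary_lipschitz: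
  assumes V: "small_potential V" and n: "n \<ge> (1::real)"
    and f: "sl_solution V (n\<^sup>2 + \<mu>) f f1" "f1 0 = n" "\<bar>\<mu>\<bar> \<le> 2 * small_size"
    and g: "sl_solution V (n\<^sup>2 + \<nu>) g g1" "g1 0 = n" "\<bar>\<nu>\<bar> \<le> 2 * small_size"
  shows "\<bar>f pi - g pi\<bar> \<le> 4 * pi * \<bar>\<mu> - \<nu>\<bar>"
proof -
  define h where "h = (\<lambda>x. f x - g x)"
  define p where "p = (\<lambda>x. (V x - \<mu>) * h x - (\<mu> - \<nu>) * g x)"
  have ch: "continuous_on {0..pi} h" unfolding h_def
    by (intro continuous_intros sl_solution_continuous[OF f(1)] sl_solution_continuous[OF g(1)])
  obtain z where z: "z \<in> {0..pi}" "\<And>x. x \<in> {0..pi} \<Longrightarrow> \<bar>h x\<bar> \<le> \<bar>h z\<bar>"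
    using attains_abs_sup[OF ch] by blast
  have q: "\<bar>V x - \<mu>\<bar> \<le> 3 * small_size" "\<bar>V x - (n\<^sup>2 + \<nu>) + n\<^sup>2\<bar> \<le> 3 * small_size" for x
    using small_potential_bound[OF V, of x] f(3) g(3) by linarith+
  have s: "pi * (3 * small_size) \<le> 1 / 2" using pi_bounds by (simp add: small_size_def)
  have g2: "\<bar>g x\<bar> \<le> 2" if "x \<in> {0..pi}" for x
    by (rule sl_solution_near_sine(3)[OF g(1) n g(2) q(2) s that])
  have P: "\<bar>p x\<bar> \<le> 3 * small_size * \<bar>h z\<bar> + 2 * \<bar>\<mu> - \<nu>\<bar>" if x: "x \<in> {0..pi}" for x
  proof -
    have "\<bar>(V x - \<mu>) * h x\<bar> \<le> 3 * small_size * \<bar>h z\<bar>"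
      using mult_mono[OF q(1)[of x] z(2)[OF x]] by (simp add: abs_mult small_size_def)
    moreover have "\<bar>(\<mu> - \<nu>) * g x\<bar> \<le> \<bar>\<mu> - \<nu>\<bar> * 2"
      unfolding abs_mult using g2[OF x] by (intro mult_left_mono) auto
    ultimately show ?thesis unfolding p_def by linarith
  qed
  have b: "\<bar>n * h x - (f1 0 - g1 0) * sin (n * x)\<bar> \<le> pi * (3 * small_size * \<bar>h z\<bar> + 2 * \<bar>\<mu> - \<nu>\<bar>)" if "x \<in> {0..pi}" for x
  proof (rule oscillator_bound(1)[where f = h and ?f1.0 = "\<lambda>x. f1 x - g1 x" and p = p, OF _ _ _ _ P that])
    show "n > 0" "h 0 = 0" using n f(1) g(1) by (auto simp: h_def sl_solution_def)
    fix x assume x: "x \<in> {0..pi}"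
    show "(h has_real_derivative f1 x - g1 x) (at x within {0..pi})"
      unfolding h_def using f(1) g(1) x by (auto simp: sl_solution_def intro!: derivative_eq_intros)
    have "(V x - (n\<^sup>2 + \<mu>)) * f x - (V x - (n\<^sup>2 + \<nu>)) * g x = p x - n\<^sup>2 * h x"
      by (simp add: p_def h_def algebra_simps)
    thus "((\<lambda>x. f1 x - g1 x) has_real_derivative p x - n\<^sup>2 * h x) (at x within {0..pi})"
      using f(1) g(1) x by (auto simp: sl_solution_def intro!: derivative_eq_intros)
  qed
  have "1 * \<bar>h z\<bar> \<le> n * \<bar>h z\<bar>" using n by (intro mult_right_mono) auto
  also have "\<dots> \<le> (pi * (3 * small_size)) * \<bar>h z\<bar> + 2 * pi * \<bar>\<mu> - \<nu>\<bar>"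
    using b[OF z(1)] f(2) g(2) n by (simp add: abs_mult algebra_simps)
  also have "\<dots> \<le> 1/2 * \<bar>h z\<bar> + 2 * pi * \<bar>\<mu> - \<nu>\<bar>" using s by (intro add_right_mono mult_right_mono) auto
  finally have "\<bar>h z\<bar> \<le> 4 * pi * \<bar>\<mu> - \<nu>\<bar>" by simp
  thus ?thesis using z(2)[of pi] by (simp add: h_def)
qed

text \<open>Testing the equation with \<open>sin (n x)\<close> expresses the boundary value as the integral of
\<open>(V - \<mu>) f sin (n x)\<close>. Since \<open>f\<close> is close to \<open>sin (n x)\<close>, this has the sign of \<open>V - \<mu>\<close> as soon as that
sign is constant with a margin.\<close>

lemma sl_solution_boundary_sign:
  assumes V: "small_potential V" and n: "n \<ge> 1" "n \<in> \<int>"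
    and f: "sl_solution V (n\<^sup>2 + \<mu>) f f1" "f1 0 = n" "\<bar>\<mu>\<bar> \<le> 2 * small_size"
    and \<sigma>: "\<sigma> = 1 \<or> \<sigma> = -1" "\<And>x. \<sigma> * (V x - \<mu>) \<le> - small_size"
  shows "\<sigma> * (f pi * cos (n * pi)) > 0"
proof -
  note c = sl_solution_continuous[OF f(1)] small_potential_continuous[OF V]
  define \<eta> where "\<eta> = 2 * pi * ((1 + 2) * small_size)"
  have near: "near_sine \<eta> n f f1"
    unfolding \<eta>_def by (rule sl_solution_near_sine_small[OF V f(1) n(1) f(2)]) (use f(3) in auto)
  have \<eta>: "\<eta> \<ge> 0" "\<eta> \<le> 1/300" unfolding \<eta>_def using pi_bounds by (auto simp: small_size_def)
  have sp: "sin (n * pi) = 0" using n(2) by (auto simp: sin_zero_iff_int2 Ints_def)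
  have "((\<lambda>x. \<sigma> * ((V x - \<mu>) * f x * sin (n * x))) has_integral
     \<sigma> * (f1 pi * sin (n * pi) - f pi * (n * cos (n * pi))) - \<sigma> * (f1 0 * sin (n * 0) - f 0 * (n * cos (n * 0)))) {0..pi}"
  proof (rule fundamental_theorem_of_calculus)
    fix x assume "x \<in> {0..pi}"
    hence d: "(f has_real_derivative f1 x) (at x within {0..pi})"
        "(f1 has_real_derivative (V x - (n\<^sup>2 + \<mu>)) * f x) (at x within {0..pi})"
      using f(1) by (auto simp: sl_solution_def)
    show "((\<lambda>x. \<sigma> * (f1 x * sin (n * x) - f x * (n * cos (n * x)))) has_vector_derivative
         \<sigma> * ((V x - \<mu>) * f x * sin (n * x))) (at x within {0..pi})"
      unfolding has_real_derivative_iff_has_vector_derivative[symmetric]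
      by (rule derivative_eq_intros d refl | simp)+ (simp add: algebra_simps power2_eq_square)
  qed simp
  hence "((\<lambda>x. \<sigma> * ((V x - \<mu>) * f x * sin (n * x))) has_integral - (n * (\<sigma> * (f pi * cos (n * pi))))) {0..pi}"
    using f(1) sp by (simp add: sl_solution_def mult_ac)
  hence i: "integral {0..pi} (\<lambda>x. \<sigma> * ((V x - \<mu>) * f x * sin (n * x))) = - (n * (\<sigma> * (f pi * cos (n * pi))))"
    by (rule integral_unique)
  have "integral {0..pi} (\<lambda>x. \<sigma> * ((V x - \<mu>) * f x * sin (n * x)))
      \<le> integral {0..pi} (\<lambda>x. 3 * small_size * \<eta> - small_size * (sin (n * x) * sin (n * x)))"
  proof (rule integral_le)
    fix x assume x: "x \<in> {0..pi}"
    have q: "\<bar>\<sigma> * (V x - \<mu>)\<bar> \<le> 3 * small_size"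
      using small_potential_bound[OF V, of x] f(3) \<sigma>(1) by (auto simp: abs_if split: if_splits)
    have n1: "\<eta> / n \<le> \<eta>" using n(1) \<eta>(1) divide_left_mono[of 1 n \<eta>] by simp
    have fs: "\<bar>f x - sin (n * x)\<bar> \<le> \<eta>" using near_sineD(1)[OF near x] n1 by linarith
    have "\<bar>\<sigma> * (V x - \<mu>) * ((f x - sin (n * x)) * sin (n * x))\<bar> \<le> 3 * small_size * (\<eta> * 1)"
      unfolding abs_mult[of "\<sigma> * (V x - \<mu>)"] abs_mult[of "f x - sin (n * x)"]
      by (intro mult_mono q fs abs_sin_le_one) (auto simp: small_size_def \<eta>)
    moreover have "\<sigma> * (V x - \<mu>) * (sin (n * x) * sin (n * x)) \<le> - small_size * (sin (n * x) * sin (n * x))"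
      by (intro mult_right_mono \<sigma>) auto
    moreover have "\<sigma> * ((V x - \<mu>) * f x * sin (n * x)) =
      \<sigma> * (V x - \<mu>) * ((f x - sin (n * x)) * sin (n * x)) + \<sigma> * (V x - \<mu>) * (sin (n * x) * sin (n * x))"
      by (simp add: algebra_simps)
    ultimately show "\<sigma> * ((V x - \<mu>) * f x * sin (n * x)) \<le> 3 * small_size * \<eta> - small_size * (sin (n * x) * sin (n * x))"
      by linarith
  qed (intro integrable_continuous_real continuous_intros c)+
  also have "\<dots> = 3 * small_size * \<eta> * pi - small_size * (pi / 2)"
    using n by (subst integral_diff) (auto intro!: integrable_continuous_real continuous_intros simp: integral_sin_sq)
  also have "\<dots> < 0" using \<eta> pi_bounds by (simp add: small_size_def)
  finally have "n * (\<sigma> * (f pi * cos (n * pi))) > 0" unfolding i by simp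
  thus ?thesis using n(1) by (simp add: zero_less_mult_iff)
qed

text \<open>Shooting: at \<open>\<mu> = 2 small_size\<close> and \<open>\<mu> = - 2 small_size\<close> the boundary values have opposite
signs, and the intermediate value theorem gives an energy in between that meets the boundary
condition.\<close>

lemma dirichlet_solution_exists:
  assumes V: "small_potential V" and n: "n \<ge> 1" "n \<in> \<int>"
  shows "\<exists>E. \<bar>E - n\<^sup>2\<bar> \<le> 2 * small_size \<and> (\<exists>f f1. dirichlet_solution V E f f1 \<and> f1 0 = n)"
proof -
  have "\<exists>f f1. sl_solution V (n\<^sup>2 + \<mu>) f f1 \<and> f1 0 = n" if "\<bar>\<mu>\<bar> \<le> 2 * small_size" for \<mu>
  proof (rule sl_solution_exists[OF small_potential_continuous[OF V] n(1)])
    show "\<bar>V x - (n\<^sup>2 + \<mu>) + n\<^sup>2\<bar> \<le> 3 * small_size" for x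
      using small_potential_bound[OF V, of x] that by linarith
    show "pi * (3 * small_size) \<le> 1/2" using pi_bounds by (simp add: small_size_def)
  qed
  then obtain F F1 where F: "\<And>\<mu>. \<bar>\<mu>\<bar> \<le> 2 * small_size \<Longrightarrow> sl_solution V (n\<^sup>2 + \<mu>) (F \<mu>) (F1 \<mu>) \<and> F1 \<mu> 0 = n"
    by metis
  let ?I = "{- (2 * small_size)..2 * small_size}"
  have s0: "small_size > 0" by (simp add: small_size_def)
  have "(4 * pi)-lipschitz_on ?I (\<lambda>\<mu>. F \<mu> pi)"
  proof (rule lipschitz_onI)
    fix \<mu> \<nu> assume "\<mu> \<in> ?I" "\<nu> \<in> ?I"
    thus "dist (F \<mu> pi) (F \<nu> pi) \<le> 4 * pi * dist \<mu> \<nu>"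
      unfolding dist_real_def using F[of \<mu>] F[of \<nu>]
      by (intro sl_solution_boundary_lipschitz[OF V n(1), of \<mu> "F \<mu>" "F1 \<mu>" \<nu> "F \<nu>" "F1 \<nu>"]) auto
  qed auto
  hence cont: "continuous_on ?I (\<lambda>\<mu>. F \<mu> pi * cos (n * pi))"
    by (intro continuous_intros) (rule lipschitz_on_continuous_on)
  have m: "\<bar>2 * small_size\<bar> \<le> 2 * small_size" "\<bar>- (2 * small_size)\<bar> \<le> 2 * small_size" using s0 by auto
  have up: "1 * (F (2 * small_size) pi * cos (n * pi)) > 0"
  proof (rule sl_solution_boundary_sign[OF V n conjunct1[OF F[OF m(1)]] conjunct2[OF F[OF m(1)]] m(1)])
    show "1 * (V x - 2 * small_size) \<le> - small_size" for x
      using small_potential_bound[OF V, of x] by (simp add: abs_le_iff)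
  qed auto
  have lo: "-1 * (F (- (2 * small_size)) pi * cos (n * pi)) > 0"
  proof (rule sl_solution_boundary_sign[OF V n conjunct1[OF F[OF m(2)]] conjunct2[OF F[OF m(2)]] m(2)])
    show "-1 * (V x - - (2 * small_size)) \<le> - small_size" for x
      using small_potential_bound[OF V, of x] by (simp add: abs_le_iff)
  qed auto
  have "\<exists>\<mu>\<ge>- (2 * small_size). \<mu> \<le> 2 * small_size \<and> F \<mu> pi * cos (n * pi) = 0"
    by (rule IVT') (use up lo s0 cont in auto)
  then obtain \<mu> where \<mu>: "\<bar>\<mu>\<bar> \<le> 2 * small_size" "F \<mu> pi * cos (n * pi) = 0"
    by (metis abs_le_iff minus_le_iff)
  have "sin (n * pi) = 0" using n(2) by (auto simp: sin_zero_iff_int2 Ints_def)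
  hence "cos (n * pi) \<noteq> 0" using sin_cos_squared_add[of "n * pi"] by auto
  hence "F \<mu> pi = 0" using \<mu>(2) by simp
  hence "dirichlet_solution V (n\<^sup>2 + \<mu>) (F \<mu>) (F1 \<mu>) \<and> F1 \<mu> 0 = n"
    using F[OF \<mu>(1)] by (auto simp: dirichlet_solution_def)
  thus ?thesis using \<mu>(1) by (intro exI[of _ "n\<^sup>2 + \<mu>"]) auto
qed

text \<open>Two eigenfunctions near the same sine are not orthogonal, whereas the Wronskian identity with
\<open>V = W\<close> makes eigenfunctions for distinct energies orthogonal.\<close>

lemma dirichlet_solution_unique_energy:
  assumes V: "small_potential V" and n: "n \<ge> 1" "n \<in> \<int>"
    and f: "dirichlet_solution V E f f1" "f1 0 = n" "\<bar>E - n\<^sup>2\<bar> \<le> 26 * small_size"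
    and g: "dirichlet_solution V E' g g1" "g1 0 = n" "\<bar>E' - n\<^sup>2\<bar> \<le> 26 * small_size"
  shows "E = E'"
proof -
  have sl: "sl_solution V E f f1" "sl_solution V E' g g1" using f g by (auto simp: dirichlet_solution_def)
  let ?\<eta> = "2 * pi * ((1 + 26) * small_size)"
  have "?\<eta> \<le> 1/20" using pi_bounds by (simp add: small_size_def)
  from integral_product_near_sine_pos[OF sl_solution_near_sine_small[OF V sl(1) n(1) f(2,3)]
       sl_solution_near_sine_small[OF V sl(2) n(1) g(2,3)] n this
       sl_solution_continuous(1)[OF sl(1)] sl_solution_continuous(1)[OF sl(2)]]
  have "integral {0..pi} (\<lambda>x. f x * g x) \<noteq> 0" using pi_bounds by auto
  moreover have "(E - E') * integral {0..pi} (\<lambda>x. f x * g x) = 0"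
    using wronskian_identity[OF f(1) g(1) small_potential_continuous[OF V] small_potential_continuous[OF V]] by simp
  ultimately show ?thesis by simp
qed

section \<open>Weak and classical eigenfunctions, and completeness of the list of eigenvalues\<close>

text \<open>For a continuous potential the weak second derivative agrees almost everywhere with the continuous
function \<open>(V - \<mu>) f\<close>, so the first derivative is an integral of the latter and is classically
differentiable, also at the end points.\<close>

lemma H2_derivs_imp_sl_solution:
  assumes V: "continuous_on UNIV V" and h: "H2_derivs f f1 f2" "f 0 = 0"
    and ae: "AE x in lborel. x \<in> {0<..<pi} \<longrightarrow> - f2 x + V x * f x = \<mu> * f x"
  shows "sl_solution V \<mu> f f1"
proof -
  have df: "(f has_real_derivative f1 x) (at x within {0..pi})" if "x \<in> {0..pi}" for x
    using h that unfolding H2_derivs_def by blast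
  hence cf: "continuous_on {0..pi} f" by (meson DERIV_continuous continuous_on_eq_continuous_within)
  let ?g = "\<lambda>x. (V x - \<mu>) * f x"
  have cg: "continuous_on {0..pi} ?g"
    by (intro continuous_intros cf continuous_on_subset[OF V]) auto
  have m2: "(\<lambda>x. indicator {0..pi} x * f2 x) \<in> borel_measurable lborel"
    using conjunct1[OF h(1)[unfolded H2_derivs_def]] by (simp add: square_integrable_on_def set_borel_measurable_def)
  have f1x: "f1 x = f1 0 + integral {0..x} ?g" if x: "x \<in> {0..pi}" for x
  proof -
    have ig: "set_integrable lborel {0..x} ?g"
      by (rule borel_integrable_atLeastAtMost') (rule continuous_on_subset[OF cg], use x in auto)
    have "(LBINT t:{0..x}. f2 t) = (LBINT t:{0..x}. ?g t)"
      unfolding set_lebesgue_integral_def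
    proof (rule integral_cong_AE)
      have "(\<lambda>t. indicator {0..x} t * (indicator {0..pi} t * f2 t)) \<in> borel_measurable lborel"
        by (intro borel_measurable_times m2) auto
      also have "(\<lambda>t. indicator {0..x} t * (indicator {0..pi} t * f2 t)) = (\<lambda>t. indicator {0..x} t *\<^sub>R f2 t)"
        using x by (auto simp: indicator_def fun_eq_iff)
      finally show "(\<lambda>t. indicator {0..x} t *\<^sub>R f2 t) \<in> borel_measurable lborel" .
      show "(\<lambda>t. indicator {0..x} t *\<^sub>R ?g t) \<in> borel_measurable lborel"
        using ig by (simp add: set_integrable_def borel_measurable_integrable)
      have "AE t in lborel. t \<noteq> 0 \<and> t \<noteq> pi" by (simp add: AE_lborel_singleton)
      with ae show "AE t in lborel. indicator {0..x} t *\<^sub>R f2 t = indicator {0..x} t *\<^sub>R ?g t"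
        by eventually_elim (use x in \<open>auto simp: indicator_def algebra_simps\<close>)
    qed
    also have "\<dots> = integral {0..x} ?g" by (rule set_borel_integral_eq_integral(2)[OF ig])
    finally have e: "(LBINT t:{0..x}. f2 t) = integral {0..x} ?g" .
    have "f1 x = f1 0 + (LBINT t:{0..x}. f2 t)" using h x unfolding H2_derivs_def by blast
    thus ?thesis unfolding e .
  qed
  have "(f1 has_real_derivative ?g x) (at x within {0..pi})" if x: "x \<in> {0..pi}" for x
  proof -
    have "((\<lambda>x. f1 0 + integral {0..x} ?g) has_real_derivative ?g x) (at x within {0..pi})"
      using DERIV_add[OF DERIV_const[of "f1 0"] integral_has_real_derivative[OF cg x]] by simp
    thus ?thesis
      by (rule has_field_derivative_transform_within[where d = 1]) (simp, rule x, rule f1x[symmetric])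
  qed
  thus ?thesis using df h(2) unfolding sl_solution_def by blast
qed

lemma sl_solution_imp_H2_derivs:
  assumes V: "continuous_on UNIV V" and f: "sl_solution V \<mu> f f1"
  shows "H2_derivs f f1 (\<lambda>x. (V x - \<mu>) * f x)"
proof -
  note cf = sl_solution_continuous[OF f]
  let ?g = "\<lambda>x. (V x - \<mu>) * f x"
  have cg: "continuous_on {0..pi} ?g"
    by (intro continuous_intros cf continuous_on_subset[OF V]) auto
  have i: "set_integrable lborel {0..pi} ?g" "set_integrable lborel {0..pi} (\<lambda>x. (?g x)\<^sup>2)"
    by (intro borel_integrable_atLeastAtMost' continuous_intros cg)+
  have "square_integrable_on {0..pi} ?g"
    using i by (simp add: square_integrable_on_def set_borel_measurable_def set_integrable_def borel_measurable_integrable)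
  moreover have "f1 x = f1 0 + (LBINT t:{0..x}. ?g t)" if x: "x \<in> {0..pi}" for x
  proof -
    have "(?g has_integral f1 x - f1 0) {0..x}"
    proof (rule fundamental_theorem_of_calculus)
      fix y assume "y \<in> {0..x}"
      with x f have "(f1 has_real_derivative ?g y) (at y within {0..pi})" by (auto simp: sl_solution_def)
      hence "(f1 has_real_derivative ?g y) (at y within {0..x})"
        by (rule DERIV_subset) (use x in auto)
      thus "(f1 has_vector_derivative ?g y) (at y within {0..x})"
        by (simp add: has_real_derivative_iff_has_vector_derivative)
    qed (use x in auto)
    moreover have "set_integrable lborel {0..x} ?g"
      by (rule borel_integrable_atLeastAtMost') (rule continuous_on_subset[OF cg], use x in auto)
    ultimately show ?thesis by (simp add: set_borel_integral_eq_integral(2) integral_unique)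
  qed
  ultimately show ?thesis using f unfolding H2_derivs_def sl_solution_def by blast
qed

lemma dirichlet_eigenvalue_iff:
  assumes V: "continuous_on UNIV V"
  shows "dirichlet_eigenvalue V \<mu> \<longleftrightarrow> (\<exists>f f1. dirichlet_solution V \<mu> f f1 \<and> (\<exists>x\<in>{0<..<pi}. f x \<noteq> 0))"
proof
  assume "dirichlet_eigenvalue V \<mu>"
  thus "\<exists>f f1. dirichlet_solution V \<mu> f f1 \<and> (\<exists>x\<in>{0<..<pi}. f x \<noteq> 0)"
    unfolding dirichlet_eigenvalue_def dirichlet_solution_def using H2_derivs_imp_sl_solution[OF V] by blast
next
  assume "\<exists>f f1. dirichlet_solution V \<mu> f f1 \<and> (\<exists>x\<in>{0<..<pi}. f x \<noteq> 0)"
  then obtain f f1 where *: "sl_solution V \<mu> f f1" "f pi = 0" "\<exists>x\<in>{0<..<pi}. f x \<noteq> 0"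
    by (auto simp: dirichlet_solution_def)
  have "AE x in lborel. x \<in> {0<..<pi} \<longrightarrow> - ((V x - \<mu>) * f x) + V x * f x = \<mu> * f x"
    by (simp add: algebra_simps)
  moreover have "f 0 = 0" using * by (simp add: sl_solution_def)
  ultimately show "dirichlet_eigenvalue V \<mu>"
    unfolding dirichlet_eigenvalue_def using * sl_solution_imp_H2_derivs[OF V *(1)] by blast
qed

text \<open>A Poincare inequality with an explicit constant. The equation gives
\<open>\<integral> f'\<^sup>2 = \<integral> (E - V) f\<^sup>2 \<le> pi / 15 F\<^sup>2\<close> for \<open>E \<le> 1/16\<close>, where \<open>F\<close> is the maximum of \<open>\<bar>f\<bar>\<close>; on the other
hand \<open>F \<le> \<integral> \<bar>f'\<bar>\<close>, and \<open>\<bar>f'\<bar> \<le> pi / F f'\<^sup>2 + F / (4 pi)\<close> pointwise. Together they give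
\<open>F \<le> (pi\<^sup>2 / 15 + 1 / 4) F\<close> with a factor below 1.\<close>

lemma eigenvalue_lower_bound:
  assumes V: "small_potential V" and f: "dirichlet_solution V E f f1" and nz: "x0 \<in> {0..pi}" "f x0 \<noteq> 0"
  shows "E > 1 / 16"
proof (rule ccontr)
  assume "\<not> E > 1 / 16"
  hence E: "E \<le> 1 / 16" by simp
  have sl: "sl_solution V E f f1" "f 0 = 0" "f pi = 0" using f by (auto simp: dirichlet_solution_def sl_solution_def)
  note c = sl_solution_continuous[OF sl(1)] small_potential_continuous[OF V]
  obtain z where z: "z \<in> {0..pi}" "\<And>x. x \<in> {0..pi} \<Longrightarrow> \<bar>f x\<bar> \<le> \<bar>f z\<bar>"
    using attains_abs_sup[OF c(1)] by blast
  define F where "F = \<bar>f z\<bar>"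
  let ?h = "\<lambda>x. pi / F * (f1 x * f1 x) + F / (4 * pi)"
  let ?q = "\<lambda>x. (V x - E) * (f x * f x)"
  have F: "F > 0" unfolding F_def using z(2)[OF nz(1)] nz(2) by linarith
  have d: "(f has_real_derivative f1 x) (at x within {0..pi})"
     "(f1 has_real_derivative (V x - E) * f x) (at x within {0..pi})" if "x \<in> {0..pi}" for x
    using sl that by (auto simp: sl_solution_def)
  have "((\<lambda>x. f1 x * f1 x + (V x - E) * (f x * f x)) has_integral f pi * f1 pi - f 0 * f1 0) {0..pi}"
    by (rule fundamental_theorem_of_calculus)
       (auto simp: has_real_derivative_iff_has_vector_derivative[symmetric] algebra_simps intro!: derivative_eq_intros d)
  hence i0: "integral {0..pi} (\<lambda>x. f1 x * f1 x + (V x - E) * (f x * f x)) = 0"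
    using sl by (simp add: integral_unique)
  have i1: "integral {0..pi} (\<lambda>x. f1 x * f1 x + (V x - E) * (f x * f x)) =
      integral {0..pi} (\<lambda>x. f1 x * f1 x) + integral {0..pi} ?q"
    by (intro integral_add integrable_continuous_real continuous_intros c)
  have "integral {0..pi} (\<lambda>x. - (1/15 * (F * F))) \<le> integral {0..pi} ?q"
  proof (rule integral_le)
    fix x assume x: "x \<in> {0..pi}"
    have "f x * f x \<le> F * F" using mult_mono[OF z(2)[OF x] z(2)[OF x]] by (simp add: F_def abs_mult[symmetric])
    moreover have "V x - E \<ge> - (1/15)" using small_potential_bound[OF V, of x] E by (simp add: small_size_def)
    hence "(V x - E) * (f x * f x) \<ge> - (1/15) * (f x * f x)" by (intro mult_right_mono) auto
    ultimately show "- (1/15 * (F * F)) \<le> (V x - E) * (f x * f x)" by linarith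
  qed (intro integrable_continuous_real continuous_intros c)+
  moreover have "integral {0..pi} (\<lambda>x. - (1/15 * (F * F))) = - (pi / 15 * (F * F))" by simp
  ultimately have i2: "integral {0..pi} (\<lambda>x. f1 x * f1 x) \<le> pi / 15 * (F * F)" using i0 i1 by linarith
  have G: "?h integrable_on S" if "S = {0..z} \<or> S = {0..pi}" for S
  proof -
    have "?h integrable_on {0..y}" if "y \<le> pi" for y
      using that F by (intro integrable_continuous_real continuous_intros continuous_on_subset[OF c(2)]) auto
    thus ?thesis using that z(1) by auto
  qed
  have "\<bar>f z - f 0\<bar> \<le> integral {0..pi} ?h"
  proof -
    have "(f1 has_integral f z - f 0) {0..z}"
    proof (rule fundamental_theorem_of_calculus)
      fix y assume "y \<in> {0..z}"
      hence "(f has_real_derivative f1 y) (at y within {0..z})"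
        using DERIV_subset[OF d(1), of y "{0..z}"] z(1) by auto
      thus "(f has_vector_derivative f1 y) (at y within {0..z})"
        by (simp add: has_real_derivative_iff_has_vector_derivative)
    qed (use z in auto)
    hence "norm (integral {0..z} f1) = \<bar>f z - f 0\<bar>" by (simp add: integral_unique)
    moreover have "norm (integral {0..z} f1) \<le> integral {0..z} ?h"
    proof (rule integral_norm_bound_integral)
      show "f1 integrable_on {0..z}"
        by (intro integrable_continuous_real continuous_on_subset[OF c(2)]) (use z(1) in auto)
      show "?h integrable_on {0..z}"
        by (rule G) blast
      fix x
      \<comment> \<open>The weight \<open>pi / F\<close> balances the two terms of the final estimate.\<close>
      have "0 \<le> (2 * pi * \<bar>f1 x\<bar> - F)\<^sup>2" by simp
      hence "(4 * pi * F) * \<bar>f1 x\<bar> \<le> 4 * pi * pi * (f1 x * f1 x) + F * F"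
        by (simp add: power2_eq_square algebra_simps)
      hence "\<bar>f1 x\<bar> \<le> (4 * pi * pi * (f1 x * f1 x) + F * F) / (4 * pi * F)" using F by (simp add: field_simps)
      also have "\<dots> = pi / F * (f1 x * f1 x) + F / (4 * pi)" using F by (simp add: field_simps)
      finally show "norm (f1 x) \<le> pi / F * (f1 x * f1 x) + F / (4 * pi)" by simp
    qed
    moreover have "integral {0..z} ?h \<le> integral {0..pi} ?h"
      by (rule integral_subset_le, use z(1) in force, rule G, blast, rule G, blast, use F in simp)
    ultimately show ?thesis by linarith
  qed
  also have "\<dots> = pi / F * integral {0..pi} (\<lambda>x. f1 x * f1 x) + F / 4"
  proof -
    have "(\<lambda>x. pi / F * (f1 x * f1 x)) integrable_on {0..pi}"
      by (intro integrable_continuous_real continuous_intros c)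
    from integral_add[OF this integrable_const_ivl, of "F / (4 * pi)"] show ?thesis by simp
  qed
  also have "\<dots> \<le> pi / F * (pi / 15 * (F * F)) + F / 4"
    using F by (intro add_right_mono mult_left_mono i2) auto
  also have "\<dots> = (pi * pi / 15 + 1/4) * F" using F by (simp add: field_simps)
  also have "\<dots> < 1 * F"
  proof (intro mult_strict_right_mono F)
    have "pi * pi \<le> 3.2 * 3.2" using pi_bounds by (intro mult_mono) auto
    thus "pi * pi / 15 + 1/4 < 1" by simp
  qed
  finally show False using sl by (simp add: F_def)
qed

text \<open>Obtained from \<open>tan y \<ge> y\<close> at \<open>y / 2\<close>: \<open>sin y = 2 sin (y/2) cos (y/2) \<ge> y cos\<^sup>2 (y/2) \<ge> y / 2\<close>.\<close>

lemma abs_sin_pi_lower: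
  assumes "\<bar>t\<bar> \<le> 1 / 2" shows "\<bar>t\<bar> \<le> \<bar>sin (t * pi)\<bar>"
proof -
  have main: "y / 2 \<le> sin y" if y: "0 \<le> y" "y \<le> pi / 2" for y :: real
  proof (cases "y = 0")
    case False
    have h: "0 < y / 2" "y / 2 < pi / 2" using y False pi_gt_zero by auto
    have c: "cos (y / 2) > 0" using h by (intro cos_gt_zero) auto
    have "\<bar>y / 2\<bar> \<le> \<bar>tan (y / 2)\<bar>" by (rule abs_tan_ge) (use h in auto)
    moreover have "tan (y / 2) > 0" using h by (intro tan_gt_zero) auto
    ultimately have "y / 2 * cos (y / 2) \<le> sin (y / 2)" using h c by (simp add: tan_def field_simps)
    hence "2 * (y / 2 * cos (y / 2)) * cos (y / 2) \<le> 2 * sin (y / 2) * cos (y / 2)"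
      using c by (intro mult_right_mono) auto
    also have "\<dots> = sin y" using sin_double[of "y / 2"] by simp
    also have "2 * (y / 2 * cos (y / 2)) * cos (y / 2) = y / 2 * (1 + cos y)"
      using cos_double_cos[of "y / 2"] by (simp add: power2_eq_square field_simps)
    finally have "y / 2 * (1 + cos y) \<le> sin y" .
    moreover have "cos y \<ge> 0" using y by (intro cos_ge_zero) auto
    hence "y / 2 * 1 \<le> y / 2 * (1 + cos y)" using y by (intro mult_left_mono) auto
    ultimately show ?thesis by linarith
  qed auto
  have "\<bar>t\<bar> * pi / 2 \<le> sin (\<bar>t\<bar> * pi)" using assms by (intro main) auto
  also have "\<dots> \<le> \<bar>sin (t * pi)\<bar>" by (cases "t \<ge> 0") auto
  finally have "\<bar>t\<bar> * (pi / 2) \<le> \<bar>sin (t * pi)\<bar>" by simp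
  moreover have "\<bar>t\<bar> * 1 \<le> \<bar>t\<bar> * (pi / 2)" using pi_bounds by (intro mult_left_mono) auto
  ultimately show ?thesis by linarith
qed

text \<open>Every eigenvalue is accounted for. With \<open>k = sqrt E\<close>, an eigenfunction is close to
\<open>f1 0 * sin (k x) / k\<close>; its vanishing at \<open>pi\<close> forces \<open>sin (k pi)\<close> to be of size \<open>small_size / k\<close>, so
\<open>k\<close> lies that close to an integer, and squaring costs only a factor of order \<open>k\<close>.\<close>

lemma eigenvalue_near_square:
  assumes V: "small_potential V" and f: "dirichlet_solution V E f f1" and nz: "x0 \<in> {0..pi}" "f x0 \<noteq> 0"
  shows "f1 0 \<noteq> 0 \<and> (\<exists>n::nat. n \<ge> 1 \<and> \<bar>E - (real n)\<^sup>2\<bar> \<le> 26 * small_size)"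
proof -
  have sl: "sl_solution V E f f1" "f 0 = 0" "f pi = 0" using f by (auto simp: dirichlet_solution_def sl_solution_def)
  note c = sl_solution_continuous[OF sl(1)] small_potential_continuous[OF V]
  obtain z where z: "z \<in> {0..pi}" "\<And>x. x \<in> {0..pi} \<Longrightarrow> \<bar>f x\<bar> \<le> \<bar>f z\<bar>"
    using attains_abs_sup[OF c(1)] by blast
  define F where "F = \<bar>f z\<bar>"
  have F: "F > 0" unfolding F_def using z(2)[OF nz(1)] nz(2) by linarith
  have E: "E > 1 / 16" by (rule eigenvalue_lower_bound[OF V f nz])
  define k where "k = sqrt E"
  have k2: "k\<^sup>2 = E" using E by (simp add: k_def)
  have k: "k > 1 / 4" using E unfolding k_def by (intro real_less_rsqrt) (simp add: power2_eq_square)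
  define s where "s = pi * small_size"
  have s: "0 \<le> s" "s \<le> 1 / 1000" using pi_bounds by (auto simp: s_def small_size_def)
  have b: "\<bar>k * f x - f1 0 * sin (k * x)\<bar> \<le> pi * (small_size * F)" if "x \<in> {0..pi}" for x
  proof (rule oscillator_bound(1)[where f = f and ?f1.0 = f1 and p = "\<lambda>x. V x * f x", OF _ sl(2) _ _ _ that])
    show "k > 0" using k by simp
    fix x assume x: "x \<in> {0..pi}"
    show "(f has_real_derivative f1 x) (at x within {0..pi})" using sl x by (auto simp: sl_solution_def)
    show "(f1 has_real_derivative V x * f x - k\<^sup>2 * f x) (at x within {0..pi})"
      using sl x by (auto simp: sl_solution_def k2 algebra_simps)
    show "\<bar>V x * f x\<bar> \<le> small_size * F"
      using mult_mono[OF small_potential_bound[OF V, of x] z(2)[OF x]] by (simp add: abs_mult F_def small_size_def)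
  qed
  have bz: "k * F \<le> \<bar>f1 0\<bar> + s * F"
  proof -
    have "\<bar>k * f z\<bar> \<le> \<bar>f1 0 * sin (k * z)\<bar> + s * F" using b[OF z(1)] unfolding s_def by linarith
    moreover have "\<bar>f1 0 * sin (k * z)\<bar> \<le> \<bar>f1 0\<bar> * 1" unfolding abs_mult by (intro mult_left_mono) auto
    ultimately show ?thesis using k by (simp add: abs_mult F_def)
  qed
  have bp: "\<bar>f1 0\<bar> * \<bar>sin (k * pi)\<bar> \<le> s * F" using b[of pi] sl by (simp add: s_def abs_mult)
  have "s * F \<le> k / 2 * F" using s k F by (intro mult_right_mono) auto
  hence f10: "k / 2 * F \<le> \<bar>f1 0\<bar>" using bz by (simp add: field_simps)
  hence ne: "f1 0 \<noteq> 0" using k F by (auto simp: mult_le_0_iff)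
  have "k / 2 * F * \<bar>sin (k * pi)\<bar> \<le> s * F" using mult_right_mono[OF f10, of "\<bar>sin (k * pi)\<bar>"] bp by simp
  hence "(k / 2 * \<bar>sin (k * pi)\<bar>) * F \<le> s * F" by (simp add: mult_ac)
  hence sk: "k / 2 * \<bar>sin (k * pi)\<bar> \<le> s" using F by simp
  define m where "m = round k"
  define t where "t = k - real_of_int m"
  have t: "\<bar>t\<bar> \<le> 1 / 2" using of_int_round_abs_le[of k] by (simp add: t_def m_def abs_minus_commute)
  have "\<bar>sin (k * pi)\<bar> = \<bar>sin (t * pi)\<bar>"
  proof -
    have sm: "sin (real_of_int m * pi) = 0" by (auto simp: sin_zero_iff_int2)
    hence cm: "\<bar>cos (real_of_int m * pi)\<bar> = 1" using sin_cos_squared_add[of "real_of_int m * pi"]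
      by (auto simp: power2_eq_1_iff)
    have "k * pi = t * pi + real_of_int m * pi" by (simp add: t_def left_diff_distrib)
    hence "sin (k * pi) = sin (t * pi + real_of_int m * pi)" by simp
    also have "\<dots> = sin (t * pi) * cos (real_of_int m * pi)" by (simp add: sin_add sm)
    finally show ?thesis using cm by (simp add: abs_mult)
  qed
  hence "k / 2 * \<bar>t\<bar> \<le> k / 2 * \<bar>sin (k * pi)\<bar>" using abs_sin_pi_lower[OF t] k by (intro mult_left_mono) auto
  with sk have kt: "k * \<bar>t\<bar> \<le> 2 * s" by simp
  have "1/4 * \<bar>t\<bar> \<le> k * \<bar>t\<bar>" using k by (intro mult_right_mono) auto
  with kt have t8: "\<bar>t\<bar> \<le> 8 * s" by simp
  have mk: "real_of_int m = k - t" by (simp add: t_def)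
  have "real_of_int m > 0" using mk t8 s k by linarith
  hence m1: "m \<ge> 1" by simp
  have "E - (real_of_int m)\<^sup>2 = 2 * (k * t) - t * t" unfolding k2[symmetric] mk by (simp add: power2_eq_square algebra_simps)
  moreover have "\<bar>k * t\<bar> \<le> 2 * s" using kt k by (simp add: abs_mult)
  moreover have "\<bar>t * t\<bar> \<le> 1/2 * (8 * s)" unfolding abs_mult using t t8 by (intro mult_mono) auto
  ultimately have "\<bar>E - (real_of_int m)\<^sup>2\<bar> \<le> 8 * s" by linarith
  also have "\<dots> \<le> 26 * small_size" using pi_bounds by (simp add: s_def small_size_def)
  finally have "\<bar>E - (real (nat m))\<^sup>2\<bar> \<le> 26 * small_size" using m1 by simp
  moreover have "nat m \<ge> 1" using m1 by simp
  ultimately show ?thesis using ne by blast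
qed

section \<open>The eigenvalues as functions of the potential\<close>

text \<open>The choice is determined by \<open>dirichlet_solution_unique_energy\<close> when the potential is small and
\<open>n \<ge> 1\<close>.\<close>

definition eigval :: "(real \<Rightarrow> real) \<Rightarrow> nat \<Rightarrow> real" where
  "eigval V n = (SOME E. \<bar>E - (real n)\<^sup>2\<bar> \<le> 2 * small_size \<and>
     (\<exists>f f1. dirichlet_solution V E f f1 \<and> f1 0 = real n))"

lemma eigval_solution:
  assumes V: "small_potential V" and n: "n \<ge> 1"
  obtains f f1 where "dirichlet_solution V (eigval V n) f f1" "f1 0 = real n"
    "near_sine (1 / 300) (real n) f f1" "continuous_on {0..pi} f" "continuous_on {0..pi} f1"
    "\<bar>eigval V n - (real n)\<^sup>2\<bar> \<le> 2 * small_size"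
proof -
  have n': "real n \<ge> 1" "real n \<in> \<int>" using n by auto
  have *: "\<bar>eigval V n - (real n)\<^sup>2\<bar> \<le> 2 * small_size \<and>
     (\<exists>f f1. dirichlet_solution V (eigval V n) f f1 \<and> f1 0 = real n)"
    unfolding eigval_def by (rule someI_ex) (rule dirichlet_solution_exists[OF V n'])
  then obtain f f1 where f: "dirichlet_solution V (eigval V n) f f1" "f1 0 = real n" by blast
  hence sl: "sl_solution V (eigval V n) f f1" by (simp add: dirichlet_solution_def)
  have "near_sine (2 * pi * ((1 + 2) * small_size)) (real n) f f1"
    by (rule sl_solution_near_sine_small[OF V sl n'(1) f(2)]) (use * in auto)
  hence "near_sine (1/300) (real n) f f1"
    by (rule near_sine_mono) (use pi_bounds n in \<open>auto simp: small_size_def\<close>)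
  thus thesis using that f * sl_solution_continuous[OF sl] by blast
qed

lemma eigval_near_square:
  "small_potential V \<Longrightarrow> n \<ge> 1 \<Longrightarrow> \<bar>eigval V n - (real n)\<^sup>2\<bar> \<le> 2 * small_size"
  by (rule eigval_solution) auto

text \<open>An arbitrary eigenfunction is rescaled to have initial slope \<open>n\<close>, with \<open>n\<close> the integer found by
\<open>eigenvalue_near_square\<close>; uniqueness of the energy near \<open>n\<^sup>2\<close> then identifies its eigenvalue.\<close>

lemma eigval_is_dirichlet_spectrum:
  assumes V: "small_potential V"
  shows "is_dirichlet_spectrum V (eigval V)"
  unfolding is_dirichlet_spectrum_def
proof (intro conjI equalityI subsetI)
  show "strict_mono_on {1..} (eigval V)"
  proof (rule strict_mono_onI)
    fix m n :: nat assume mn: "m \<in> {1..}" "n \<in> {1..}" "m < n"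
    have "real m + 1 \<le> real n" using mn by linarith
    hence "(real m + 1)\<^sup>2 \<le> (real n)\<^sup>2" by (intro power_mono) auto
    hence "(real m)\<^sup>2 + 1 \<le> (real n)\<^sup>2" using mn by (simp add: power2_eq_square algebra_simps)
    thus "eigval V m < eigval V n"
    proof -
      have "small_size \<le> 1 / 6" by (simp add: small_size_def)
      thus ?thesis
        using eigval_near_square[OF V, of m] eigval_near_square[OF V, of n] mn \<open>(real m)\<^sup>2 + 1 \<le> (real n)\<^sup>2\<close>
        unfolding abs_le_iff by auto
    qed
  qed
  have cV: "continuous_on UNIV V" by (rule small_potential_continuous[OF V])
  fix E
  {
    assume "E \<in> eigval V ` {1..}"
    then obtain n where n: "n \<ge> 1" "E = eigval V n" by auto
    obtain f f1 where f: "dirichlet_solution V E f f1" "near_sine (1 / 300) (real n) f f1"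
      using eigval_solution[OF V n(1)] unfolding n(2) by blast
    \<comment> \<open>At the first maximum of \<open>sin (n x)\<close> the eigenfunction is close to 1, hence not zero.\<close>
    define x where "x = pi / (2 * real n)"
    have "pi * 1 < pi * (2 * real n)" using n(1) by (intro mult_strict_left_mono) auto
    hence x: "x \<in> {0<..<pi}" using n(1) by (auto simp: x_def divide_less_eq)
    have "(1/300) / real n \<le> 1/300" using n(1) by (simp add: field_simps)
    moreover have "sin (real n * x) = 1" using n(1) by (simp add: x_def)
    moreover have "\<bar>f x - sin (real n * x)\<bar> \<le> (1/300) / real n" using near_sineD(1)[OF f(2), of x] x by auto
    ultimately have "f x \<noteq> 0" by auto
    thus "E \<in> {\<mu>. dirichlet_eigenvalue V \<mu>}" using f(1) x dirichlet_eigenvalue_iff[OF cV] by blast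
  next
    assume "E \<in> {\<mu>. dirichlet_eigenvalue V \<mu>}"
    then obtain g g1 y where g0: "dirichlet_solution V E g g1" "y \<in> {0<..<pi}" "g y \<noteq> 0"
      unfolding dirichlet_eigenvalue_iff[OF cV] mem_Collect_eq by blast
    hence g: "dirichlet_solution V E g g1" "y \<in> {0..pi}" "g y \<noteq> 0" by simp_all
    from eigenvalue_near_square[OF V g] obtain n where
      n: "g1 0 \<noteq> 0" "n \<ge> 1" "\<bar>E - (real n)\<^sup>2\<bar> \<le> 26 * small_size" by blast
    define a where "a = real n / g1 0"
    have ga: "dirichlet_solution V E (\<lambda>x. a * g x) (\<lambda>x. a * g1 x)"
    proof -
      have "((\<lambda>x. a * g x) has_real_derivative a * g1 x) (at x within {0..pi})"
           "((\<lambda>x. a * g1 x) has_real_derivative (V x - E) * (a * g x)) (at x within {0..pi})" if "x \<in> {0..pi}" for x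
      proof -
        have d: "(g has_real_derivative g1 x) (at x within {0..pi})"
           "(g1 has_real_derivative (V x - E) * g x) (at x within {0..pi})"
          using g(1) that unfolding dirichlet_solution_def sl_solution_def by blast+
        show "((\<lambda>x. a * g x) has_real_derivative a * g1 x) (at x within {0..pi})"
           "((\<lambda>x. a * g1 x) has_real_derivative (V x - E) * (a * g x)) (at x within {0..pi})"
          using DERIV_cmult[OF d(1), of a] DERIV_cmult[OF d(2), of a] by (simp_all add: mult.left_commute)
      qed
      thus ?thesis using g(1) unfolding dirichlet_solution_def sl_solution_def by simp
    qed
    obtain f f1 where f: "dirichlet_solution V (eigval V n) f f1" "f1 0 = real n"
      "\<bar>eigval V n - (real n)\<^sup>2\<bar> \<le> 2 * small_size"
      using eigval_solution[OF V n(2)] by blast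
    have "E = eigval V n"
      by (rule dirichlet_solution_unique_energy[OF V, of "real n", OF _ _ ga _ n(3) f(1,2)])
         (use n f(3) in \<open>auto simp: a_def small_size_def\<close>)
    thus "E \<in> eigval V ` {1..}" using n(2) by auto
  }
qed

lemma eigval_diff_identity:
  assumes V: "small_potential V" and W: "small_potential W" and n: "n \<ge> 1"
  obtains f g f1 g1 where
    "(eigval V n - eigval W n) * integral {0..pi} (\<lambda>x. f x * g x) = integral {0..pi} (\<lambda>x. (V x - W x) * (f x * g x))"
    "near_sine (1 / 300) (real n) f f1" "near_sine (1 / 300) (real n) g g1"
    "\<And>x. x \<in> {0..pi} \<Longrightarrow> (f has_real_derivative f1 x) (at x within {0..pi})"
    "\<And>x. x \<in> {0..pi} \<Longrightarrow> (g has_real_derivative g1 x) (at x within {0..pi})"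
    "f 0 = 0" "f pi = 0" "g 0 = 0" "g pi = 0"
    "continuous_on {0..pi} f" "continuous_on {0..pi} g" "continuous_on {0..pi} f1" "continuous_on {0..pi} g1"
    "integral {0..pi} (\<lambda>x. f x * g x) \<ge> pi / 4"
proof -
  obtain f f1 where f: "dirichlet_solution V (eigval V n) f f1" "near_sine (1 / 300) (real n) f f1"
    "continuous_on {0..pi} f" "continuous_on {0..pi} f1" using eigval_solution[OF V n] by blast
  obtain g g1 where g: "dirichlet_solution W (eigval W n) g g1" "near_sine (1 / 300) (real n) g g1"
    "continuous_on {0..pi} g" "continuous_on {0..pi} g1" using eigval_solution[OF W n] by blast
  have fs: "\<And>x. x \<in> {0..pi} \<Longrightarrow> (f has_real_derivative f1 x) (at x within {0..pi})" "f 0 = 0" "f pi = 0"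
    using f(1) unfolding dirichlet_solution_def sl_solution_def by blast+
  have gs: "\<And>x. x \<in> {0..pi} \<Longrightarrow> (g has_real_derivative g1 x) (at x within {0..pi})" "g 0 = 0" "g pi = 0"
    using g(1) unfolding dirichlet_solution_def sl_solution_def by blast+
  have p: "integral {0..pi} (\<lambda>x. f x * g x) \<ge> pi / 4"
    by (rule integral_product_near_sine_pos[OF f(2) g(2) _ _ _ f(3) g(3)]) (use n in auto)
  show thesis
    by (rule that[OF wronskian_identity[OF f(1) g(1) small_potential_continuous[OF V] small_potential_continuous[OF W]]
         f(2) g(2) fs(1) gs(1) fs(2,3) gs(2,3) f(3) g(3) f(4) g(4) p])
qed

lemma eigval_lipschitz:
  assumes V: "small_potential V" and W: "small_potential W" and n: "n \<ge> 1"
    and d: "\<And>x. x \<in> {0..pi} \<Longrightarrow> \<bar>V x - W x\<bar> \<le> d"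
  shows "\<bar>eigval V n - eigval W n\<bar> \<le> 16 * d"
proof (rule eigval_diff_identity[OF V W n], goal_cases)
  case (1 f g f1 g1)
  have d0: "d \<ge> 0" using d[of 0] by (auto intro: order_trans[OF abs_ge_zero])
  have "\<bar>integral {0..pi} (\<lambda>x. (V x - W x) * (f x * g x))\<bar> \<le> pi * (d * 4)"
  proof (rule integral_abs_bound)
    fix x assume x: "x \<in> {0..pi}"
    have "\<bar>f x * g x\<bar> \<le> 4" by (rule product_near_sine_sq(3)[OF 1(2,3) _ _ x]) (use n in auto)
    thus "\<bar>(V x - W x) * (f x * g x)\<bar> \<le> d * 4" unfolding abs_mult[of "V x - W x"] by (intro mult_mono d x d0) auto
  qed (intro continuous_intros 1 small_potential_continuous[OF V] small_potential_continuous[OF W])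
  hence "\<bar>eigval V n - eigval W n\<bar> * integral {0..pi} (\<lambda>x. f x * g x) \<le> pi * (d * 4)"
    using 1(1) 1(14) pi_gt_zero by (metis abs_mult abs_of_nonneg divide_pos_pos less_imp_le order_trans zero_less_numeral)
  moreover have "\<bar>eigval V n - eigval W n\<bar> * (pi / 4) \<le> \<bar>eigval V n - eigval W n\<bar> * integral {0..pi} (\<lambda>x. f x * g x)"
    by (intro mult_left_mono 1) auto
  ultimately have "\<bar>eigval V n - eigval W n\<bar> * (pi / 4) \<le> pi * (d * 4)" by (rule order_trans[rotated])
  thus ?thesis by (simp add: field_simps)
qed

text \<open>The defect \<open>f g - sin\<^sup>2\<close> is of size \<open>\<eta> / n\<close> with derivative of size \<open>\<eta>\<close>. The trivial
estimate of the integral thus gives \<open>1 / n\<close>, and one integration by parts gives \<open>1 / m\<close>. Decay in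
both indices is what later makes the error kernel pass the Schur test.\<close>

lemma integral_cos_product_defect:
  fixes f g f1 g1 :: "real \<Rightarrow> real"
  assumes f: "near_sine \<eta> n f f1" and g: "near_sine \<eta> n g g1" and n: "n \<ge> 1" "n \<in> \<int>" and \<eta>: "\<eta> \<le> 1"
    and df: "\<And>x. x \<in> {0..pi} \<Longrightarrow> (f has_real_derivative f1 x) (at x within {0..pi})"
    and dg: "\<And>x. x \<in> {0..pi} \<Longrightarrow> (g has_real_derivative g1 x) (at x within {0..pi})"
    and c: "continuous_on {0..pi} f" "continuous_on {0..pi} g" "continuous_on {0..pi} f1" "continuous_on {0..pi} g1"
    and m: "m \<ge> 1" "m \<in> \<int>"
  shows "\<bar>integral {0..pi} (\<lambda>x. cos (2 * m * x) * (f x * g x - sin (n * x) * sin (n * x)))\<bar> \<le> 3 * pi * \<eta> / max m n"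
proof -
  let ?e = "\<lambda>x. f x * g x - sin (n * x) * sin (n * x)"
  let ?e1 = "\<lambda>x. f1 x * g x + f x * g1 x - 2 * n * sin (n * x) * cos (n * x)"
  have cc: "\<bar>cos (2 * m * x)\<bar> \<le> 1" "\<bar>sin (2 * m * x) / (2 * m)\<bar> \<le> 1 / (2 * m)" for x
    using m(1) by (auto simp: abs_divide divide_right_mono)
  have 1: "\<bar>integral {0..pi} (\<lambda>x. cos (2 * m * x) * ?e x)\<bar> \<le> pi * (1 * (3 * \<eta> / n))"
  proof (rule integral_abs_bound)
    fix x assume x: "x \<in> {0..pi}"
    show "\<bar>cos (2 * m * x) * ?e x\<bar> \<le> 1 * (3 * \<eta> / n)" unfolding abs_mult[of "cos (2 * m * x)"]
      by (intro mult_mono cc product_near_sine_sq(1)[OF f g n(1) \<eta> x]) auto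
  qed (intro continuous_intros c)
  have "((\<lambda>x. cos (2 * m * x) * ?e x + sin (2 * m * x) / (2 * m) * ?e1 x) has_integral
      sin (2 * m * pi) / (2 * m) * ?e pi - sin (2 * m * 0) / (2 * m) * ?e 0) {0..pi}"
  proof (rule fundamental_theorem_of_calculus)
    fix x assume x: "x \<in> {0..pi}"
    have d1: "((\<lambda>x. sin (2 * m * x) / (2 * m)) has_real_derivative cos (2 * m * x)) (at x within {0..pi})"
      using m(1) by (auto intro!: derivative_eq_intros)
    have d2: "(?e has_real_derivative ?e1 x) (at x within {0..pi})"
      by (rule derivative_eq_intros df[OF x] dg[OF x] refl | simp)+
    show "((\<lambda>x. sin (2 * m * x) / (2 * m) * ?e x) has_vector_derivative
       cos (2 * m * x) * ?e x + sin (2 * m * x) / (2 * m) * ?e1 x) (at x within {0..pi})"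
      using DERIV_mult[OF d1 d2] unfolding has_real_derivative_iff_has_vector_derivative[symmetric]
      by (simp add: mult.commute add.commute)
  qed simp
  moreover have "sin (2 * m * pi) = 0"
  proof -
    have "sin (m * pi) = 0" using m(2) by (auto simp: sin_zero_iff_int2 Ints_def)
    thus ?thesis using sin_double[of "m * pi"] by (simp add: mult.assoc)
  qed
  ultimately have "integral {0..pi} (\<lambda>x. cos (2 * m * x) * ?e x + sin (2 * m * x) / (2 * m) * ?e1 x) = 0"
    by (simp add: integral_unique)
  moreover have "integral {0..pi} (\<lambda>x. cos (2 * m * x) * ?e x + sin (2 * m * x) / (2 * m) * ?e1 x) =
     integral {0..pi} (\<lambda>x. cos (2 * m * x) * ?e x) + integral {0..pi} (\<lambda>x. sin (2 * m * x) / (2 * m) * ?e1 x)"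
    by (intro integral_add integrable_continuous_real continuous_intros c) (use m in auto)
  ultimately have e: "integral {0..pi} (\<lambda>x. cos (2 * m * x) * ?e x) = - integral {0..pi} (\<lambda>x. sin (2 * m * x) / (2 * m) * ?e1 x)"
    by linarith
  have 2: "\<bar>integral {0..pi} (\<lambda>x. sin (2 * m * x) / (2 * m) * ?e1 x)\<bar> \<le> pi * (1 / (2 * m) * (6 * \<eta>))"
  proof (rule integral_abs_bound)
    fix x assume x: "x \<in> {0..pi}"
    show "\<bar>sin (2 * m * x) / (2 * m) * ?e1 x\<bar> \<le> 1 / (2 * m) * (6 * \<eta>)" unfolding abs_mult[of "sin (2 * m * x) / (2 * m)"]
      by (intro mult_mono cc product_near_sine_sq(2)[OF f g n(1) \<eta> x]) (use m in auto)
  qed (intro continuous_intros c; use m in auto)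
  show ?thesis
  proof (cases "m \<le> n")
    case True thus ?thesis using 1 by (simp add: max_def mult_ac)
  next
    case False thus ?thesis using 2 unfolding e by (simp add: max_def mult_ac)
  qed
qed

text \<open>The Wronskian identity for the two potentials, with \<open>f g\<close> compared to \<open>sin\<^sup>2 (n x)\<close>, whose only
cosine mode besides the mean is \<open>2 n\<close>.\<close>

lemma eigval_cos_perturbation:
  assumes V: "small_potential V" and W: "small_potential W" and n: "n \<ge> 1" and m: "m \<ge> (1::nat)"
    and VW: "\<And>x. V x = W x + \<tau> * cos (2 * real m * x)"
  shows "\<bar>eigval V n - eigval W n + (if m = n then \<tau> / 2 else 0)\<bar> \<le> \<bar>\<tau>\<bar> * (3 / 50) / real (max m n)"
proof (rule eigval_diff_identity[OF V W n], goal_cases)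
  case (1 f g f1 g1)
  let ?d = "eigval V n - eigval W n + (if m = n then \<tau> / 2 else 0)"
  define I where "I = integral {0..pi} (\<lambda>x. f x * g x)"
  define D where "D = integral {0..pi} (\<lambda>x. cos (2 * real m * x) * (f x * g x - sin (n * x) * sin (n * x)))"
  have n': "real n \<ge> 1" "real n \<in> \<int>" "real m \<ge> 1" "real m \<in> \<int>" using n m by auto
  have D: "\<bar>D\<bar> \<le> 3 * pi * (1/300) / real (max m n)"
    unfolding D_def of_nat_max
    by (rule integral_cos_product_defect[OF 1(2,3) n'(1,2) _ 1(4,5) 1(10-13) n'(3,4)]) auto
  have I: "\<bar>I - pi / 2\<bar> \<le> 3 * pi * (1/300) / real n"
    unfolding I_def by (rule integral_product_near_sine[OF 1(2,3) n'(1,2) _ 1(10,11)]) auto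
  have I4: "I \<ge> pi / 4" using 1(14) by (simp add: I_def)
  have "integral {0..pi} (\<lambda>x. (V x - W x) * (f x * g x)) =
     integral {0..pi} (\<lambda>x. \<tau> * (cos (2 * real m * x) * (f x * g x - sin (n * x) * sin (n * x))
       + cos (2 * real m * x) * (sin (n * x) * sin (n * x))))"
    by (rule arg_cong[where f = "integral {0..pi}"]) (simp add: VW fun_eq_iff algebra_simps)
  also have "\<dots> = \<tau> * (D + integral {0..pi} (\<lambda>x. cos (2 * real m * x) * (sin (n * x) * sin (n * x))))"
    unfolding D_def integral_mult_right
    by (subst integral_add) (intro integrable_continuous_real continuous_intros 1 | simp)+
  also have "\<dots> = \<tau> * (D - (if m = n then pi / 4 else 0))"
    using integral_cos_sin_sq[of "real n" "real m"] n' by simp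
  finally have e: "(eigval V n - eigval W n) * I = \<tau> * (D - (if m = n then pi / 4 else 0))"
    using 1(1) by (simp add: I_def)
  have "?d * I = \<tau> * (D + (if m = n then (I - pi / 2) / 2 else 0))"
    unfolding distrib_right e by (cases "m = n") (simp_all add: field_simps)
  hence "\<bar>?d\<bar> * I = \<bar>\<tau>\<bar> * \<bar>D + (if m = n then (I - pi / 2) / 2 else 0)\<bar>"
    using I4 pi_gt_zero by (metis abs_mult abs_of_pos divide_pos_pos less_le_trans zero_less_numeral)
  also have "\<dots> \<le> \<bar>\<tau>\<bar> * (9/2 * pi * (1/300) / real (max m n))"
  proof (rule mult_left_mono)
    define Y where "Y = pi * (1/300) / real (max m n)"
    have h: "Y \<ge> 0" "\<bar>D\<bar> \<le> 3 * Y" "m = n \<Longrightarrow> \<bar>I - pi / 2\<bar> \<le> 3 * Y"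
      using D I by (auto simp: Y_def)
    have "\<bar>D + (I - pi / 2) / 2\<bar> \<le> 9/2 * Y" if "m = n"
      using h(2) h(3)[OF that] unfolding abs_le_iff by (simp add: field_simps)
    moreover have "\<bar>D\<bar> \<le> 9/2 * Y" using h(1,2) by linarith
    ultimately have "\<bar>D + (if m = n then (I - pi / 2) / 2 else 0)\<bar> \<le> 9/2 * Y" by simp
    thus "\<bar>D + (if m = n then (I - pi / 2) / 2 else 0)\<bar> \<le> 9/2 * pi * (1/300) / real (max m n)"
      by (simp add: Y_def)
  qed simp
  finally have "\<bar>?d\<bar> * I \<le> \<bar>\<tau>\<bar> * (9/2 * pi * (1/300) / real (max m n))" .
  moreover have "\<bar>?d\<bar> * (pi / 4) \<le> \<bar>?d\<bar> * I"
    by (intro mult_left_mono I4) auto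
  ultimately have "(pi / 4) * \<bar>?d\<bar> \<le> (pi / 4) * (\<bar>\<tau>\<bar> * (3/50) / real (max m n))"
    by (simp add: mult_ac)
  thus ?thesis by (subst (asm) mult_le_cancel_left_pos) auto
qed

lemma zero_small_potential: "small_potential (\<lambda>_. 0)"
  by (auto simp: small_potential_def small_size_def)

text \<open>The Wronskian identity against the zero potential, whose eigenfunction is exactly \<open>sin (n x)\<close>:
the integral of \<open>V sin\<^sup>2 (n x)\<close> is half the integral of \<open>V\<close> minus half the cosine coefficient.\<close>

lemma eigval_asymptotics:
  assumes V: "small_potential V" and n: "n \<ge> 1"
    and B: "\<bar>integral {0..pi} (\<lambda>x. V x * cos (2 * real n * x))\<bar> \<le> B"
  shows "\<bar>eigval V n - (real n)\<^sup>2 - integral {0..pi} V / pi\<bar> \<le> 1 / real n + B"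
proof -
  have n': "real n \<ge> 1" "real n \<in> \<int>" using n by auto
  obtain f f1 where f: "dirichlet_solution V (eigval V n) f f1" "near_sine (1 / 300) (real n) f f1"
    "continuous_on {0..pi} f" "\<bar>eigval V n - (real n)\<^sup>2\<bar> \<le> 2 * small_size" using eigval_solution[OF V n] by blast
  let ?s = "\<lambda>x. sin (real n * x)"
  define \<mu> where "\<mu> = eigval V n - (real n)\<^sup>2"
  have s: "dirichlet_solution (\<lambda>_. 0) ((real n)\<^sup>2) ?s (\<lambda>x. real n * cos (real n * x))"
    unfolding dirichlet_solution_def sl_solution_def
  proof (intro conjI ballI)
    show "sin (real n * pi) = 0" by (simp add: mult.commute)
  qed (auto intro!: derivative_eq_intros simp: power2_eq_square)
  have cV: "continuous_on {0..pi} V" by (rule small_potential_continuous[OF V])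
  have w: "\<mu> * integral {0..pi} (\<lambda>x. f x * ?s x) = integral {0..pi} (\<lambda>x. V x * (f x * ?s x))"
    using wronskian_identity[OF f(1) s cV continuous_on_const] by (simp add: \<mu>_def)
  define e where "e = (\<lambda>x. f x - ?s x)"
  have ce: "continuous_on {0..pi} e" unfolding e_def by (intro continuous_intros f)
  have fe: "f x * ?s x = e x * ?s x + ?s x * ?s x" for x by (simp add: e_def algebra_simps)
  have i1: "integral {0..pi} (\<lambda>x. f x * ?s x) = integral {0..pi} (\<lambda>x. e x * ?s x) + pi / 2"
    unfolding fe using integral_sin_sq[OF n'(2)] n by (subst integral_add) (intro integrable_continuous_real continuous_intros ce | simp)+
  have Vf: "V x * (f x * ?s x) = V x * (e x * ?s x) + (V x / 2 - V x * cos (2 * real n * x) / 2)" for x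
  proof -
    have s2: "?s x * ?s x = 1/2 - cos (2 * real n * x) / 2"
      using cos_double_sin[of "real n * x"] by (simp add: power2_eq_square mult.assoc diff_divide_distrib)
    show ?thesis unfolding fe s2 by (simp add: distrib_left right_diff_distrib)
  qed
  have i2: "integral {0..pi} (\<lambda>x. V x * (f x * ?s x)) = integral {0..pi} (\<lambda>x. V x * (e x * ?s x))
     + (integral {0..pi} V / 2 - integral {0..pi} (\<lambda>x. V x * cos (2 * real n * x)) / 2)"
  proof -
    have a: "(\<lambda>x. V x * (e x * ?s x)) integrable_on {0..pi}" "(\<lambda>x. V x / 2) integrable_on {0..pi}"
      "(\<lambda>x. V x * cos (2 * real n * x) / 2) integrable_on {0..pi}"
      by (intro integrable_continuous_real continuous_intros ce cV; simp)+
    show ?thesis unfolding Vf integral_add[OF a(1) integrable_diff[OF a(2,3)]] integral_diff[OF a(2,3)] by simp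
  qed
  have e1: "\<bar>e x * ?s x\<bar> \<le> (1/300) / real n" if x: "x \<in> {0..pi}" for x
  proof -
    have "\<bar>e x\<bar> * \<bar>?s x\<bar> \<le> ((1/300) / real n) * 1" unfolding e_def
      by (intro mult_mono near_sineD(1)[OF f(2) x]) auto
    thus ?thesis by (simp add: abs_mult)
  qed
  have b1: "\<bar>integral {0..pi} (\<lambda>x. e x * ?s x)\<bar> \<le> pi * ((1/300) / real n)"
    by (intro integral_abs_bound e1 continuous_intros ce)
  have b2: "\<bar>integral {0..pi} (\<lambda>x. V x * (e x * ?s x))\<bar> \<le> pi * (1 * ((1/300) / real n))"
  proof (intro integral_abs_bound continuous_intros ce cV)
    fix x assume x: "x \<in> {0..pi}"
    have "\<bar>V x\<bar> \<le> 1" using small_potential_bound[OF V, of x] by (simp add: small_size_def)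
    thus "\<bar>V x * (e x * ?s x)\<bar> \<le> 1 * ((1/300) / real n)" unfolding abs_mult[of "V x"]
      by (intro mult_mono e1 x) auto
  qed
  have b3: "\<bar>\<mu> * integral {0..pi} (\<lambda>x. e x * ?s x)\<bar> \<le> 1 * (pi * ((1/300) / real n))"
    unfolding abs_mult[of \<mu>] by (intro mult_mono b1) (use f(4) in \<open>auto simp: \<mu>_def small_size_def\<close>)
  have "(pi / 2) * (\<mu> - integral {0..pi} V / pi) = integral {0..pi} (\<lambda>x. V x * (e x * ?s x))
     - \<mu> * integral {0..pi} (\<lambda>x. e x * ?s x) - integral {0..pi} (\<lambda>x. V x * cos (2 * real n * x)) / 2"
    using w unfolding i1 i2 by (simp add: algebra_simps)
  hence "\<bar>(pi / 2) * (\<mu> - integral {0..pi} V / pi)\<bar> \<le> 2 * (pi * ((1/300) / real n)) + B / 2"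
    using b2 b3 B by (simp add: abs_le_iff)
  moreover have "2 * (pi * ((1/300) / real n)) \<le> (pi / 2) * (1 / real n)" using n by (simp add: field_simps)
  moreover have "B / 2 \<le> (pi / 2) * B"
    using pi_bounds order_trans[OF abs_ge_zero B] mult_right_mono[of "1/2" "pi/2" B] by simp
  ultimately have "(pi / 2) * \<bar>\<mu> - integral {0..pi} V / pi\<bar> \<le> (pi / 2) * (1 / real n + B)"
    by (simp add: abs_mult distrib_left)
  thus ?thesis unfolding \<mu>_def by (subst (asm) mult_le_cancel_left_pos) auto
qed

section \<open>A single Fourier mode that moves a given integer combination\<close>

lemma sum_inverse_sqrt: "(\<Sum>n=1..m. 1 / sqrt (real n)) \<le> 2 * sqrt (real m)"
proof (induction m)
  case (Suc m)
  have "1 / sqrt (real (Suc m)) \<le> 2 * (sqrt (real (Suc m)) - sqrt (real m))"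
  proof -
    define a b where "a = sqrt (real (Suc m))" and "b = sqrt (real m)"
    have ab: "a > 0" "b \<ge> 0" "a\<^sup>2 = b\<^sup>2 + 1" by (auto simp: a_def b_def)
    have "0 \<le> (a - b)\<^sup>2" by simp
    hence "1 \<le> 2 * (a - b) * a" using ab(3) by (simp add: power2_eq_square algebra_simps)
    thus ?thesis using ab(1) unfolding a_def[symmetric] b_def[symmetric] by (simp add: divide_le_eq)
  qed
  thus ?case using Suc by simp
qed simp

lemma sum_inverse_three_halves:
  assumes "m \<ge> 1"
  shows "(\<Sum>n=Suc m..m+k. 1 / (real n * sqrt (real n))) \<le> 2 / sqrt (real m) - 2 / sqrt (real (m + k))"
proof (induction k)
  case (Suc k)
  have "1 / (real (Suc (m+k)) * sqrt (real (Suc (m+k)))) \<le> 2 / sqrt (real (m+k)) - 2 / sqrt (real (Suc (m+k)))"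
  proof -
    define a b where "a = sqrt (real (Suc (m+k)))" and "b = sqrt (real (m+k))"
    have ab: "a > 0" "b > 0" "a\<^sup>2 = b\<^sup>2 + 1" using assms by (auto simp: a_def b_def)
    have ba: "b < a" by (simp add: a_def b_def)
    have ra: "real (Suc (m+k)) = a\<^sup>2" by (simp add: a_def)
    have "b * b + a * b \<le> 2 * (a * a)" using ba ab mult_mono[of b a b a] mult_mono[of a a b a] by linarith
    have "1 = (a - b) * (a + b)" using ab(3) by (simp add: power2_eq_square algebra_simps)
    moreover have "b * ((a - b) * (a + b)) \<le> 2 * (a * a) * (a - b)"
      using mult_right_mono[OF \<open>b * b + a * b \<le> 2 * (a * a)\<close>, of "a - b"] ba by (simp add: algebra_simps)
    ultimately have "b \<le> 2 * (a * a) * (a - b)" by simp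
    hence "b / (a * a * a * b) \<le> 2 * (a * a) * (a - b) / (a * a * a * b)"
      using ab(1,2) by (intro divide_right_mono) auto
    also have "\<dots> = 2 / b - 2 / a" using ab(1,2) by (simp add: field_simps)
    also have "b / (a * a * a * b) = 1 / (a\<^sup>2 * a)" using ab(1,2) by (simp add: power2_eq_square)
    finally have "1 / (a\<^sup>2 * a) \<le> 2 / b - 2 / a" .
    thus ?thesis unfolding ra using a_def b_def by simp
  qed
  thus ?case using Suc by simp
qed simp

text \<open>The Schur test for the kernel \<open>1 / max m n\<close> with the weight \<open>sqrt n\<close>: the indices below \<open>i\<close> and
those above \<open>i\<close> contribute \<open>2 / sqrt i\<close> each.\<close>

lemma schur_weight_sum:
  assumes A: "finite A" "\<And>n. n \<in> A \<Longrightarrow> n \<ge> 1" and i: "i \<ge> (1::nat)"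
  shows "(\<Sum>n\<in>A. 1 / (sqrt (real n) * real (max n i))) \<le> 4 / sqrt (real i)"
proof -
  obtain k where k: "\<And>n. n \<in> A \<Longrightarrow> n \<le> i + k"
    using A(1) by (metis finite_nat_set_iff_bounded_le trans_le_add2)
  have "(\<Sum>n\<in>A. 1 / (sqrt (real n) * real (max n i))) \<le> (\<Sum>n=1..i+k. 1 / (sqrt (real n) * real (max n i)))"
    by (rule sum_mono2) (use A k in auto)
  also have "{1..i+k} = {1..i} \<union> {Suc i..i+k}" using i by auto
  also have "(\<Sum>n\<in>\<dots>. 1 / (sqrt (real n) * real (max n i))) =
     (\<Sum>n=1..i. 1 / (sqrt (real n) * real (max n i))) + (\<Sum>n=Suc i..i+k. 1 / (sqrt (real n) * real (max n i)))"
    by (rule sum.union_disjoint) auto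
  also have "(\<Sum>n=1..i. 1 / (sqrt (real n) * real (max n i))) = (\<Sum>n=1..i. 1 / sqrt (real n)) / real i"
    unfolding sum_divide_distrib by (rule sum.cong) (auto simp: max_def)
  also have "(\<Sum>n=Suc i..i+k. 1 / (sqrt (real n) * real (max n i))) = (\<Sum>n=Suc i..i+k. 1 / (real n * sqrt (real n)))"
    by (rule sum.cong) (auto simp: max_def)
  also have "(\<Sum>n=1..i. 1 / sqrt (real n)) / real i + (\<Sum>n=Suc i..i+k. 1 / (real n * sqrt (real n)))
     \<le> 2 * sqrt (real i) / real i + 2 / sqrt (real i)"
  proof (rule add_mono)
    show "(\<Sum>n=1..i. 1 / sqrt (real n)) / real i \<le> 2 * sqrt (real i) / real i"
      by (intro divide_right_mono sum_inverse_sqrt) auto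
    have "2 / sqrt (real (i + k)) \<ge> 0" by simp
    thus "(\<Sum>n=Suc i..i+k. 1 / (real n * sqrt (real n))) \<le> 2 / sqrt (real i)"
      using sum_inverse_three_halves[OF i, of k] by linarith
  qed
  also have "2 * sqrt (real i) / real i = 2 / sqrt (real i)"
    using i by (simp add: field_simps real_sqrt_mult_self)
  finally show ?thesis by simp
qed

text \<open>Maximise \<open>\<bar>l n\<bar> sqrt n\<close>. The factor 4 depends neither on the set nor on the coefficients, which is
why a single smallness threshold for the potential serves all combinations.\<close>

lemma dominant_index_exists:
  fixes l :: "nat \<Rightarrow> int"
  assumes A: "finite A" "A \<noteq> {}" "\<And>n. n \<in> A \<Longrightarrow> n \<ge> 1"
  obtains i where "i \<in> A" "(\<Sum>n\<in>A. \<bar>real_of_int (l n)\<bar> / real (max n i)) \<le> 4 * \<bar>real_of_int (l i)\<bar>"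
proof -
  define w where "w = (\<lambda>n. \<bar>real_of_int (l n)\<bar> * sqrt (real n))"
  obtain i where i: "i \<in> A" "\<And>n. n \<in> A \<Longrightarrow> w n \<le> w i"
    using Max_in[of "w ` A"] Max_ge[of "w ` A"] A by (metis finite_imageI imageE image_is_empty imageI)
  have "(\<Sum>n\<in>A. \<bar>real_of_int (l n)\<bar> / real (max n i)) \<le> (\<Sum>n\<in>A. w i * (1 / (sqrt (real n) * real (max n i))))"
  proof (rule sum_mono)
    fix n assume n: "n \<in> A"
    have p: "sqrt (real n) > 0" "real (max n i) > 0" using A(3)[OF n] by auto
    have "\<bar>real_of_int (l n)\<bar> \<le> w i / sqrt (real n)" using i(2)[OF n] p by (simp add: w_def field_simps)
    hence "\<bar>real_of_int (l n)\<bar> / real (max n i) \<le> w i / sqrt (real n) / real (max n i)" by (intro divide_right_mono) auto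
    thus "\<bar>real_of_int (l n)\<bar> / real (max n i) \<le> w i * (1 / (sqrt (real n) * real (max n i)))" by (simp add: field_simps)
  qed
  also have "\<dots> = w i * (\<Sum>n\<in>A. 1 / (sqrt (real n) * real (max n i)))" by (simp only: sum_distrib_left)
  also have "\<dots> \<le> w i * (4 / sqrt (real i))"
    using schur_weight_sum[OF A(1,3) A(3)[OF i(1)]] by (intro mult_left_mono) (auto simp: w_def)
  also have "\<dots> = 4 * \<bar>real_of_int (l i)\<bar>" using A(3)[OF i(1)] by (simp add: w_def)
  finally show thesis using that i(1) by blast
qed

text \<open>Besides the frequencies there is a multiple of \<open>c\<close>, the limit of \<open>lam n - n\<^sup>2\<close>, and an integer
shift: these are what remains of frequencies with very large indices.\<close>

definition combination :: "(nat \<Rightarrow> real) \<Rightarrow> real \<Rightarrow> nat set \<Rightarrow> (nat \<Rightarrow> int) \<Rightarrow> int \<Rightarrow> int \<Rightarrow> real" where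
  "combination lam c A l m a = (\<Sum>n\<in>A. real_of_int (l n) * lam n) + real_of_int m * c + real_of_int a"

text \<open>The dominant mode moves the \<open>i\<close>-th term by half of \<open>\<bar>l i\<bar> \<bar>\<tau>\<bar>\<close>, all errors together amount to at
most \<open>24/100\<close> of \<open>\<bar>l i\<bar> \<bar>\<tau>\<bar>\<close>, and the mean does not change.\<close>

lemma combination_slope:
  assumes V: "small_potential V" and W: "small_potential W"
    and A: "finite A" "\<And>n. n \<in> A \<Longrightarrow> n \<ge> 1" and i: "i \<in> A" "l i \<noteq> 0"
    and dom: "(\<Sum>n\<in>A. \<bar>real_of_int (l n)\<bar> / real (max n i)) \<le> 4 * \<bar>real_of_int (l i)\<bar>"
    and VW: "\<And>x. V x = W x + \<tau> * cos (2 * real i * x)"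
  shows "\<bar>combination (eigval V) (integral {0..pi} V / pi) A l m a
          - combination (eigval W) (integral {0..pi} W / pi) A l m a\<bar> \<ge> \<bar>\<tau>\<bar> / 4"
proof -
  let ?d = "combination (eigval V) (integral {0..pi} V / pi) A l m a
    - combination (eigval W) (integral {0..pi} W / pi) A l m a"
  define e where "e = (\<lambda>n. eigval V n - eigval W n + (if i = n then \<tau> / 2 else 0))"
  have e: "\<bar>e n\<bar> \<le> \<bar>\<tau>\<bar> * (3 / 50) / real (max n i)" if "n \<in> A" for n
    unfolding e_def using eigval_cos_perturbation[OF V W A(2)[OF that] A(2)[OF i(1)] VW] by (simp add: max.commute)
  have cW: "continuous_on {0..pi} W" by (rule small_potential_continuous[OF W])
  have "integral {0..pi} V = integral {0..pi} W + integral {0..pi} (\<lambda>x. \<tau> * cos ((2 * real i) * x))"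
    unfolding VW by (intro integral_add integrable_continuous_real continuous_intros cW)
  also have "integral {0..pi} (\<lambda>x. \<tau> * cos ((2 * real i) * x)) = 0"
    using integral_cos_int[of "2 * real i"] A(2)[OF i(1)] by simp
  finally have m: "integral {0..pi} V = integral {0..pi} W" by simp
  have "(\<Sum>n\<in>A. real_of_int (l n) * (if i = n then \<tau> / 2 else 0)) = real_of_int (l i) * (\<tau> / 2)"
    using A(1) i(1) by (simp add: if_distrib[of "\<lambda>x. _ * x"] cong: if_cong)
  hence eq: "?d =
        (\<Sum>n\<in>A. real_of_int (l n) * e n) - real_of_int (l i) * (\<tau> / 2)"
    unfolding combination_def m e_def by (simp add: algebra_simps sum.distrib sum_subtractf)
  have "\<bar>\<Sum>n\<in>A. real_of_int (l n) * e n\<bar> \<le> (\<Sum>n\<in>A. \<bar>real_of_int (l n)\<bar> * (\<bar>\<tau>\<bar> * (3 / 50) / real (max n i)))"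
    by (rule order_trans[OF sum_abs sum_mono]) (unfold abs_mult, intro mult_left_mono e, auto)
  also have "\<dots> = (\<bar>\<tau>\<bar> * (3 / 50)) * (\<Sum>n\<in>A. \<bar>real_of_int (l n)\<bar> / real (max n i))"
    unfolding sum_distrib_left by (rule sum.cong) auto
  also have "\<dots> \<le> (\<bar>\<tau>\<bar> * (3 / 50)) * (4 * \<bar>real_of_int (l i)\<bar>)"
    by (intro mult_left_mono dom) auto
  finally have "\<bar>\<Sum>n\<in>A. real_of_int (l n) * e n\<bar> \<le> 24/100 * (\<bar>real_of_int (l i)\<bar> * \<bar>\<tau>\<bar>)" by (simp add: mult_ac)
  moreover have "\<bar>real_of_int (l i) * (\<tau> / 2)\<bar> = 1/2 * (\<bar>real_of_int (l i)\<bar> * \<bar>\<tau>\<bar>)" by (simp add: abs_mult)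
  ultimately have "\<bar>?d\<bar> \<ge> 1/4 * (\<bar>real_of_int (l i)\<bar> * \<bar>\<tau>\<bar>)"
    unfolding eq by linarith
  moreover have "1 * \<bar>\<tau>\<bar> \<le> \<bar>real_of_int (l i)\<bar> * \<bar>\<tau>\<bar>" using i(2) by (intro mult_right_mono) auto
  ultimately show ?thesis by linarith
qed

section \<open>Removing the largest index\<close>

text \<open>The weight of \<open>m\<close> is counted together with the coefficients \<open>l n\<close>, so that the bound is preserved when
a coefficient is moved from a frequency to the constant \<open>c\<close>.\<close>

definition admissible :: "nat \<Rightarrow> nat set \<Rightarrow> (nat \<Rightarrow> int) \<Rightarrow> int \<Rightarrow> bool" where
  "admissible r A l m \<longleftrightarrow> finite A \<and> A \<noteq> {} \<and> (\<forall>n\<in>A. n \<ge> 1 \<and> l n \<noteq> 0) \<and> \<bar>m\<bar> + (\<Sum>n\<in>A. \<bar>l n\<bar>) \<le> int r"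

text \<open>What the Borel-Cantelli lemma can deliver directly: only polynomially many index sets with a given
minimum satisfy the bound on the maximum.\<close>

definition nonresonant_in_range :: "(nat \<Rightarrow> real) \<Rightarrow> real \<Rightarrow> bool" where
  "nonresonant_in_range lam c \<longleftrightarrow> (\<forall>r K. \<exists>\<gamma>>0. \<exists>\<alpha>::nat. \<forall>A l m a. admissible r A l m \<longrightarrow>
      Max A \<le> (Min A + 1) ^ K \<longrightarrow> \<bar>combination lam c A l m a\<bar> \<ge> \<gamma> / real (Min A + 1) ^ \<alpha>)"

text \<open>Induction on the number of indices. If the largest index \<open>N\<close> exceeds \<open>(q + 1) ^ K\<close>, with \<open>q\<close> the
smallest, replace \<open>lam N\<close> by \<open>N\<^sup>2 + c\<close>. The error is at most \<open>r C / sqrt N\<close>, and \<open>K\<close> is chosen after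
the constants of the induction hypothesis so that this is at most half of the lower bound for the
remaining indices.\<close>

lemma nonresonant_all_ranges:
  assumes T: "nonresonant_in_range lam c" and C: "C > 0"
    and decay: "\<And>n. n \<ge> 1 \<Longrightarrow> \<bar>lam n - (real n)\<^sup>2 - c\<bar> \<le> C / sqrt (real n)"
  shows "\<exists>\<gamma>>0. \<exists>\<alpha>::nat. \<forall>A l m a. admissible r A l m \<longrightarrow> card A \<le> p \<longrightarrow>
      \<bar>combination lam c A l m a\<bar> \<ge> \<gamma> / real (Min A + 1) ^ \<alpha>"
proof (induction p)
  case 0
  show ?case by (rule exI[of _ 1]) (auto simp: admissible_def)
next
  case (Suc p)
  then obtain \<gamma> \<alpha> where g: "\<gamma> > 0" and IH: "\<And>A l m a. admissible r A l m \<Longrightarrow> card A \<le> p \<Longrightarrow>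
      \<bar>combination lam c A l m a\<bar> \<ge> \<gamma> / real (Min A + 1) ^ \<alpha>" by blast
  obtain j0 :: nat where "2 * real r * C / \<gamma> < 2 ^ j0" using real_arch_pow[of 2 "2 * real r * C / \<gamma>"] by auto
  moreover define j where "j = Suc j0"
  moreover have "(2::real) ^ j0 \<le> 2 ^ j" unfolding j_def by (intro power_increasing) auto
  ultimately have j: "2 * real r * C / \<gamma> < 2 ^ j" "j \<ge> 1" by (linarith, simp)
  \<comment> \<open>The square root of \<open>(q + 1) ^ K\<close> is \<open>(q + 1) ^ (\<alpha> + j)\<close>: the first factor matches the lower
    bound, the second one is at least \<open>2 ^ j\<close> and absorbs the constants.\<close>
  define K where "K = 2 * (\<alpha> + j)"
  obtain \<gamma>' \<alpha>' where g': "\<gamma>' > 0" and TK: "\<And>A l m a. admissible r A l m \<Longrightarrow> Max A \<le> (Min A + 1) ^ K \<Longrightarrow>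
      \<bar>combination lam c A l m a\<bar> \<ge> \<gamma>' / real (Min A + 1) ^ \<alpha>'"
    using T unfolding nonresonant_in_range_def by meson
  define \<gamma>'' \<alpha>'' where "\<gamma>'' = min (\<gamma> / 2) \<gamma>'" and "\<alpha>'' = max \<alpha> \<alpha>'"
  have weaken: "\<gamma>'' / real (q + 1) ^ \<alpha>'' \<le> b / real (q + 1) ^ \<beta>" if "\<gamma>'' \<le> b" "\<beta> \<le> \<alpha>''" for q b \<beta>
  proof (rule frac_le)
    show "real (q + 1) ^ \<beta> \<le> real (q + 1) ^ \<alpha>''" using that(2) by (intro power_increasing) auto
  qed (use that g g' in \<open>auto simp: \<gamma>''_def\<close>)
  show ?case
  proof (intro exI[of _ \<gamma>''] exI[of _ \<alpha>''] conjI allI impI)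
    show "\<gamma>'' > 0" using g g' by (simp add: \<gamma>''_def)
    fix A l m a assume adm: "admissible r A l m" and card: "card A \<le> Suc p"
    define q where "q = Min A"
    show "\<bar>combination lam c A l m a\<bar> \<ge> \<gamma>'' / real (Min A + 1) ^ \<alpha>''"
    proof (cases "Max A \<le> (Min A + 1) ^ K")
      case True
      show ?thesis by (rule order_trans[OF weaken TK[OF adm True]]) (auto simp: \<gamma>''_def \<alpha>''_def)
    next
      case False
      define N where "N = Max A"
      have A: "finite A" "A \<noteq> {}" "\<And>n. n \<in> A \<Longrightarrow> n \<ge> 1" "\<And>n. n \<in> A \<Longrightarrow> l n \<noteq> 0"
        using adm by (auto simp: admissible_def)
      have NA: "N \<in> A" and qA: "q \<in> A" using A by (auto simp: N_def q_def)
      have Nq: "N > (q + 1) ^ K" using False by (simp add: N_def q_def)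
      have q1: "q \<ge> 1" using A(3)[OF qA] .
      define B where "B = A - {N}"
      have lr: "\<bar>real_of_int (l N)\<bar> \<le> real r"
      proof -
        have "\<bar>l N\<bar> \<le> (\<Sum>n\<in>A. \<bar>l n\<bar>)" by (rule member_le_sum[OF NA]) (use A in auto)
        hence "\<bar>l N\<bar> \<le> int r" using adm by (auto simp: admissible_def)
        thus ?thesis by linarith
      qed
      have rem: "\<bar>real_of_int (l N) * (lam N - (real N)\<^sup>2 - c)\<bar> \<le> (\<gamma> / 2) / real (q + 1) ^ \<alpha>"
      proof -
        have "real ((q + 1) ^ K) \<le> real N" using Nq by linarith
        hence "(real (q + 1) ^ (\<alpha> + j))\<^sup>2 \<le> real N" by (simp add: K_def power_mult[symmetric] mult.commute)
        hence s: "real (q + 1) ^ (\<alpha> + j) \<le> sqrt (real N)" by (rule real_le_rsqrt)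
        have "\<bar>real_of_int (l N) * (lam N - (real N)\<^sup>2 - c)\<bar> \<le> real r * (C / sqrt (real N))"
          unfolding abs_mult by (intro mult_mono lr decay A NA) auto
        also have "\<dots> \<le> real r * (C / real (q + 1) ^ (\<alpha> + j))"
          using C s A(3)[OF NA] by (intro mult_left_mono divide_left_mono mult_pos_pos) auto
        also have "\<dots> = (real r * C / real (q + 1) ^ j) / real (q + 1) ^ \<alpha>" by (simp add: power_add field_simps)
        also have "\<dots> \<le> (\<gamma> / 2) / real (q + 1) ^ \<alpha>"
        proof (rule divide_right_mono)
          have "2 * real r * C < \<gamma> * 2 ^ j" using j(1) g by (simp add: field_simps)
          also have "\<dots> \<le> \<gamma> * real (q + 1) ^ j" using g q1 by (intro mult_left_mono power_mono) auto
          finally show "real r * C / real (q + 1) ^ j \<le> \<gamma> / 2" by (simp add: field_simps)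
        qed simp
        finally show ?thesis .
      qed
      have qN: "q < N"
      proof -
        have "(q + 1) ^ 1 \<le> (q + 1) ^ K" using j(2) by (intro power_increasing) (auto simp: K_def)
        thus ?thesis using Nq by simp
      qed
      have qB: "q \<in> B" using qA qN by (simp add: B_def)
      have MB: "Min B = q" using A qB unfolding B_def q_def
        by (intro Min_eqI) auto
      have sB: "(\<Sum>n\<in>A. g n) = g N + (\<Sum>n\<in>B. g n)" for g :: "nat \<Rightarrow> real"
        unfolding B_def by (rule sum.remove[OF A(1) NA])
      have sBi: "(\<Sum>n\<in>A. g n) = g N + (\<Sum>n\<in>B. g n)" for g :: "nat \<Rightarrow> int"
        unfolding B_def by (rule sum.remove[OF A(1) NA])
      have adB: "admissible r B l (m + l N)"
        using adm qB sBi[of "\<lambda>n. \<bar>l n\<bar>"] unfolding admissible_def by (auto simp: B_def)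
      have cB: "card B \<le> p" using card A(1) NA by (simp add: B_def)
      have "combination lam c A l m a = combination lam c B l (m + l N) (a + l N * (int N)\<^sup>2)
          + real_of_int (l N) * (lam N - (real N)\<^sup>2 - c)"
        unfolding combination_def sB by (simp add: algebra_simps)
      moreover have "\<bar>combination lam c B l (m + l N) (a + l N * (int N)\<^sup>2)\<bar> \<ge> \<gamma> / real (q + 1) ^ \<alpha>"
        using IH[OF adB cB] unfolding MB .
      ultimately have "\<bar>combination lam c A l m a\<bar> \<ge> \<gamma> / real (q + 1) ^ \<alpha> - (\<gamma> / 2) / real (q + 1) ^ \<alpha>"
        using rem by linarith
      also have "\<gamma> / real (q + 1) ^ \<alpha> - (\<gamma> / 2) / real (q + 1) ^ \<alpha> = (\<gamma> / 2) / real (q + 1) ^ \<alpha>"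
        unfolding diff_divide_distrib[symmetric] by simp
      finally have "(\<gamma> / 2) / real (q + 1) ^ \<alpha> \<le> \<bar>combination lam c A l m a\<bar>" .
      thus ?thesis unfolding q_def by (rule order_trans[OF weaken, rotated -1]) (auto simp: \<gamma>''_def \<alpha>''_def)
    qed
  qed
qed

lemma japanese_bracket_lower: "x \<ge> 0 \<Longrightarrow> (x + 1) / 2 \<le> japanese_bracket x"
  unfolding japanese_bracket_def
proof (rule real_le_rsqrt)
  assume "x \<ge> 0"
  have "0 \<le> (x - 1)\<^sup>2 + 2 * x\<^sup>2 + 2" by (intro add_nonneg_nonneg) auto
  thus "((x + 1) / 2)\<^sup>2 \<le> 1 + \<bar>x\<bar>\<^sup>2" by (simp add: power2_eq_square field_simps)
qed

lemma strongly_nonresonantI: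
  assumes T: "nonresonant_in_range lam c" and C: "C > 0"
    and decay: "\<And>n. n \<ge> 1 \<Longrightarrow> \<bar>lam n - (real n)\<^sup>2 - c\<bar> \<le> C / sqrt (real n)"
  shows "strongly_nonresonant lam"
  unfolding strongly_nonresonant_def
proof (intro allI impI)
  fix r :: real assume r: "r > 0"
  define R where "R = nat \<lfloor>r\<rfloor>"
  obtain \<gamma> \<alpha> where g: "\<gamma> > 0" and main: "\<And>A l m a. admissible R A l m \<Longrightarrow> card A \<le> R \<Longrightarrow>
      \<bar>combination lam c A l m a\<bar> \<ge> \<gamma> / real (Min A + 1) ^ \<alpha>"
    using nonresonant_all_ranges[OF T C decay, of R R] by blast
  show "\<exists>\<gamma> \<alpha> :: real. \<gamma> > 0 \<and> \<alpha> > 0 \<and>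
         (\<forall>(k::nat) (l :: nat \<Rightarrow> int) (n :: nat \<Rightarrow> nat).
            1 \<le> k \<and> real k \<le> r \<and>
            (\<forall>j\<in>{1..k}. l j \<noteq> 0) \<and> (\<forall>j\<in>{1..k}. n j \<ge> 1) \<and> inj_on n {1..k} \<and>
            real_of_int (\<Sum>j=1..k. \<bar>l j\<bar>) \<le> r \<and>
            mono_on {1..k} (\<lambda>j. japanese_bracket (real (n j)))
            \<longrightarrow> \<bar>\<Sum>j=1..k. real_of_int (l j) * lam (n j)\<bar>
                  \<ge> \<gamma> * japanese_bracket (real (n 1)) powr (- \<alpha>))"
  proof (rule exI[of _ "\<gamma> / 2 ^ Suc \<alpha>"], rule exI[of _ "real (Suc \<alpha>)"], intro conjI allI impI; (elim conjE)?)
    fix k :: nat and l :: "nat \<Rightarrow> int" and n :: "nat \<Rightarrow> nat"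
    assume k: "1 \<le> k" "real k \<le> r" and l: "\<forall>j\<in>{1..k}. l j \<noteq> 0" and n: "\<forall>j\<in>{1..k}. n j \<ge> 1"
      and inj: "inj_on n {1..k}" and sum: "real_of_int (\<Sum>j=1..k. \<bar>l j\<bar>) \<le> r"
      and mono: "mono_on {1..k} (\<lambda>j. japanese_bracket (real (n j)))"
    define A where "A = n ` {1..k}"
    define l' where "l' = (\<lambda>x. l (the_inv_into {1..k} n x))"
    have l': "l' (n j) = l j" if "j \<in> {1..k}" for j
      unfolding l'_def using the_inv_into_f_f[OF inj that] by simp
    have re: "(\<Sum>x\<in>A. h (l' x) x) = (\<Sum>j=1..k. h (l j) (n j))" for h :: "int \<Rightarrow> nat \<Rightarrow> 'b::comm_monoid_add"
      unfolding A_def sum.reindex[OF inj] by (rule sum.cong) (auto simp: l')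
    have "\<lfloor>real_of_int (\<Sum>j=1..k. \<bar>l j\<bar>)\<rfloor> \<le> \<lfloor>r\<rfloor>" using sum by (rule floor_mono)
    hence "(\<Sum>x\<in>A. \<bar>l' x\<bar>) \<le> \<lfloor>r\<rfloor>" unfolding floor_of_int using re[of "\<lambda>i _. \<bar>i\<bar>"] by simp
    hence adm: "admissible R A l' 0" unfolding admissible_def R_def
      using k n l l' r by (auto simp: A_def)
    have kR: "k \<le> R" using k(2) unfolding R_def by (simp add: le_nat_floor)
    have "card A \<le> k" unfolding A_def using card_image_le[of "{1..k}" n] by simp
    with kR have cA: "card A \<le> R" by simp
    have MA: "Min A = n 1"
    proof (rule Min_eqI)
      fix y assume "y \<in> A"
      then obtain j where j: "j \<in> {1..k}" "y = n j" by (auto simp: A_def)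
      have "japanese_bracket (real (n 1)) \<le> japanese_bracket (real (n j))"
        using mono_onD[OF mono, of 1 j] j(1) k(1) by auto
      thus "n 1 \<le> y" unfolding j(2) japanese_bracket_def by simp
    qed (use k in \<open>auto simp: A_def\<close>)
    define q where "q = n 1"
    have "\<gamma> / 2 ^ Suc \<alpha> * japanese_bracket (real q) powr (- real (Suc \<alpha>)) \<le> \<gamma> / real (q + 1) ^ \<alpha>"
    proof -
      have b: "(real q + 1) / 2 \<le> japanese_bracket (real q)" by (rule japanese_bracket_lower) simp
      have b0: "(real q + 1) / 2 > 0" by simp
      have "japanese_bracket (real q) powr (- real (Suc \<alpha>)) = 1 / japanese_bracket (real q) ^ Suc \<alpha>"
        using b b0 by (subst powr_minus_divide, subst powr_realpow) auto
      also have "\<dots> \<le> 1 / ((real q + 1) / 2) ^ Suc \<alpha>"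
        using b b0 by (intro divide_left_mono power_mono mult_pos_pos zero_less_power) auto
      also have "\<dots> = 2 ^ Suc \<alpha> / (real q + 1) ^ Suc \<alpha>" by (simp only: power_divide) simp
      finally have "\<gamma> / 2 ^ Suc \<alpha> * japanese_bracket (real q) powr (- real (Suc \<alpha>)) \<le> \<gamma> / 2 ^ Suc \<alpha> * (2 ^ Suc \<alpha> / (real q + 1) ^ Suc \<alpha>)"
        using g by (intro mult_left_mono) auto
      also have "\<dots> = \<gamma> / (real q + 1) ^ Suc \<alpha>" by simp
      also have "\<dots> \<le> \<gamma> / (real q + 1) ^ \<alpha>"
        using g by (intro divide_left_mono power_increasing mult_pos_pos) auto
      finally show ?thesis by (simp add: add.commute)
    qed
    also have "\<dots> \<le> \<bar>combination lam c A l' 0 0\<bar>" using main[OF adm cA, of 0] by (simp only: MA q_def)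
    also have "combination lam c A l' 0 0 = (\<Sum>j=1..k. real_of_int (l j) * lam (n j))"
      unfolding combination_def using re[of "\<lambda>i x. real_of_int i * lam x"] by simp
    finally show "\<gamma> / 2 ^ Suc \<alpha> * japanese_bracket (real (n 1)) powr (- real (Suc \<alpha>))
        \<le> \<bar>\<Sum>j=1..k. real_of_int (l j) * lam (n j)\<bar>" unfolding q_def .
  qed (use g in auto)
qed

section \<open>Random trigonometric potentials\<close>

definition trig :: "int \<Rightarrow> real \<Rightarrow> real" where
  "trig k x = (if k < 0 then sin (of_int k * x) else cos (of_int k * x))"

definition amplitude :: "real \<Rightarrow> int \<Rightarrow> real" where
  "amplitude s k = japanese_bracket (of_int k) powr (- s)"

definition partial_potential :: "real \<Rightarrow> (int \<Rightarrow> real) \<Rightarrow> nat \<Rightarrow> real \<Rightarrow> real" where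
  "partial_potential s v N x = (\<Sum>k\<in>{- int N..int N}. v k * amplitude s k * trig k x)"

text \<open>A bound for the sum of the absolute values of the Fourier amplitudes of the potential. It dominates
the supremum of the potential and of all its partial sums, and it is a countable conjunction of
conditions on finitely many coefficients, hence evidently measurable.\<close>

definition mass_bounded :: "real \<Rightarrow> (int \<Rightarrow> real) \<Rightarrow> real \<Rightarrow> bool" where
  "mass_bounded s v B \<longleftrightarrow> (\<forall>N. (\<Sum>k\<in>{- int N..int N}. \<bar>v k\<bar> * amplitude s k) \<le> B)"

lemma abs_trig_le: "\<bar>trig k x\<bar> \<le> 1"
  by (simp add: trig_def)

lemma trig_continuous [continuous_intros]: "continuous_on S (trig k)"
  unfolding trig_def by (cases "k < 0") (auto intro!: continuous_intros)

lemma japanese_bracket_ge_1: "japanese_bracket x \<ge> 1"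
  unfolding japanese_bracket_def by simp

lemma amplitude_pos: "amplitude s k > 0"
  unfolding amplitude_def using japanese_bracket_ge_1[of "of_int k"] by simp

lemma mass_bounded_summable:
  assumes "mass_bounded s v B"
  shows "(\<lambda>k. \<bar>v k\<bar> * amplitude s k) summable_on UNIV"
proof (rule nonneg_bdd_above_summable_on)
  show "bdd_above (sum (\<lambda>k. \<bar>v k\<bar> * amplitude s k) ` {F. F \<subseteq> UNIV \<and> finite F})"
  proof (rule bdd_aboveI2)
    fix F :: "int set" assume F: "F \<in> {F. F \<subseteq> UNIV \<and> finite F}"
    define N where "N = Max (insert 0 ((\<lambda>k. nat \<bar>k\<bar>) ` F))"
    have "F \<subseteq> {- int N..int N}"
    proof
      fix k assume "k \<in> F"
      hence "nat \<bar>k\<bar> \<le> N" unfolding N_def using F by (intro Max_ge) auto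
      thus "k \<in> {- int N..int N}" by auto
    qed
    hence "sum (\<lambda>k. \<bar>v k\<bar> * amplitude s k) F \<le> (\<Sum>k\<in>{- int N..int N}. \<bar>v k\<bar> * amplitude s k)"
      by (intro sum_mono2) (auto simp: less_imp_le[OF amplitude_pos])
    also have "\<dots> \<le> B" using assms by (simp add: mass_bounded_def)
    finally show "sum (\<lambda>k. \<bar>v k\<bar> * amplitude s k) F \<le> B" .
  qed
qed (auto simp: less_imp_le[OF amplitude_pos])

lemma symmetric_intervals_at_top:
  "filterlim (\<lambda>N. {- int N..int N}) (finite_subsets_at_top UNIV) sequentially"
  unfolding filterlim_finite_subsets_at_top
proof (intro allI impI)
  fix X :: "int set" assume X: "finite X \<and> X \<subseteq> UNIV"
  define N0 where "N0 = Max (insert 0 ((\<lambda>k. nat \<bar>k\<bar>) ` X))"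
  have "X \<subseteq> {- int N..int N}" if "N \<ge> N0" for N
  proof
    fix k assume "k \<in> X"
    hence "nat \<bar>k\<bar> \<le> N0" unfolding N0_def using X by (intro Max_ge) auto
    thus "k \<in> {- int N..int N}" using that by auto
  qed
  thus "\<forall>\<^sub>F N in sequentially. finite {- int N..int N} \<and> X \<subseteq> {- int N..int N} \<and> {- int N..int N} \<subseteq> UNIV"
    by (intro eventually_sequentiallyI[of N0]) auto
qed

text \<open>The Weierstrass test, with the two one-sided sums of the random potential merged into one sum over
all integers.\<close>

lemma partial_potential_uniform_limit:
  assumes v: "mass_bounded s v B"
  shows "uniform_limit UNIV (partial_potential s v) (random_potential s v) sequentially"
proof -
  let ?f = "\<lambda>k x. v k * amplitude s k * trig k x"
  have sm: "(\<lambda>k. \<bar>v k\<bar> * amplitude s k) summable_on UNIV" by (rule mass_bounded_summable[OF v])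
  have le: "norm (?f k x) \<le> \<bar>v k\<bar> * amplitude s k" for k x
    using mult_left_mono[OF abs_trig_le[of k x], of "\<bar>v k\<bar> * amplitude s k"] amplitude_pos[of s k]
    by (simp add: abs_mult)
  have "uniform_limit UNIV (\<lambda>X x. \<Sum>k\<in>X. ?f k x) (\<lambda>x. \<Sum>\<^sub>\<infinity>k. ?f k x) (finite_subsets_at_top UNIV)"
    by (rule Weierstrass_m_test_general[OF le sm])
  hence "uniform_limit UNIV (\<lambda>N. (\<lambda>X x. \<Sum>k\<in>X. ?f k x) {- int N..int N}) (\<lambda>x. \<Sum>\<^sub>\<infinity>k. ?f k x) sequentially"
    by (rule filterlim_compose[OF _ symmetric_intervals_at_top])
  moreover have "(\<lambda>x. \<Sum>\<^sub>\<infinity>k. ?f k x) = random_potential s v"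
  proof
    fix x
    have s: "(\<lambda>k. ?f k x) summable_on S" for S
    proof -
      have "(\<lambda>k. ?f k x) summable_on UNIV"
        by (rule abs_summable_summable, rule Infinite_Sum.abs_summable_on_comparison_test'[OF sm]) (rule le)
      thus ?thesis using summable_on_subset_banach by blast
    qed
    have "(\<Sum>\<^sub>\<infinity>k. ?f k x) = (\<Sum>\<^sub>\<infinity>k\<in>{..-1} \<union> {0..}. ?f k x)"
      by (rule arg_cong[where f = "infsum _"]) auto
    also have "\<dots> = (\<Sum>\<^sub>\<infinity>k\<in>{..-1}. ?f k x) + (\<Sum>\<^sub>\<infinity>k\<in>{0..}. ?f k x)"
      by (rule infsum_Un_disjoint[OF s s]) auto
    also have "\<dots> = random_potential s v x"
      unfolding random_potential_def
      by (intro arg_cong2[where f = "(+)"] infsum_cong) (auto simp: trig_def amplitude_def)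
    finally show "(\<Sum>\<^sub>\<infinity>k. ?f k x) = random_potential s v x" .
  qed
  ultimately show ?thesis unfolding partial_potential_def by simp
qed

lemma partial_potential_continuous: "continuous_on S (partial_potential s v N)"
  unfolding partial_potential_def by (intro continuous_intros)

lemma partial_potential_tendsto:
  "mass_bounded s v B \<Longrightarrow> (\<lambda>N. partial_potential s v N x) \<longlonglongrightarrow> random_potential s v x"
  using tendsto_uniform_limitI[OF partial_potential_uniform_limit] by blast

lemma partial_potential_bound:
  assumes "mass_bounded s v B" shows "\<bar>partial_potential s v N x\<bar> \<le> B"
proof -
  have "\<bar>partial_potential s v N x\<bar> \<le> (\<Sum>k\<in>{- int N..int N}. \<bar>v k\<bar> * amplitude s k)"
    unfolding partial_potential_def
  proof (rule order_trans[OF sum_abs sum_mono])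
    fix k show "\<bar>v k * amplitude s k * trig k x\<bar> \<le> \<bar>v k\<bar> * amplitude s k"
      using mult_left_mono[OF abs_trig_le[of k x], of "\<bar>v k\<bar> * amplitude s k"] amplitude_pos[of s k]
      by (simp add: abs_mult)
  qed
  also have "\<dots> \<le> B" using assms by (simp add: mass_bounded_def)
  finally show ?thesis .
qed

lemma mass_bounded_small_potential:
  assumes v: "mass_bounded s v small_size"
  shows "small_potential (random_potential s v)" "small_potential (partial_potential s v N)"
proof -
  have "continuous_on UNIV (random_potential s v)"
    by (rule uniform_limit_theorem[OF _ partial_potential_uniform_limit[OF v]]) (auto simp: partial_potential_continuous)
  moreover have "\<bar>random_potential s v x\<bar> \<le> small_size" for x
    by (rule tendsto_upperbound[OF tendsto_rabs[OF partial_potential_tendsto[OF v, of x]]])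
       (auto simp: partial_potential_bound[OF v])
  ultimately show "small_potential (random_potential s v)" by (simp add: small_potential_def)
  show "small_potential (partial_potential s v N)"
    by (simp add: small_potential_def partial_potential_continuous partial_potential_bound[OF v])
qed

lemma partial_potential_integral_tendsto:
  assumes v: "mass_bounded s v B" and h: "continuous_on {a..b} h"
  shows "(\<lambda>N. integral {a..b} (\<lambda>x. partial_potential s v N x * h x)) \<longlonglongrightarrow>
         integral {a..b} (\<lambda>x. random_potential s v x * h x)"
proof -
  have u: "uniform_limit {a..b} (partial_potential s v) (random_potential s v) sequentially"
    using partial_potential_uniform_limit[OF v] by (rule uniform_limit_on_subset) auto
  have c: "continuous_on {a..b} (random_potential s v)"
    by (rule uniform_limit_theorem[OF _ u]) (auto simp: partial_potential_continuous)
  have bd: "bounded (g ` {a..b})" if "continuous_on {a..b} g" for g :: "real \<Rightarrow> real"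
    by (rule compact_imp_bounded[OF compact_continuous_image[OF that]]) simp
  have "uniform_limit {a..b} (\<lambda>N x. partial_potential s v N x * h x) (\<lambda>x. random_potential s v x * h x) sequentially"
    by (rule uniform_lim_mult[OF u uniform_limit_const bd[OF c] bd[OF h]])
  then obtain I J where "\<And>n. ((\<lambda>x. partial_potential s v n x * h x) has_integral I n) {a..b}"
    "((\<lambda>x. random_potential s v x * h x) has_integral J) {a..b}" "I \<longlonglongrightarrow> J"
    by (rule uniform_limit_integral) (auto intro!: continuous_intros partial_potential_continuous h)
  note r = this
  have "(\<lambda>N. integral {a..b} (\<lambda>x. partial_potential s v N x * h x)) = I"
    by (rule ext) (rule integral_unique[OF r(1)])
  thus ?thesis using r(3) integral_unique[OF r(2)] by simp
qed

lemma integral_partial_potential: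
  assumes h: "continuous_on {a..b} h"
  shows "integral {a..b} (\<lambda>x. partial_potential s v N x * h x) =
         (\<Sum>k\<in>{- int N..int N}. v k * amplitude s k * integral {a..b} (\<lambda>x. trig k x * h x))"
proof -
  have "(\<lambda>x. partial_potential s v N x * h x) = (\<lambda>x. \<Sum>k\<in>{- int N..int N}. v k * amplitude s k * (trig k x * h x))"
    by (rule ext) (simp add: partial_potential_def sum_distrib_right mult.assoc)
  moreover have "integral {a..b} (\<lambda>x. \<Sum>k\<in>{- int N..int N}. v k * amplitude s k * (trig k x * h x)) =
     (\<Sum>k\<in>{- int N..int N}. integral {a..b} (\<lambda>x. v k * amplitude s k * (trig k x * h x)))"
    by (rule integral_sum) (auto intro!: integrable_continuous_real continuous_intros h)
  ultimately show ?thesis by simp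
qed

lemma has_integral_cos_period:
  "((\<lambda>x. cos (of_int p * x)) has_integral (if p = 0 then 2 * pi else 0)) {0..2 * pi}"
proof (cases "p = 0")
  case True
  have "((\<lambda>x. 1::real) has_integral (2 * pi - 0) * 1) {0..2 * pi}" using has_integral_const_real[of "1::real" 0 "2*pi"] by simp
  thus ?thesis using True by simp
next
  case False
  have "((\<lambda>x. cos (of_int p * x)) has_integral (sin (of_int p * (2 * pi)) / of_int p - sin (of_int p * 0) / of_int p)) {0..2 * pi}"
    by (rule fundamental_theorem_of_calculus)
       (use False in \<open>auto intro!: derivative_eq_intros simp: has_real_derivative_iff_has_vector_derivative[symmetric]\<close>)
  moreover have "sin (of_int p * (2 * pi)) = 0" using sin_zero_iff_int2[of "of_int p * (2 * pi)"]
    by (auto intro!: exI[of _ "2 * p"])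
  ultimately show ?thesis using False by simp
qed

lemma has_integral_sin_period:
  "((\<lambda>x. sin (of_int p * x)) has_integral 0) {0..2 * pi}"
proof (cases "p = 0")
  case False
  have "((\<lambda>x. sin (of_int p * x)) has_integral (- cos (of_int p * (2 * pi)) / of_int p - - cos (of_int p * 0) / of_int p)) {0..2 * pi}"
    by (rule fundamental_theorem_of_calculus)
       (use False in \<open>auto intro!: derivative_eq_intros simp: has_real_derivative_iff_has_vector_derivative[symmetric]\<close>)
  moreover have "cos (of_int p * (2 * pi)) = 1" using cos_int_2pin[of p] by (simp add: mult_ac)
  ultimately show ?thesis using False by simp
qed auto

lemma integral_trig_mult_trig:
  "integral {0..2 * pi} (\<lambda>x. trig j x * trig k x) = (if j = k then (if k = 0 then 2 * pi else pi) else 0)"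
proof -
  let ?c = "\<lambda>p x. cos (real_of_int p * x)" and ?s = "\<lambda>p x. sin (real_of_int p * x)"
  consider "j < 0" "k < 0" | "j \<ge> 0" "k \<ge> 0" | "j < 0" "k \<ge> 0" | "j \<ge> 0" "k < 0" by linarith
  thus ?thesis
  proof cases
    case 1
    have e: "trig j x * trig k x = (?c (j - k) x - ?c (j + k) x) / 2" for x
      using 1 by (simp add: trig_def cos_diff cos_add left_diff_distrib distrib_right)
    have "((\<lambda>x. (?c (j - k) x - ?c (j + k) x) / 2) has_integral ((if j - k = 0 then 2 * pi else 0) - (if j + k = 0 then 2 * pi else 0)) / 2) {0..2 * pi}"
      by (intro has_integral_divide has_integral_diff has_integral_cos_period)
    from integral_unique[OF this] show ?thesis unfolding e using 1 by auto
  next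
    case 2
    have e: "trig j x * trig k x = (?c (j - k) x + ?c (j + k) x) / 2" for x
      using 2 by (simp add: trig_def cos_diff cos_add left_diff_distrib distrib_right)
    have "((\<lambda>x. (?c (j - k) x + ?c (j + k) x) / 2) has_integral ((if j - k = 0 then 2 * pi else 0) + (if j + k = 0 then 2 * pi else 0)) / 2) {0..2 * pi}"
      by (intro has_integral_divide has_integral_add has_integral_cos_period)
    from integral_unique[OF this] show ?thesis unfolding e using 2 by auto
  next
    case 3
    have e: "trig j x * trig k x = (?s (j + k) x + ?s (j - k) x) / 2" for x
      using 3 by (simp add: trig_def sin_diff sin_add left_diff_distrib distrib_right)
    have "((\<lambda>x. (?s (j + k) x + ?s (j - k) x) / 2) has_integral (0 + 0) / 2) {0..2 * pi}"
      by (intro has_integral_divide has_integral_add has_integral_sin_period)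
    from integral_unique[OF this] show ?thesis unfolding e using 3 by auto
  next
    case 4
    have e: "trig j x * trig k x = (?s (j + k) x - ?s (j - k) x) / 2" for x
      using 4 by (simp add: trig_def sin_diff sin_add left_diff_distrib distrib_right)
    have "((\<lambda>x. (?s (j + k) x - ?s (j - k) x) / 2) has_integral (0 - 0) / 2) {0..2 * pi}"
      by (intro has_integral_divide has_integral_diff has_integral_sin_period)
    from integral_unique[OF this] show ?thesis unfolding e using 4 by auto
  qed
qed

lemma integral_potential_trig:
  assumes v: "mass_bounded s v B"
  shows "integral {0..2 * pi} (\<lambda>x. random_potential s v x * trig k x) =
     v k * amplitude s k * (if k = 0 then 2 * pi else pi)"
proof (rule LIMSEQ_unique[OF partial_potential_integral_tendsto[OF v]])
  show "continuous_on {0..2 * pi} (trig k)" by (intro continuous_intros)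
  have "integral {0..2 * pi} (\<lambda>x. partial_potential s v N x * trig k x) = v k * amplitude s k * (if k = 0 then 2 * pi else pi)"
    if "N \<ge> nat \<bar>k\<bar>" for N
  proof -
    have kN: "k \<in> {- int N..int N}" using that by auto
    have "integral {0..2 * pi} (\<lambda>x. partial_potential s v N x * trig k x) =
      (\<Sum>j\<in>{- int N..int N}. if j = k then v k * amplitude s k * (if k = 0 then 2 * pi else pi) else 0)"
      unfolding integral_partial_potential[OF trig_continuous] integral_trig_mult_trig
      by (rule sum.cong) auto
    thus ?thesis using kN by simp
  qed
  thus "(\<lambda>N. integral {0..2 * pi} (\<lambda>x. partial_potential s v N x * trig k x)) \<longlonglongrightarrow> v k * amplitude s k * (if k = 0 then 2 * pi else pi)"
    by (intro tendsto_eventually eventually_sequentiallyI[of "nat \<bar>k\<bar>"])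
qed

text \<open>Up to sign the integral is the real or the imaginary part of the integral that defines the Fourier
coefficient, depending on whether the mode is a cosine or a sine.\<close>

lemma fourier_coeff_lower:
  fixes u :: "real \<Rightarrow> real"
  assumes u: "continuous_on {0..2 * pi} u"
  shows "\<bar>integral {0..2 * pi} (\<lambda>x. u x * trig k x)\<bar> \<le> 2 * pi * cmod (fourier_coeff u k)"
proof -
  let ?F = "\<lambda>x. indicator {0..2 * pi} x *\<^sub>R (complex_of_real (u x) * cis (- (of_int k * x)))"
  define Z where "Z = (LBINT x:{0..2 * pi}. complex_of_real (u x) * cis (- (of_int k * x)))"
  have "set_integrable lborel {0..2 * pi} (\<lambda>x. complex_of_real (u x) * cis (- (of_int k * x)))"
    by (rule borel_integrable_atLeastAtMost') (intro continuous_intros continuous_on_cis u)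
  hence i: "integrable lborel ?F" by (simp add: set_integrable_def)
  have j: "integral {0..2 * pi} (\<lambda>x. u x * h x) = (\<integral>x. indicator {0..2 * pi} x * (u x * h x) \<partial>lborel)"
    if "continuous_on {0..2 * pi} h" for h :: "real \<Rightarrow> real"
  proof -
    have "set_integrable lborel {0..2 * pi} (\<lambda>x. u x * h x)"
      by (rule borel_integrable_atLeastAtMost') (intro continuous_intros u that)
    from set_borel_integral_eq_integral(2)[OF this] show ?thesis by (simp add: set_lebesgue_integral_def)
  qed
  have R: "Re Z = integral {0..2 * pi} (\<lambda>x. u x * cos (of_int k * x))"
    unfolding Z_def set_lebesgue_integral_def integral_Re[OF i, symmetric]
    by (subst j) (auto intro!: continuous_intros Bochner_Integration.integral_cong)
  have I: "Im Z = - integral {0..2 * pi} (\<lambda>x. u x * sin (of_int k * x))"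
    unfolding Z_def set_lebesgue_integral_def integral_Im[OF i, symmetric]
    by (subst j) (auto intro!: continuous_intros Bochner_Integration.integral_cong simp flip: Bochner_Integration.integral_minus)
  have "\<bar>integral {0..2 * pi} (\<lambda>x. u x * trig k x)\<bar> \<le> cmod Z"
  proof (cases "k < 0")
    case True
    hence "integral {0..2 * pi} (\<lambda>x. u x * trig k x) = - Im Z" unfolding I by (simp add: trig_def)
    thus ?thesis using abs_Im_le_cmod[of Z] by simp
  next
    case False
    hence "integral {0..2 * pi} (\<lambda>x. u x * trig k x) = Re Z" unfolding R by (simp add: trig_def)
    thus ?thesis using abs_Re_le_cmod[of Z] by simp
  qed
  also have "cmod Z = 2 * pi * cmod (fourier_coeff u k)"
    unfolding fourier_coeff_def Z_def[symmetric] by (simp add: norm_divide norm_mult)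
  finally show ?thesis .
qed

text \<open>The telescoping bound \<open>1 / (1 + n\<^sup>2) \<le> 1 / (n - 1/2) - 1 / (n + 1/2)\<close>.\<close>

lemma sum_inverse_bracket_squares:
  "(\<Sum>k\<in>{- int N..int N}. (1 / japanese_bracket (of_int k))\<^sup>2) \<le> 5 - 2 / (real N + 1 / 2)"
proof (induction N)
  case (Suc N)
  have e: "{- int (Suc N)..int (Suc N)} = insert (- int (Suc N)) (insert (int (Suc N)) {- int N..int N})" by auto
  have jb: "(1 / japanese_bracket x)\<^sup>2 = 1 / (1 + x\<^sup>2)" for x :: real
    unfolding japanese_bracket_def power_divide by simp
  have "(\<Sum>k\<in>{- int (Suc N)..int (Suc N)}. (1 / japanese_bracket (of_int k))\<^sup>2)
     = 2 * (1 / (1 + (real N + 1)\<^sup>2)) + (\<Sum>k\<in>{- int N..int N}. (1 / japanese_bracket (of_int k))\<^sup>2)"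
    unfolding e by (subst sum.insert, simp, simp)+ (simp add: jb, simp add: power2_eq_square algebra_simps)
  also have "\<dots> \<le> 2 * (1 / (1 + (real N + 1)\<^sup>2)) + (5 - 2 / (real N + 1 / 2))" using Suc by simp
  also have "1 / (1 + (real N + 1)\<^sup>2) \<le> 1 / (real N + 1/2) - 1 / (real N + 3/2)"
  proof -
    have "1 / (real N + 1/2) - 1 / (real N + 3/2) = 1 / ((real N + 1/2) * (real N + 3/2))"
      by (simp add: field_simps)
    moreover have "1 / (1 + (real N + 1)\<^sup>2) \<le> 1 / ((real N + 1/2) * (real N + 3/2))"
      by (intro divide_left_mono mult_pos_pos) (auto simp: power2_eq_square algebra_simps add_pos_nonneg)
    ultimately show ?thesis by simp
  qed
  finally show ?case by (simp add: algebra_simps)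
qed (simp add: japanese_bracket_def)

text \<open>By orthogonality each amplitude is at most twice the modulus of a Fourier coefficient, and the sum of
the Fourier coefficients is controlled by the Sobolev norm through the Cauchy-Schwarz inequality with
weight \<open>1 + k\<^sup>2\<close>. The a priori bound \<open>B\<close>, of any size, makes the Fourier series meaningful.\<close>

lemma H1_norm_controls_mass:
  assumes v: "mass_bounded s v B" and H1: "H1_norm_torus (random_potential s v) < ereal (small_size / 10)"
  shows "mass_bounded s v small_size"
  unfolding mass_bounded_def
proof
  fix N
  let ?u = "random_potential s v"
  let ?w = "\<lambda>n::int. (japanese_bracket (of_int n))\<^sup>2 * (cmod (fourier_coeff ?u n))\<^sup>2"
  have cont: "continuous_on {0..2 * pi} ?u"
    by (rule continuous_on_subset[OF uniform_limit_theorem[OF _ partial_potential_uniform_limit[OF v]]])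
       (auto simp: partial_potential_continuous)
  have in1: "in_H1_torus ?u" using H1 by (auto simp: H1_norm_torus_def split: if_splits)
  hence sm: "?w summable_on UNIV" by (simp add: in_H1_torus_def)
  have "sqrt (\<Sum>\<^sub>\<infinity>n. ?w n) < small_size / 10" using H1 in1 by (simp add: H1_norm_torus_def)
  hence "(\<Sum>\<^sub>\<infinity>n. ?w n) \<le> (small_size / 10)\<^sup>2"
    by (intro sqrt_le_D less_imp_le)
  moreover have "sum ?w {- int N..int N} \<le> (\<Sum>\<^sub>\<infinity>n. ?w n)"
    by (rule finite_sum_le_infsum[OF sm]) auto
  ultimately have w: "sum ?w {- int N..int N} \<le> (small_size / 10)\<^sup>2" by linarith
  have coeff: "\<bar>v k\<bar> * amplitude s k \<le> 2 * cmod (fourier_coeff ?u k)" for k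
  proof -
    have "\<bar>v k\<bar> * amplitude s k * pi \<le> \<bar>integral {0..2 * pi} (\<lambda>x. ?u x * trig k x)\<bar>"
      unfolding integral_potential_trig[OF v] using amplitude_pos[of s k] pi_gt_zero
      by (auto simp: abs_mult intro!: mult_left_mono)
    also have "\<dots> \<le> 2 * pi * cmod (fourier_coeff ?u k)" by (rule fourier_coeff_lower[OF cont])
    finally have "pi * (\<bar>v k\<bar> * amplitude s k) \<le> pi * (2 * cmod (fourier_coeff ?u k))" by (simp add: mult_ac)
    thus ?thesis by simp
  qed
  define a b where "a = (\<lambda>k::int. 1 / japanese_bracket (of_int k))"
    and "b = (\<lambda>k::int. japanese_bracket (of_int k) * cmod (fourier_coeff ?u k))"
  have ab: "cmod (fourier_coeff ?u k) = a k * b k" for k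
    using japanese_bracket_ge_1[of "of_int k"] by (simp add: a_def b_def)
  define C where "C = (\<Sum>k\<in>{- int N..int N}. cmod (fourier_coeff ?u k))"
  have "C\<^sup>2 \<le> (\<Sum>k\<in>{- int N..int N}. (a k)\<^sup>2) * (\<Sum>k\<in>{- int N..int N}. (b k)\<^sup>2)"
    unfolding C_def ab by (rule Cauchy_Schwarz_ineq_sum)
  also have "\<dots> \<le> 5 * (small_size / 10)\<^sup>2"
  proof (intro mult_mono)
    have "2 / (real N + 1 / 2) \<ge> 0" by simp
    thus "(\<Sum>k\<in>{- int N..int N}. (a k)\<^sup>2) \<le> 5" unfolding a_def using sum_inverse_bracket_squares[of N] by linarith
    show "(\<Sum>k\<in>{- int N..int N}. (b k)\<^sup>2) \<le> (small_size / 10)\<^sup>2" using w by (simp add: b_def power_mult_distrib)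
  qed (auto intro: sum_nonneg)
  also have "\<dots> \<le> (small_size / 2)\<^sup>2" by (simp add: small_size_def power2_eq_square)
  finally have "C \<le> small_size / 2" by (rule power2_le_imp_le) (simp add: small_size_def)
  have "(\<Sum>k\<in>{- int N..int N}. \<bar>v k\<bar> * amplitude s k) \<le> (\<Sum>k\<in>{- int N..int N}. 2 * cmod (fourier_coeff ?u k))"
    by (rule sum_mono) (rule coeff)
  also have "\<dots> = 2 * C" by (simp add: C_def sum_distrib_left)
  also have "\<dots> \<le> small_size" using \<open>C \<le> small_size / 2\<close> by simp
  finally show "(\<Sum>k\<in>{- int N..int N}. \<bar>v k\<bar> * amplitude s k) \<le> small_size" .
qed

text \<open>The integral is at most \<open>pi\<close>, and one integration by parts, without boundary terms because
\<open>sin (2 n x)\<close> vanishes at both ends, bounds it by \<open>pi \<bar>k\<bar> / n\<close>. Interpolating between the two costs only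
half a derivative of the potential.\<close>

lemma trig_cos_integral_decay:
  assumes n: "n \<ge> (1::nat)"
  shows "\<bar>integral {0..pi} (\<lambda>x. trig k x * cos (2 * real n * x))\<bar> \<le> pi * sqrt (japanese_bracket (of_int k)) / sqrt (real n)"
proof -
  define t :: "real \<Rightarrow> real" where "t = (\<lambda>x. if k < 0 then cos (of_int k * x) else - sin (of_int k * x))"
  have t1: "\<bar>t x\<bar> \<le> 1" for x by (simp add: t_def)
  have ct: "continuous_on {0..pi} t" unfolding t_def by (cases "k < 0") (auto intro!: continuous_intros)
  have dt: "(trig k has_real_derivative of_int k * t x) (at x within {0..pi})" for x
  proof (cases "k < 0")
    case True
    have "trig k = (\<lambda>x. sin (of_int k * x))" using True by (simp add: trig_def fun_eq_iff)
    thus ?thesis using True by (auto intro!: derivative_eq_intros simp: t_def)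
  next
    case False
    have "trig k = (\<lambda>x. cos (of_int k * x))" using False by (simp add: trig_def fun_eq_iff)
    thus ?thesis using False by (auto intro!: derivative_eq_intros simp: t_def)
  qed
  let ?I = "integral {0..pi} (\<lambda>x. trig k x * cos (2 * real n * x))"
  let ?s = "\<lambda>x. sin (2 * real n * x) / (2 * real n)"
  have 1: "\<bar>?I\<bar> \<le> pi * 1"
  proof (rule integral_abs_bound)
    fix x show "\<bar>trig k x * cos (2 * real n * x)\<bar> \<le> 1"
      using mult_mono[OF abs_trig_le[of k x] abs_cos_le_one[of "2 * real n * x"]] by (simp add: abs_mult)
  qed (intro continuous_intros)
  have "((\<lambda>x. trig k x * cos (2 * real n * x) + of_int k * t x * ?s x) has_integral
      trig k pi * (sin (2 * real n * pi) / (2 * real n)) - trig k 0 * (sin (2 * real n * 0) / (2 * real n))) {0..pi}"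
  proof (rule fundamental_theorem_of_calculus)
    fix x
    have d: "((\<lambda>x. sin (2 * real n * x) / (2 * real n)) has_real_derivative cos (2 * real n * x)) (at x within {0..pi})"
      using n by (auto intro!: derivative_eq_intros)
    show "((\<lambda>x. trig k x * ?s x) has_vector_derivative
       trig k x * cos (2 * real n * x) + of_int k * t x * ?s x) (at x within {0..pi})"
      using DERIV_mult[OF dt d] unfolding has_real_derivative_iff_has_vector_derivative[symmetric]
      by (simp add: mult_ac add.commute)
  qed simp
  moreover have "sin (2 * real n * pi) = 0" using sin_npi[of "2 * n"] by simp
  ultimately have "integral {0..pi} (\<lambda>x. trig k x * cos (2 * real n * x) + of_int k * t x * ?s x) = 0"
    by (simp add: integral_unique)
  moreover have "integral {0..pi} (\<lambda>x. trig k x * cos (2 * real n * x) + of_int k * t x * ?s x)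
    = ?I + integral {0..pi} (\<lambda>x. of_int k * t x * ?s x)"
    by (intro integral_add integrable_continuous_real continuous_intros ct) (use n in auto)
  ultimately have e: "?I = - integral {0..pi} (\<lambda>x. of_int k * t x * ?s x)" by linarith
  have "\<bar>integral {0..pi} (\<lambda>x. of_int k * t x * ?s x)\<bar> \<le> pi * (\<bar>of_int k\<bar> / (2 * real n))"
  proof (rule integral_abs_bound)
    fix x
    have "\<bar>t x\<bar> * \<bar>sin (2 * real n * x)\<bar> \<le> 1 * 1" by (intro mult_mono t1) auto
    hence "\<bar>of_int k\<bar> / (2 * real n) * (\<bar>t x\<bar> * \<bar>sin (2 * real n * x)\<bar>) \<le> \<bar>of_int k\<bar> / (2 * real n) * (1 * 1)"
      by (intro mult_left_mono) auto
    thus "\<bar>of_int k * t x * ?s x\<bar> \<le> \<bar>of_int k\<bar> / (2 * real n)"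
      by (simp add: abs_mult)
  qed (intro continuous_intros ct, use n in auto)
  moreover have "pi * (\<bar>of_int k\<bar> / (2 * real n)) \<le> pi * (\<bar>of_int k\<bar> / real n)"
    using n by (intro mult_left_mono divide_left_mono) auto
  ultimately have 2: "\<bar>?I\<bar> \<le> pi * (\<bar>of_int k\<bar> / real n)" unfolding e abs_minus_cancel
    by (rule order_trans)
  define y where "y = japanese_bracket (of_int k) / real n"
  have ky: "\<bar>of_int k\<bar> / real n \<le> y" unfolding y_def japanese_bracket_def
    by (intro divide_right_mono real_le_rsqrt) auto
  have y0: "y \<ge> 0" using ky by (rule order_trans[rotated]) auto
  have "\<bar>?I\<bar> \<le> pi * sqrt y"
  proof (cases "y \<ge> 1")
    case True
    hence "pi * 1 \<le> pi * sqrt y" by (intro mult_left_mono) auto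
    thus ?thesis using 1 by linarith
  next
    case False
    have "y * y \<le> y * 1" using False y0 by (intro mult_left_mono) auto
    hence "y \<le> sqrt y" using y0 by (intro real_le_rsqrt) (simp add: power2_eq_square)
    hence "pi * (\<bar>of_int k\<bar> / real n) \<le> pi * sqrt y" using ky by (intro mult_left_mono) auto
    thus ?thesis using 2 by linarith
  qed
  thus ?thesis by (simp add: y_def real_sqrt_divide)
qed

text \<open>The factor \<open>sqrt \<langle>k\<rangle>\<close> lost for each mode is absorbed by lowering the exponent of the amplitudes
from \<open>s\<close> to \<open>s - 1/2\<close>, which still exceeds 1.\<close>

lemma potential_cos_integral_decay:
  assumes v: "mass_bounded s v B0" and w: "mass_bounded (s - 1/2) v B" and n: "n \<ge> (1::nat)"
  shows "\<bar>integral {0..pi} (\<lambda>x. random_potential s v x * cos (2 * real n * x))\<bar> \<le> pi * B / sqrt (real n)"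
proof (rule tendsto_upperbound[OF tendsto_rabs[OF partial_potential_integral_tendsto[OF v]]])
  show "continuous_on {0..pi} (\<lambda>x. cos (2 * real n * x))" by (intro continuous_intros)
  have "\<bar>integral {0..pi} (\<lambda>x. partial_potential s v N x * cos (2 * real n * x))\<bar> \<le> pi * B / sqrt (real n)" for N
  proof -
    have "\<bar>integral {0..pi} (\<lambda>x. partial_potential s v N x * cos (2 * real n * x))\<bar>
       \<le> (\<Sum>k\<in>{- int N..int N}. pi / sqrt (real n) * (\<bar>v k\<bar> * amplitude (s - 1/2) k))"
    proof (subst integral_partial_potential, intro continuous_intros, rule order_trans[OF sum_abs sum_mono])
      fix k
      have am: "amplitude s k * sqrt (japanese_bracket (of_int k)) = amplitude (s - 1/2) k"
        using japanese_bracket_ge_1[of "of_int k"]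
        by (simp add: amplitude_def powr_half_sqrt[symmetric] powr_add[symmetric])
      have "\<bar>v k * amplitude s k * integral {0..pi} (\<lambda>x. trig k x * cos (2 * real n * x))\<bar>
        \<le> \<bar>v k\<bar> * amplitude s k * (pi * sqrt (japanese_bracket (of_int k)) / sqrt (real n))"
        unfolding abs_mult abs_of_pos[OF amplitude_pos]
        by (intro mult_left_mono trig_cos_integral_decay[OF n]) (auto simp: less_imp_le[OF amplitude_pos])
      also have "\<dots> = pi / sqrt (real n) * (\<bar>v k\<bar> * amplitude (s - 1/2) k)"
        unfolding am[symmetric] by simp
      finally show "\<bar>v k * amplitude s k * integral {0..pi} (\<lambda>x. trig k x * cos (2 * real n * x))\<bar>
         \<le> pi / sqrt (real n) * (\<bar>v k\<bar> * amplitude (s - 1/2) k)" .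
    qed
    also have "\<dots> = pi / sqrt (real n) * (\<Sum>k\<in>{- int N..int N}. \<bar>v k\<bar> * amplitude (s - 1/2) k)"
      by (simp add: sum_distrib_left)
    also have "\<dots> \<le> pi / sqrt (real n) * B"
      using w by (intro mult_left_mono) (auto simp: mass_bounded_def)
    finally show ?thesis by simp
  qed
  thus "\<forall>\<^sub>F N in sequentially. \<bar>integral {0..pi} (\<lambda>x. partial_potential s v N x * cos (2 * real n * x))\<bar> \<le> pi * B / sqrt (real n)"
    by simp
qed simp

lemma eigval_decay:
  assumes v: "mass_bounded s v small_size" and w: "mass_bounded (s - 1/2) v B"
  shows "\<exists>C>0. \<forall>n\<ge>1. \<bar>eigval (random_potential s v) n - (real n)\<^sup>2 - integral {0..pi} (random_potential s v) / pi\<bar> \<le> C / sqrt (real n)"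
proof (intro exI[of _ "1 + pi * \<bar>B\<bar>"] conjI allI impI)
  let ?err = "\<lambda>n. \<bar>eigval (random_potential s v) n - (real n)\<^sup>2 - integral {0..pi} (random_potential s v) / pi\<bar>"
  show "1 + pi * \<bar>B\<bar> > 0" by (simp add: add_pos_nonneg)
  fix n :: nat assume n: "n \<ge> 1"
  have "?err n \<le> 1 / real n + pi * B / sqrt (real n)"
    by (rule eigval_asymptotics[OF mass_bounded_small_potential(1)[OF v] n potential_cos_integral_decay[OF v w n]])
  also have "\<dots> \<le> 1 / sqrt (real n) + pi * \<bar>B\<bar> / sqrt (real n)"
  proof (intro add_mono)
    have "sqrt (real n) \<le> real n" using n real_sqrt_ge_one[of "real n"]
      by (metis abs_ge_self abs_of_nat mult_left_mono mult_1_right of_nat_1 of_nat_le_iff real_sqrt_ge_zero real_sqrt_mult_self of_nat_0_le_iff)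
    thus "1 / real n \<le> 1 / sqrt (real n)" using n by (intro divide_left_mono) auto
    show "pi * B / sqrt (real n) \<le> pi * \<bar>B\<bar> / sqrt (real n)" by (intro divide_right_mono mult_left_mono) auto
  qed
  also have "\<dots> = (1 + pi * \<bar>B\<bar>) / sqrt (real n)" by (simp add: add_divide_distrib)
  finally show "?err n \<le> (1 + pi * \<bar>B\<bar>) / sqrt (real n)" .
qed

section \<open>Gaussian coefficient sequences\<close>

definition gaussian_sequence :: "(int \<Rightarrow> real) measure" where
  "gaussian_sequence = Pi\<^sub>M UNIV (\<lambda>_. std_normal_distribution)"

lemma prob_space_std_normal: "prob_space std_normal_distribution"
  using prob_space_normal_density[of 1 0] by simp

lemma prob_space_gaussian_sequence: "prob_space gaussian_sequence"
  unfolding gaussian_sequence_def by (intro prob_space_PiM prob_space_std_normal)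

lemma sets_gaussian_sequence [measurable_cong]: "sets gaussian_sequence = sets borel"
proof -
  have "sets gaussian_sequence = sets (Pi\<^sub>M UNIV (\<lambda>i::int. borel :: real measure))"
    unfolding gaussian_sequence_def by (rule sets_PiM_cong) auto
  thus ?thesis by (simp add: sets_PiM_equal_borel)
qed

lemma space_gaussian_sequence [simp]: "space gaussian_sequence = UNIV"
  using sets_eq_imp_space_eq[OF sets_gaussian_sequence] by simp

lemma coordinate_measurable: "(\<lambda>v::int \<Rightarrow> real. v k) \<in> borel_measurable borel"
  by (rule borel_measurable_continuous_onI) (rule continuous_on_product_coordinates)

lemma nn_integral_coordinate_abs:
  "(\<integral>\<^sup>+v. ennreal \<bar>v k\<bar> \<partial>gaussian_sequence) = ennreal (sqrt (2 / pi))"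
proof -
  have m: "(\<lambda>v. v k) \<in> measurable gaussian_sequence std_normal_distribution"
    unfolding gaussian_sequence_def by (rule measurable_component_singleton) simp
  have d: "distr gaussian_sequence std_normal_distribution (\<lambda>v. v k) = std_normal_distribution"
    unfolding gaussian_sequence_def by (rule distr_PiM_component[OF prob_space_std_normal]) simp
  have "(\<integral>\<^sup>+v. ennreal \<bar>v k\<bar> \<partial>gaussian_sequence) = (\<integral>\<^sup>+x. ennreal \<bar>x\<bar> \<partial>distr gaussian_sequence std_normal_distribution (\<lambda>v. v k))"
    by (subst nn_integral_distr[OF m]) auto
  also have "\<dots> = (\<integral>\<^sup>+x. ennreal (std_normal_density x * \<bar>x\<bar>) \<partial>lborel)"
    unfolding d by (subst nn_integral_density) (auto simp: ennreal_mult)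
  also have "\<dots> = ennreal (sqrt (2 / pi))"
    using std_normal_moment_abs_odd[of 0] by (intro nn_integral_eq_integral[THEN trans])
      (auto simp: has_bochner_integral_iff)
  finally show ?thesis .
qed

lemma amplitude_le_powr: "t > 0 \<Longrightarrow> n \<ge> 1 \<Longrightarrow> amplitude t (int n) \<le> real n powr (- t)" "amplitude t (- k) = amplitude t k"
proof -
  assume "t > 0" "n \<ge> 1"
  have "real n \<le> japanese_bracket (real n)" unfolding japanese_bracket_def by (rule real_le_rsqrt) simp
  thus "amplitude t (int n) \<le> real n powr (- t)"
    unfolding amplitude_def using \<open>t > 0\<close> \<open>n \<ge> 1\<close> by (simp add: powr_mono2')
qed (simp add: amplitude_def japanese_bracket_def)

text \<open>The expected sum of the absolute values is finite, since the first absolute moments of the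
coefficients are all equal and the amplitudes are summable for exponents above 1.\<close>

lemma AE_mass_bounded:
  assumes t: "t > 1"
  shows "AE v in gaussian_sequence. \<exists>B. mass_bounded t v B"
proof -
  define g where "g = (\<lambda>(v::int \<Rightarrow> real) (n::nat). \<bar>v (int n)\<bar> * amplitude t (int n) + \<bar>v (- int n)\<bar> * amplitude t (- int n))"
  have g0: "g v n \<ge> 0" for v n unfolding g_def by (intro add_nonneg_nonneg mult_nonneg_nonneg) (auto simp: less_imp_le[OF amplitude_pos])
  have cm [measurable]: "(\<lambda>v::int \<Rightarrow> real. v k) \<in> borel_measurable gaussian_sequence" for k
    using coordinate_measurable[of k] by (simp cong: measurable_cong_sets add: sets_gaussian_sequence)
  have gm [measurable]: "(\<lambda>v. g v n) \<in> borel_measurable gaussian_sequence" for n unfolding g_def by measurable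
  define c where "c = sqrt (2 / pi)"
  have ig: "(\<integral>\<^sup>+v. ennreal (g v n) \<partial>gaussian_sequence) = ennreal (2 * c * amplitude t (int n))" for n
  proof -
    have "(\<integral>\<^sup>+v. ennreal (g v n) \<partial>gaussian_sequence) = (\<integral>\<^sup>+v. ennreal \<bar>v (int n)\<bar> * ennreal (amplitude t (int n)) + ennreal \<bar>v (- int n)\<bar> * ennreal (amplitude t (int n)) \<partial>gaussian_sequence)"
      unfolding g_def amplitude_le_powr(2)
      by (intro nn_integral_cong) (simp add: ennreal_plus[symmetric] ennreal_mult'[symmetric] less_imp_le[OF amplitude_pos] del: ennreal_plus)
    also have "\<dots> = ennreal c * ennreal (amplitude t (int n)) + ennreal c * ennreal (amplitude t (int n))"
      by (subst nn_integral_add, measurable) (simp add: nn_integral_multc nn_integral_coordinate_abs c_def)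
    also have "\<dots> = ennreal (2 * c * amplitude t (int n))"
      by (simp add: ennreal_plus[symmetric] ennreal_mult'[symmetric] c_def less_imp_le[OF amplitude_pos] del: ennreal_plus)
    finally show ?thesis .
  qed
  have sm: "summable (\<lambda>n. 2 * c * amplitude t (int n))"
  proof (intro summable_mult summable_comparison_test[of "\<lambda>n. amplitude t (int n)" "\<lambda>n. real n powr (- t)"])
    show "\<exists>N. \<forall>n\<ge>N. norm (amplitude t (int n)) \<le> real n powr (- t)"
      by (rule exI[of _ 1]) (use t in \<open>auto simp: less_imp_le[OF amplitude_pos] intro!: amplitude_le_powr\<close>)
    show "summable (\<lambda>n. real n powr (- t))" using t by (simp add: summable_real_powr_iff)
  qed
  have c0: "c \<ge> 0" by (simp add: c_def)
  have "(\<integral>\<^sup>+v. (\<Sum>n. ennreal (g v n)) \<partial>gaussian_sequence) = (\<Sum>n. ennreal (2 * c * amplitude t (int n)))"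
    by (subst nn_integral_suminf) (auto simp: ig)
  also have "\<dots> = ennreal (\<Sum>n. 2 * c * amplitude t (int n))"
    by (rule suminf_ennreal2[OF mult_nonneg_nonneg[OF _ less_imp_le[OF amplitude_pos]] sm]) (use c0 in simp)
  finally have "(\<integral>\<^sup>+v. (\<Sum>n. ennreal (g v n)) \<partial>gaussian_sequence) \<noteq> \<infinity>" by simp
  hence "AE v in gaussian_sequence. (\<Sum>n. ennreal (g v n)) \<noteq> \<infinity>"
    by (intro nn_integral_noteq_infinite) auto
  thus ?thesis
  proof eventually_elim
    case (elim v)
    define B where "B = enn2real (\<Sum>n. ennreal (g v n))"
    have "(\<Sum>k\<in>{- int N..int N}. \<bar>v k\<bar> * amplitude t k) \<le> (\<Sum>n<Suc N. g v n)" for N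
    proof (induction N)
      case 0 show ?case by (simp add: g_def less_imp_le[OF amplitude_pos])
    next
      case (Suc N)
      have e: "{- int (Suc N)..int (Suc N)} = insert (- int (Suc N)) (insert (int (Suc N)) {- int N..int N})" by auto
      show ?case unfolding e sum.lessThan_Suc[of _ "Suc N"] using Suc
        by (subst sum.insert, simp, simp)+ (simp add: g_def)
    qed
    moreover have "(\<Sum>n<Suc N. g v n) \<le> B" for N
    proof -
      have "ennreal (\<Sum>n<Suc N. g v n) = (\<Sum>n<Suc N. ennreal (g v n))" by (rule sum_ennreal[symmetric]) (rule g0)
      also have "\<dots> \<le> (\<Sum>n. ennreal (g v n))" by (rule sum_le_suminf) auto
      also have "\<dots> = ennreal B" unfolding B_def using elim by (simp add: less_top)
      finally show ?thesis by (subst (asm) ennreal_le_iff) (auto simp: B_def)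
    qed
    ultimately show ?case unfolding mass_bounded_def by (meson order_trans)
  qed
qed

lemma mass_bounded_amplitude_mono:
  assumes "mass_bounded t v B" "t \<le> s" shows "mass_bounded s v B"
  unfolding mass_bounded_def
proof
  fix N
  have "(\<Sum>k\<in>{- int N..int N}. \<bar>v k\<bar> * amplitude s k) \<le> (\<Sum>k\<in>{- int N..int N}. \<bar>v k\<bar> * amplitude t k)"
    by (intro sum_mono mult_left_mono)
       (use assms(2) japanese_bracket_ge_1 in \<open>auto simp: amplitude_def intro!: powr_mono\<close>)
  thus "(\<Sum>k\<in>{- int N..int N}. \<bar>v k\<bar> * amplitude s k) \<le> B" using assms(1) unfolding mass_bounded_def by (meson order_trans)
qed

text \<open>Truncating the values of a potential makes it small without changing it if it was small already. The
truncation is a contraction for the supremum norm, so functionals that are Lipschitz on small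
potentials extend to continuous, hence measurable, functions of finitely many coefficients.\<close>

definition clamp_small :: "real \<Rightarrow> real" where
  "clamp_small y = max (- small_size) (min small_size y)"

lemma clamp_small_potential: "continuous_on UNIV V \<Longrightarrow> small_potential (\<lambda>x. clamp_small (V x))"
  unfolding small_potential_def clamp_small_def by (auto intro!: continuous_intros simp: small_size_def)

lemma clamp_small_id: "small_potential V \<Longrightarrow> (\<lambda>x. clamp_small (V x)) = V"
  unfolding small_potential_def clamp_small_def by (auto simp: fun_eq_iff abs_le_iff max_def min_def) (smt (verit))+

lemma clamp_small_contract: "\<bar>clamp_small a - clamp_small b\<bar> \<le> \<bar>a - b\<bar>"
  unfolding clamp_small_def by (auto simp: max_def min_def)

text \<open>The functional depends on finitely many coordinates and is Lipschitz in them, hence continuous for the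
product topology, whose Borel sets are the product sigma algebra.\<close>

lemma clamped_functional_measurable:
  fixes \<Phi> :: "(real \<Rightarrow> real) \<Rightarrow> real"
  assumes L: "L \<ge> 0" and lip: "\<And>V W d. small_potential V \<Longrightarrow> small_potential W \<Longrightarrow> (\<And>x. \<bar>V x - W x\<bar> \<le> d) \<Longrightarrow> \<bar>\<Phi> V - \<Phi> W\<bar> \<le> L * d"
  shows "(\<lambda>v. \<Phi> (\<lambda>x. clamp_small (partial_potential s v N x))) \<in> borel_measurable borel"
proof (rule borel_measurable_continuous_onI)
  let ?f = "\<lambda>v. \<Phi> (\<lambda>x. clamp_small (partial_potential s v N x))"
  have "isCont ?f w" for w
  proof -
    let ?d = "\<lambda>v. \<Sum>k\<in>{- int N..int N}. \<bar>v k - w k\<bar> * amplitude s k"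
    have b: "\<bar>?f v - ?f w\<bar> \<le> L * ?d v" for v
    proof (rule lip[OF clamp_small_potential[OF partial_potential_continuous] clamp_small_potential[OF partial_potential_continuous]])
      fix x
      have "\<bar>partial_potential s v N x - partial_potential s w N x\<bar> = \<bar>\<Sum>k\<in>{- int N..int N}. (v k - w k) * amplitude s k * trig k x\<bar>"
        unfolding partial_potential_def sum_subtractf[symmetric] by (simp add: algebra_simps)
      also have "\<dots> \<le> ?d v"
      proof (rule order_trans[OF sum_abs sum_mono])
        fix k show "\<bar>(v k - w k) * amplitude s k * trig k x\<bar> \<le> \<bar>v k - w k\<bar> * amplitude s k"
          using mult_left_mono[OF abs_trig_le[of k x], of "\<bar>v k - w k\<bar> * amplitude s k"] amplitude_pos[of s k]
          by (simp add: abs_mult)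
      qed
      finally show "\<bar>clamp_small (partial_potential s v N x) - clamp_small (partial_potential s w N x)\<bar> \<le> ?d v"
        using clamp_small_contract order_trans by blast
    qed
    have "((\<lambda>v. L * ?d v) \<longlongrightarrow> L * ?d w) (at w)"
    proof -
      have "continuous_on UNIV (\<lambda>v::int \<Rightarrow> real. L * ?d v)"
        by (intro continuous_intros continuous_on_product_coordinates)
      hence "isCont (\<lambda>v. L * ?d v) w" by (simp add: continuous_on_eq_continuous_at)
      thus ?thesis unfolding isCont_def .
    qed
    hence lim: "((\<lambda>v. L * ?d v) \<longlongrightarrow> 0) (at w)" by simp
    have "((\<lambda>v. ?f v - ?f w) \<longlongrightarrow> 0) (at w)"
      by (rule Lim_null_comparison[OF _ lim]) (use b in auto)
    thus ?thesis unfolding isCont_def using LIM_zero_iff by blast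
  qed
  thus "continuous_on UNIV ?f" by (simp add: continuous_at_imp_continuous_on)
qed

lemma clamped_functional_tendsto:
  fixes \<Phi> :: "(real \<Rightarrow> real) \<Rightarrow> real"
  assumes L: "L \<ge> 0" and lip: "\<And>V W d. small_potential V \<Longrightarrow> small_potential W \<Longrightarrow> (\<And>x. \<bar>V x - W x\<bar> \<le> d) \<Longrightarrow> \<bar>\<Phi> V - \<Phi> W\<bar> \<le> L * d"
    and v: "mass_bounded s v small_size"
  shows "(\<lambda>N. \<Phi> (\<lambda>x. clamp_small (partial_potential s v N x))) \<longlonglongrightarrow> \<Phi> (random_potential s v)"
proof -
  note sm = mass_bounded_small_potential[OF v]
  have "(\<lambda>N. \<Phi> (partial_potential s v N)) \<longlonglongrightarrow> \<Phi> (random_potential s v)"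
  proof (rule LIMSEQ_I)
    fix e :: real assume e: "e > 0"
    define d where "d = e / (2 * (L + 1))"
    have d: "d > 0" using e L by (simp add: d_def)
    have Ld: "L * d < e"
    proof -
      have "L * d \<le> (L + 1) * d" using d by (intro mult_right_mono) auto
      also have "\<dots> = e / 2" using L by (simp add: d_def field_simps)
      finally show ?thesis using e by simp
    qed
    have "\<forall>\<^sub>F N in sequentially. \<forall>x\<in>UNIV. dist (partial_potential s v N x) (random_potential s v x) < d"
      using partial_potential_uniform_limit[OF v] d by (rule uniform_limitD)
    then obtain N0 where N0: "\<And>N x. N \<ge> N0 \<Longrightarrow> dist (partial_potential s v N x) (random_potential s v x) < d"
      unfolding eventually_sequentially by blast
    show "\<exists>no. \<forall>n\<ge>no. norm (\<Phi> (partial_potential s v n) - \<Phi> (random_potential s v)) < e"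
    proof (intro exI allI impI)
      fix n assume "N0 \<le> n"
      have "\<bar>\<Phi> (partial_potential s v n) - \<Phi> (random_potential s v)\<bar> \<le> L * d"
        by (rule lip[OF sm(2) sm(1)]) (use N0[OF \<open>N0 \<le> n\<close>] in \<open>auto simp: dist_real_def less_imp_le\<close>)
      thus "norm (\<Phi> (partial_potential s v n) - \<Phi> (random_potential s v)) < e" using Ld by simp
    qed
  qed
  thus ?thesis by (simp add: clamp_small_id[OF sm(2)])
qed

text \<open>Fubini in one coordinate: every slice lies in an interval of length \<open>2 d\<close>, and the normal density is
bounded by 1.\<close>

lemma thin_slices_small_measure:
  assumes E: "E \<in> sets borel" and d: "d \<ge> 0"
    and thin: "\<And>v t. v \<in> E \<Longrightarrow> v(j := t) \<in> E \<Longrightarrow> \<bar>t - v j\<bar> \<le> d"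
  shows "emeasure gaussian_sequence E \<le> ennreal (2 * d)"
proof -
  let ?N = "std_normal_distribution" and ?I = "UNIV - {j} :: int set"
  let ?R = "Pi\<^sub>M ?I (\<lambda>_. std_normal_distribution)"
  let ?h = "\<lambda>(x, X). X(j := x)"
  have R: "prob_space ?R" by (intro prob_space_PiM prob_space_std_normal)
  interpret N: prob_space ?N by (rule prob_space_std_normal)
  interpret R: prob_space ?R by (rule R)
  interpret NR: pair_prob_space ?N ?R ..
  have ins: "insert j ?I = UNIV" by auto
  have hm: "?h \<in> measurable (?N \<Otimes>\<^sub>M ?R) gaussian_sequence"
    using measurable_add_dim[of j ?I "\<lambda>_. ?N"] unfolding gaussian_sequence_def by (simp add: insert_absorb)
  have dist: "distr (?N \<Otimes>\<^sub>M ?R) gaussian_sequence ?h = gaussian_sequence"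
    using distr_pair_PiM_eq_PiM[of ?I "\<lambda>_. ?N" j] prob_space_std_normal unfolding ins gaussian_sequence_def by simp
  have Es: "E \<in> sets gaussian_sequence" using E by (simp add: sets_gaussian_sequence)
  let ?P = "?h -` E \<inter> space (?N \<Otimes>\<^sub>M ?R)"
  have P: "?P \<in> sets (?N \<Otimes>\<^sub>M ?R)" by (rule measurable_sets[OF hm Es])
  have "emeasure gaussian_sequence E = emeasure (?N \<Otimes>\<^sub>M ?R) ?P"
    using emeasure_distr[OF hm Es] unfolding dist .
  also have "\<dots> = (\<integral>\<^sup>+Y. emeasure ?N ((\<lambda>x. (x, Y)) -` ?P) \<partial>?R)"
    by (rule NR.emeasure_pair_measure_alt2[OF P])
  also have "\<dots> \<le> (\<integral>\<^sup>+Y. ennreal (2 * d) \<partial>?R)"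
  proof (rule nn_integral_mono)
    fix Y
    let ?S = "(\<lambda>x. (x, Y)) -` ?P"
    show "emeasure ?N ?S \<le> ennreal (2 * d)"
    proof (cases "?S = {}")
      case False
      then obtain t0 where t0: "t0 \<in> ?S" by blast
      have sub: "?S \<subseteq> {t0 - d..t0 + d}"
      proof
        fix t assume t: "t \<in> ?S"
        have "(Y(j := t0))(j := t) \<in> E" "Y(j := t0) \<in> E" using t t0 by auto
        from thin[OF this(2,1)] show "t \<in> {t0 - d..t0 + d}" by (auto simp: abs_le_iff)
      qed
      have "emeasure ?N ?S \<le> emeasure ?N {t0 - d..t0 + d}" by (rule emeasure_mono[OF sub]) simp
      also have "\<dots> = (\<integral>\<^sup>+x. ennreal (std_normal_density x) * indicator {t0 - d..t0 + d} x \<partial>lborel)"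
        by (rule emeasure_density) auto
      also have "\<dots> \<le> (\<integral>\<^sup>+x. indicator {t0 - d..t0 + d} x \<partial>lborel)"
      proof (rule nn_integral_mono)
        fix x :: real
        have "sqrt (2 * pi) \<ge> 1" using pi_bounds by simp
        hence "std_normal_density x \<le> 1 * 1"
          unfolding std_normal_density_def by (intro mult_mono) (auto simp: divide_le_eq)
        hence "ennreal (std_normal_density x) \<le> 1" by (simp add: ennreal_le_1)
        thus "ennreal (std_normal_density x) * indicator {t0 - d..t0 + d} x \<le> indicator {t0 - d..t0 + d} x"
          by (auto simp: indicator_def)
      qed
      also have "\<dots> = ennreal (2 * d)" using d by (simp add: emeasure_lborel_Icc)
      finally show ?thesis .
    qed simp
  qed
  also have "\<dots> = ennreal (2 * d)" by (simp add: R.emeasure_space_1)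
  finally show ?thesis .
qed

section \<open>The probability of one near resonance\<close>

definition energy_combination :: "nat set \<Rightarrow> (nat \<Rightarrow> int) \<Rightarrow> int \<Rightarrow> int \<Rightarrow> (real \<Rightarrow> real) \<Rightarrow> real" where
  "energy_combination A l m a V = combination (eigval V) (integral {0..pi} V / pi) A l m a"

lemma mean_lipschitz:
  assumes V: "small_potential V" and W: "small_potential W" and d: "\<And>x. \<bar>V x - W x\<bar> \<le> d"
  shows "\<bar>integral {0..pi} V / pi - integral {0..pi} W / pi\<bar> \<le> d"
proof -
  note c = small_potential_continuous[OF V] small_potential_continuous[OF W]
  have "integral {0..pi} V - integral {0..pi} W = integral {0..pi} (\<lambda>x. V x - W x)"
    by (intro integral_diff[symmetric] integrable_continuous_real c)
  moreover have "\<bar>integral {0..pi} (\<lambda>x. V x - W x)\<bar> \<le> pi * d"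
    by (intro integral_abs_bound continuous_intros c d)
  ultimately have "\<bar>integral {0..pi} V - integral {0..pi} W\<bar> / pi \<le> d" by (simp add: divide_le_eq mult.commute)
  thus ?thesis by (simp add: diff_divide_distrib[symmetric])
qed

lemma admissible_weight:
  assumes "admissible r A l m"
  shows "\<bar>real_of_int m\<bar> + (\<Sum>n\<in>A. \<bar>real_of_int (l n)\<bar>) \<le> real r"
proof -
  have "\<bar>m\<bar> + (\<Sum>n\<in>A. \<bar>l n\<bar>) \<le> int r" using assms by (simp add: admissible_def)
  hence "real_of_int (\<bar>m\<bar> + (\<Sum>n\<in>A. \<bar>l n\<bar>)) \<le> real_of_int (int r)" by (simp only: of_int_le_iff)
  thus ?thesis by simp
qed

lemma energy_combination_lipschitz:
  assumes adm: "admissible r A l m" and V: "small_potential V" and W: "small_potential W"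
    and d: "\<And>x. \<bar>V x - W x\<bar> \<le> d"
  shows "\<bar>energy_combination A l m a V - energy_combination A l m a W\<bar> \<le> (16 * real r) * d"
proof -
  have d0: "d \<ge> 0" using d[of 0] by linarith
  have A: "\<And>n. n \<in> A \<Longrightarrow> n \<ge> 1" using adm by (simp add: admissible_def)
  have "energy_combination A l m a V - energy_combination A l m a W =
    (\<Sum>n\<in>A. real_of_int (l n) * (eigval V n - eigval W n))
    + real_of_int m * (integral {0..pi} V / pi - integral {0..pi} W / pi)"
    unfolding energy_combination_def combination_def by (simp add: algebra_simps sum_subtractf)
  hence "\<bar>energy_combination A l m a V - energy_combination A l m a W\<bar> \<le>
    \<bar>\<Sum>n\<in>A. real_of_int (l n) * (eigval V n - eigval W n)\<bar>
    + \<bar>real_of_int m * (integral {0..pi} V / pi - integral {0..pi} W / pi)\<bar>"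
    by (simp only: abs_triangle_ineq)
  moreover have "\<bar>\<Sum>n\<in>A. real_of_int (l n) * (eigval V n - eigval W n)\<bar> \<le> (\<Sum>n\<in>A. \<bar>real_of_int (l n)\<bar> * (16 * d))"
    by (rule order_trans[OF sum_abs sum_mono], unfold abs_mult, intro mult_left_mono eigval_lipschitz V W A d) auto
  moreover have "\<bar>real_of_int m * (integral {0..pi} V / pi - integral {0..pi} W / pi)\<bar> \<le> \<bar>real_of_int m\<bar> * (16 * d)"
    unfolding abs_mult using mean_lipschitz[OF V W d] d0 by (intro mult_left_mono) auto
  ultimately have "\<bar>energy_combination A l m a V - energy_combination A l m a W\<bar>
     \<le> (\<bar>real_of_int m\<bar> + (\<Sum>n\<in>A. \<bar>real_of_int (l n)\<bar>)) * (16 * d)"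
    unfolding distrib_right sum_distrib_right by (simp only: add.commute)
  also have "\<dots> \<le> real r * (16 * d)" using admissible_weight[OF adm] d0 by (intro mult_right_mono) auto
  finally show ?thesis by (simp add: mult_ac)
qed

definition resonance_event :: "real \<Rightarrow> nat set \<Rightarrow> (nat \<Rightarrow> int) \<Rightarrow> int \<Rightarrow> int \<Rightarrow> real \<Rightarrow> (int \<Rightarrow> real) set" where
  "resonance_event s A l m a \<epsilon> = {v. mass_bounded s v small_size \<and> \<bar>energy_combination A l m a (random_potential s v)\<bar> < \<epsilon>}"

lemma resonance_event_measurable:
  assumes adm: "admissible r A l m"
  shows "resonance_event s A l m a \<epsilon> \<in> sets borel"
proof -
  let ?G = "\<lambda>N v. energy_combination A l m a (\<lambda>x. clamp_small (partial_potential s v N x))"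
  note lip = energy_combination_lipschitz[OF adm, of _ _ _ a]
  have [measurable]: "?G N \<in> borel_measurable borel" for N
    by (rule clamped_functional_measurable[OF _ lip]) auto
  have lm [measurable]: "(\<lambda>v. lim (\<lambda>N. ?G N v)) \<in> borel_measurable borel"
    by (rule borel_measurable_lim_metric) measurable
  have [measurable]: "(\<lambda>v::int \<Rightarrow> real. v k) \<in> borel_measurable borel" for k by (rule coordinate_measurable)
  have "lim (\<lambda>N. ?G N v) = energy_combination A l m a (random_potential s v)" if "mass_bounded s v small_size" for v
    by (rule limI[OF clamped_functional_tendsto[OF _ lip that]]) auto
  hence "resonance_event s A l m a \<epsilon> =
     {v \<in> space borel. (\<forall>N. (\<Sum>k\<in>{- int N..int N}. \<bar>v k\<bar> * amplitude s k) \<le> small_size) \<and> \<bar>lim (\<lambda>N. ?G N v)\<bar> < \<epsilon>}"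
    unfolding resonance_event_def mass_bounded_def by auto
  also have "\<dots> \<in> sets borel" by measurable
  finally show ?thesis .
qed

lemma random_potential_update:
  assumes v: "mass_bounded s v B" and w: "mass_bounded s (v(k := t)) B'"
  shows "random_potential s (v(k := t)) x = random_potential s v x + (t - v k) * amplitude s k * trig k x"
proof (rule LIMSEQ_unique[OF partial_potential_tendsto[OF w]])
  have "partial_potential s (v(k := t)) N x = partial_potential s v N x + (t - v k) * amplitude s k * trig k x"
    if "N \<ge> nat \<bar>k\<bar>" for N
  proof -
    have kN: "k \<in> {- int N..int N}" using that by auto
    have "partial_potential s (v(k := t)) N x - partial_potential s v N x =
      (\<Sum>j\<in>{- int N..int N}. if j = k then (t - v k) * amplitude s k * trig k x else 0)"
      unfolding partial_potential_def sum_subtractf[symmetric] by (rule sum.cong) (auto simp: algebra_simps)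
    also have "\<dots> = (t - v k) * amplitude s k * trig k x" using kN by simp
    finally show ?thesis by simp
  qed
  hence "\<forall>\<^sub>F N in sequentially. partial_potential s v N x + (t - v k) * amplitude s k * trig k x = partial_potential s (v(k := t)) N x"
    by (intro eventually_sequentiallyI[of "nat \<bar>k\<bar>"]) auto
  moreover have "(\<lambda>N. partial_potential s v N x + (t - v k) * amplitude s k * trig k x) \<longlonglongrightarrow>
     random_potential s v x + (t - v k) * amplitude s k * trig k x"
    by (intro tendsto_intros partial_potential_tendsto[OF v])
  ultimately show "(\<lambda>N. partial_potential s (v(k := t)) N x) \<longlonglongrightarrow> random_potential s v x + (t - v k) * amplitude s k * trig k x"
    by (rule Lim_transform_eventually[rotated])
qed

text \<open>Moving the coordinate of the dominant mode changes the combination with slope at least a quarter of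
the amplitude of that mode, so two points of the event on one line are close together. The inverse
of the amplitude is the power of \<open>M\<close> on the right.\<close>

lemma resonance_event_probability:
  assumes adm: "admissible r A l m" and M: "Max A \<le> M" and s: "s > 0" and \<epsilon>: "\<epsilon> \<ge> 0"
  shows "emeasure gaussian_sequence (resonance_event s A l m a \<epsilon>) \<le> ennreal (16 * \<epsilon> * real (3 * M) ^ nat \<lceil>s\<rceil>)"
proof -
  have A: "finite A" "A \<noteq> {}" "\<And>n. n \<in> A \<Longrightarrow> n \<ge> 1" "\<And>n. n \<in> A \<Longrightarrow> l n \<noteq> 0" using adm by (auto simp: admissible_def)
  obtain i where i: "i \<in> A" "(\<Sum>n\<in>A. \<bar>real_of_int (l n)\<bar> / real (max n i)) \<le> 4 * \<bar>real_of_int (l i)\<bar>"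
    using dominant_index_exists[OF A(1-3)] by blast
  \<comment> \<open>Nonnegative indices are the cosine modes.\<close>
  define k where "k = 2 * int i"
  define b where "b = amplitude s k"
  have b: "b > 0" unfolding b_def by (rule amplitude_pos)
  have k: "trig k x = cos (2 * real i * x)" for x by (simp add: trig_def k_def)
  have "emeasure gaussian_sequence (resonance_event s A l m a \<epsilon>) \<le> ennreal (2 * (8 * \<epsilon> / b))"
  proof (rule thin_slices_small_measure[OF resonance_event_measurable[OF adm], where j = k])
    show "8 * \<epsilon> / b \<ge> 0" using \<epsilon> b by simp
    fix v t assume v: "v \<in> resonance_event s A l m a \<epsilon>" and w: "v(k := t) \<in> resonance_event s A l m a \<epsilon>"
    let ?V = "random_potential s (v(k := t))" and ?W = "random_potential s v"
    have mb: "mass_bounded s v small_size" "mass_bounded s (v(k := t)) small_size"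
      using v w by (auto simp: resonance_event_def)
    have "?V x = ?W x + ((t - v k) * b) * cos (2 * real i * x)" for x
      using random_potential_update[OF mb] by (simp add: k b_def)
    from combination_slope[OF mass_bounded_small_potential(1)[OF mb(2)] mass_bounded_small_potential(1)[OF mb(1)]
        A(1,3) i(1) A(4)[OF i(1)] i(2) this, of m a]
    have "\<bar>(t - v k) * b\<bar> / 4 \<le> \<bar>energy_combination A l m a ?V - energy_combination A l m a ?W\<bar>"
      unfolding energy_combination_def .
    moreover have "\<bar>energy_combination A l m a ?V\<bar> < \<epsilon>" "\<bar>energy_combination A l m a ?W\<bar> < \<epsilon>"
      using v w by (auto simp: resonance_event_def)
    ultimately have "\<bar>(t - v k) * b\<bar> \<le> 8 * \<epsilon>" by linarith
    thus "\<bar>t - v k\<bar> \<le> 8 * \<epsilon> / b" using b by (simp add: abs_mult pos_le_divide_eq)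
  qed
  also have "\<dots> \<le> ennreal (16 * \<epsilon> * real (3 * M) ^ nat \<lceil>s\<rceil>)"
  proof (rule ennreal_leI)
    let ?J = "japanese_bracket (of_int k)"
    have iM: "i \<le> M" "i \<ge> 1" using i(1) A M by (auto intro: order_trans[OF Max_ge])
    have "?J \<le> 1 + 2 * real i" unfolding japanese_bracket_def k_def
      by (rule real_le_lsqrt) (auto simp: power2_eq_square algebra_simps)
    hence J: "?J \<le> real (3 * M)" using iM by simp
    have "1 / b = ?J powr s" unfolding b_def amplitude_def by (simp add: powr_minus_divide)
    also have "\<dots> \<le> real (3 * M) powr s"
      using J japanese_bracket_ge_1[of "of_int k"] s by (intro powr_mono2) auto
    also have "\<dots> \<le> real (3 * M) powr real (nat \<lceil>s\<rceil>)"
      using iM s by (intro powr_mono) (auto simp: le_of_int_ceiling)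
    also have "\<dots> = real (3 * M) ^ nat \<lceil>s\<rceil>" using iM by (intro powr_realpow) auto
    finally have "16 * \<epsilon> * (1 / b) \<le> 16 * \<epsilon> * real (3 * M) ^ nat \<lceil>s\<rceil>" using \<epsilon> by (intro mult_left_mono) auto
    thus "2 * (8 * \<epsilon> / b) \<le> 16 * \<epsilon> * real (3 * M) ^ nat \<lceil>s\<rceil>" by simp
  qed
  finally show ?thesis .
qed

section \<open>Counting relations\<close>

text \<open>The normalisation \<open>l n = 0\<close> off \<open>A\<close> makes each relation occur only once, so that the set is
finite.\<close>

definition relations :: "nat \<Rightarrow> nat \<Rightarrow> nat \<Rightarrow> nat \<Rightarrow> (nat set \<times> (nat \<Rightarrow> int) \<times> int \<times> int) set" where
  "relations r q M B = {(A, l, m, a). admissible r A l m \<and> (\<forall>n. n \<notin> A \<longrightarrow> l n = 0) \<and> Min A = q \<and> Max A \<le> M \<and> \<bar>a\<bar> \<le> int B}"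

text \<open>A relation has at most \<open>r\<close> indices, since its coefficients are nonzero integers of total weight at
most \<open>r\<close>. It is encoded by the list of its pairs \<open>(n, l n)\<close>, padded with \<open>(0, 0)\<close> to length \<open>r\<close>.\<close>

lemma card_relations:
  "finite (relations r q M B)"
  "card (relations r q M B) \<le> (Suc M * (2 * r + 1)) ^ r * (2 * r + 1) * (2 * B + 1)"
proof -
  define Y where "Y = {0..M} \<times> {- int r..int r}"
  define L where "L = {xs. set xs \<subseteq> Y \<and> length xs = r}"
  define D where "D = (\<lambda>(xs :: (nat \<times> int) list, m :: int, a :: int).
     (set (map fst xs) - {0}, \<lambda>n. case map_of xs n of None \<Rightarrow> 0 | Some c \<Rightarrow> c, m, a))"
  define X where "X = L \<times> {- int r..int r} \<times> {- int B..int B}"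
  have ci: "card {- int n..int n} = 2 * n + 1" for n by (auto simp: nat_eq_iff)
  have Y: "finite Y" "card Y = Suc M * (2 * r + 1)" by (auto simp: Y_def card_cartesian_product ci simp del: card_atLeastAtMost_int)
  have X: "finite X" "card X = (Suc M * (2 * r + 1)) ^ r * (2 * r + 1) * (2 * B + 1)"
  proof -
    have L: "finite L" "card L = (Suc M * (2 * r + 1)) ^ r"
      using card_lists_length_eq[OF Y(1), of r] finite_lists_length_eq[OF Y(1), of r] unfolding L_def Y(2) by blast+
    show "finite X" using L(1) by (simp add: X_def)
    have "card X = card L * (card {- int r..int r} * card {- int B..int B})"
      unfolding X_def by (simp only: card_cartesian_product)
    thus "card X = (Suc M * (2 * r + 1)) ^ r * (2 * r + 1) * (2 * B + 1)" unfolding L(2) ci by (simp only: mult.assoc)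
  qed
  have "relations r q M B \<subseteq> D ` X"
  proof
    fix \<tau> assume "\<tau> \<in> relations r q M B"
    then obtain A l m a where \<tau>: "\<tau> = (A, l, m, a)" and adm: "admissible r A l m" and l0: "\<And>n. n \<notin> A \<Longrightarrow> l n = 0"
      and M: "Max A \<le> M" and a: "\<bar>a\<bar> \<le> int B" by (auto simp: relations_def)
    have A: "finite A" "A \<noteq> {}" "\<And>n. n \<in> A \<Longrightarrow> n \<ge> 1" "\<And>n. n \<in> A \<Longrightarrow> l n \<noteq> 0" using adm by (auto simp: admissible_def)
    have w: "\<bar>m\<bar> + (\<Sum>n\<in>A. \<bar>l n\<bar>) \<le> int r" using adm by (simp add: admissible_def)
    have s0: "(\<Sum>n\<in>A. \<bar>l n\<bar>) \<ge> 0" by (rule sum_nonneg) simp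
    have m: "\<bar>m\<bar> \<le> int r" using w s0 by linarith
    have ln: "\<bar>l n\<bar> \<le> int r" if "n \<in> A" for n
    proof -
      have "\<bar>l n\<bar> \<le> (\<Sum>n\<in>A. \<bar>l n\<bar>)" by (rule member_le_sum[OF that]) (use A in auto)
      thus ?thesis using w by linarith
    qed
    have cA: "card A \<le> r"
    proof -
      have "int (card A) = (\<Sum>n\<in>A. 1)" by simp
      also have "\<dots> \<le> (\<Sum>n\<in>A. \<bar>l n\<bar>)" by (rule sum_mono) (use A(4) in force)
      finally show ?thesis using w by linarith
    qed
    define xs where "xs = map (\<lambda>n. (n, l n)) (sorted_list_of_set A) @ replicate (r - card A) (0, 0)"
    have nA: "n \<le> M" if "n \<in> A" for n using that A(1) M by (meson Max_ge order_trans)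
    have "set xs \<subseteq> Y" unfolding xs_def Y_def using A(1) nA ln by (fastforce simp: abs_le_iff split: if_splits)
    moreover have "length xs = r" unfolding xs_def using A(1) cA by simp
    ultimately have "(xs, m, a) \<in> X" using m a by (auto simp: X_def L_def abs_le_iff)
    moreover have "D (xs, m, a) = \<tau>"
    proof -
      have "set (map fst xs) - {0} = A" unfolding xs_def using A(1) A(3) by (force simp: image_image)
      moreover have "(case map_of xs n of None \<Rightarrow> 0 | Some c \<Rightarrow> c) = l n" for n
      proof (cases "n \<in> A")
        case True
        hence "n \<noteq> 0" using A(3) by force
        hence "map_of (replicate (r - card A) (0::nat, 0::int)) n = None"
          by (auto simp: map_of_eq_None_iff)
        hence "map_of xs n = Some (l n)" using True A(1)
          by (simp add: xs_def map_add_def map_of_map_restrict)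
        thus ?thesis by simp
      next
        case False
        hence "map_of (map (\<lambda>n. (n, l n)) (sorted_list_of_set A)) n = None" using A(1) by (simp add: map_of_map_restrict)
        hence "map_of xs n = map_of (replicate (r - card A) (0, 0)) n"
          by (simp add: xs_def map_add_def split: option.split)
        moreover have "map_of (replicate j (0::nat, 0::int)) n \<in> {None, Some 0}" for j by (induction j) auto
        ultimately have "map_of xs n = None \<or> map_of xs n = Some 0" by simp
        thus ?thesis using l0[OF False] by auto
      qed
      ultimately show ?thesis by (simp add: D_def \<tau> fun_eq_iff)
    qed
    ultimately show "\<tau> \<in> D ` X" by (metis imageI)
  qed
  note sub = this
  show "finite (relations r q M B)" by (rule finite_subset[OF sub finite_imageI[OF X(1)]])
  have "card (relations r q M B) \<le> card X"
    by (rule order_trans[OF card_mono[OF finite_imageI[OF X(1)] sub] card_image_le[OF X(1)]])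
  thus "card (relations r q M B) \<le> (Suc M * (2 * r + 1)) ^ r * (2 * r + 1) * (2 * B + 1)" unfolding X(2) .
qed

text \<open>Shifts \<open>a\<close> beyond the size of the other terms cannot produce a resonance, so only polynomially many
of them have to be considered.\<close>

lemma energy_combination_large_shift:
  assumes adm: "admissible r A l m" and M: "Max A \<le> M" and V: "small_potential V"
    and a: "\<bar>a\<bar> > int (r * (M\<^sup>2 + 1) + 1)"
  shows "\<bar>energy_combination A l m a V\<bar> \<ge> 1"
proof -
  have A: "finite A" "A \<noteq> {}" "\<And>n. n \<in> A \<Longrightarrow> n \<ge> 1" using adm by (auto simp: admissible_def)
  have e: "\<bar>eigval V n\<bar> \<le> (real M)\<^sup>2 + 1" if "n \<in> A" for n
  proof -
    have "n \<le> M" using that A M by (meson Max_ge order_trans)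
    hence "(real n)\<^sup>2 \<le> (real M)\<^sup>2" by (intro power_mono) auto
    moreover have "(real n)\<^sup>2 \<ge> 0" by simp
    ultimately show ?thesis using eigval_near_square[OF V A(3)[OF that]] unfolding small_size_def by linarith
  qed
  have c: "\<bar>integral {0..pi} V / pi\<bar> \<le> (real M)\<^sup>2 + 1"
  proof -
    have "\<bar>integral {0..pi} V / pi - integral {0..pi} (\<lambda>_. 0) / pi\<bar> \<le> small_size"
      by (rule mean_lipschitz[OF V zero_small_potential]) (use small_potential_bound[OF V] in simp)
    hence "\<bar>integral {0..pi} V / pi\<bar> \<le> small_size" by (simp only: integral_0 div_0 diff_0_right)
    moreover have "(real M)\<^sup>2 \<ge> 0" "small_size \<le> 1" by (simp_all add: small_size_def)
    ultimately show ?thesis by linarith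
  qed
  have tri: "1 \<le> \<bar>x + y + z\<bar>" if "\<bar>x\<bar> \<le> X" "\<bar>y\<bar> \<le> Y" "Y + X \<le> R" "R + 1 \<le> \<bar>z\<bar>" for x y z X Y R :: real
    using that by linarith
  have "\<bar>\<Sum>n\<in>A. real_of_int (l n) * eigval V n\<bar> \<le> (\<Sum>n\<in>A. \<bar>real_of_int (l n)\<bar> * ((real M)\<^sup>2 + 1))"
    by (rule order_trans[OF sum_abs sum_mono], unfold abs_mult, intro mult_left_mono e) auto
  moreover have "\<bar>real_of_int m * (integral {0..pi} V / pi)\<bar> \<le> \<bar>real_of_int m\<bar> * ((real M)\<^sup>2 + 1)"
    unfolding abs_mult by (intro mult_left_mono c) auto
  moreover have "(\<bar>real_of_int m\<bar> + (\<Sum>n\<in>A. \<bar>real_of_int (l n)\<bar>)) * ((real M)\<^sup>2 + 1) \<le> real r * ((real M)\<^sup>2 + 1)"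
    using admissible_weight[OF adm] by (intro mult_right_mono) auto
  moreover have "\<bar>real_of_int a\<bar> \<ge> real r * ((real M)\<^sup>2 + 1) + 1"
  proof -
    have "real_of_int (int (r * (M\<^sup>2 + 1) + 1)) \<le> real_of_int \<bar>a\<bar>" using a by (simp only: of_int_le_iff)
    thus ?thesis by (simp add: algebra_simps)
  qed
  ultimately show ?thesis
    unfolding energy_combination_def combination_def distrib_right sum_distrib_right by (rule tri)
qed

lemma relations_count_polynomial:
  assumes M: "M \<ge> 1"
  shows "real (card (relations r q M (r * (M\<^sup>2 + 1) + 1))) \<le>
     (2 * (2 * real r + 1)) ^ r * (2 * real r + 1) * (4 * real r + 3) * real M ^ (r + 2)"
proof -
  define B where "B = r * (M\<^sup>2 + 1) + 1"
  have MM: "1 \<le> M\<^sup>2" using M by (simp add: power2_eq_square)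
  have "card (relations r q M B) \<le> (Suc M * (2 * r + 1)) ^ r * (2 * r + 1) * (2 * B + 1)" by (rule card_relations)
  also have "\<dots> \<le> (2 * M * (2 * r + 1)) ^ r * (2 * r + 1) * ((4 * r + 3) * M\<^sup>2)"
  proof (intro mult_le_mono power_mono le_refl)
    show "Suc M \<le> 2 * M" using M by simp
    have "r * (M\<^sup>2 + 1) \<le> r * (2 * M\<^sup>2)" using MM by (intro mult_le_mono) auto
    hence "2 * B + 1 \<le> 2 * (r * (2 * M\<^sup>2)) + 3" unfolding B_def by simp
    also have "\<dots> \<le> 2 * (r * (2 * M\<^sup>2)) + 3 * M\<^sup>2" using MM by simp
    also have "\<dots> = (4 * r + 3) * M\<^sup>2" by (simp add: algebra_simps)
    finally show "2 * B + 1 \<le> (4 * r + 3) * M\<^sup>2" .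
  qed auto
  finally have "real (card (relations r q M B)) \<le> real ((2 * M * (2 * r + 1)) ^ r * (2 * r + 1) * ((4 * r + 3) * M\<^sup>2))"
    by (simp only: of_nat_le_iff)
  also have "\<dots> = (2 * (2 * real r + 1)) ^ r * (2 * real r + 1) * (4 * real r + 3) * real M ^ (r + 2)"
  proof -
    have b: "real (2 * M * (2 * r + 1)) = real M * (2 * (2 * real r + 1))" "real (2 * r + 1) = 2 * real r + 1"
      "real (4 * r + 3) = 4 * real r + 3" by (simp_all add: algebra_simps)
    show ?thesis
      unfolding of_nat_mult[of "_ * _" "_ * _"] of_nat_mult[of "_ ^ r"] of_nat_mult[of _ "M\<^sup>2"] of_nat_power b power_add power_mult_distrib[of "real M"]
      by (simp only: mult_ac)
  qed
  finally show ?thesis unfolding B_def .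
qed

section \<open>Almost sure absence of resonances\<close>

text \<open>Borel-Cantelli over the smallest index \<open>q\<close>. The number of relations and the inverse amplitude are
both powers of \<open>q + 1\<close>, and the exponent is chosen such that the probabilities are bounded by a
multiple of \<open>1 / (q + 1)\<^sup>2\<close>.\<close>

lemma AE_eventually_no_resonance:
  assumes s: "s > 0"
  shows "\<exists>\<alpha>::nat. AE v in gaussian_sequence. \<forall>\<^sub>F q in sequentially.
     \<forall>(A, l, m, a) \<in> relations r q ((q + 1) ^ K) (r * (((q + 1) ^ K)\<^sup>2 + 1) + 1).
        v \<notin> resonance_event s A l m a (1 / real (q + 1) ^ \<alpha>)"
proof -
  define S where "S = nat \<lceil>s\<rceil>"
  \<comment> \<open>\<open>M ^ (r + 2)\<close> bounds the number of relations and \<open>M ^ S\<close> the inverse amplitude, up to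
    constants, where \<open>M = (q + 1) ^ K\<close>; the final 2 gives summability.\<close>
  define \<alpha> where "\<alpha> = K * (r + 2 + S) + 2"
  define C where "C = (2 * (2 * real r + 1)) ^ r * (2 * real r + 1) * (4 * real r + 3)"
  define M where "M = (\<lambda>q::nat. (q + 1) ^ K)"
  define R where "R = (\<lambda>q. relations r q (M q) (r * ((M q)\<^sup>2 + 1) + 1))"
  define \<epsilon> where "\<epsilon> = (\<lambda>q. 1 / real (q + 1) ^ \<alpha>)"
  define E where "E = (\<lambda>q. \<Union>(A, l, m, a) \<in> R q. resonance_event s A l m a (\<epsilon> q))"
  interpret prob_space gaussian_sequence by (rule prob_space_gaussian_sequence)
  have R: "admissible r A l m" "Max A \<le> M q" if "(A, l, m, a) \<in> R q" for q A l m a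
    using that by (auto simp: R_def relations_def)
  have fin: "finite (R q)" for q unfolding R_def by (rule card_relations(1))
  have M1: "M q \<ge> 1" for q by (simp add: M_def)
  have \<epsilon>0: "\<epsilon> q \<ge> 0" for q by (simp add: \<epsilon>_def)
  have meas1: "(case \<tau> of (A, l, m, a) \<Rightarrow> resonance_event s A l m a (\<epsilon> q)) \<in> events" if "\<tau> \<in> R q" for \<tau> q
    using that R(1)[of _ _ _ _ q] by (auto simp: sets_gaussian_sequence intro!: resonance_event_measurable split: prod.splits)
  have meas: "E q \<in> events" for q
    unfolding E_def using fin meas1 by (intro sets.finite_UN) auto
  have C0: "C \<ge> 0" unfolding C_def by (intro mult_nonneg_nonneg) auto
  have pE: "prob (E q) \<le> C * 16 * 3 ^ S * (1 / real (q + 1) ^ 2)" for q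
  proof -
    have "prob (E q) \<le> (\<Sum>\<tau>\<in>R q. prob (case \<tau> of (A, l, m, a) \<Rightarrow> resonance_event s A l m a (\<epsilon> q)))"
      unfolding E_def by (rule finite_measure_subadditive_finite[OF fin]) (use meas1 in auto)
    also have "\<dots> \<le> (\<Sum>\<tau>\<in>R q. 16 * \<epsilon> q * real (3 * M q) ^ S)"
    proof (rule sum_mono)
      fix \<tau> assume t: "\<tau> \<in> R q"
      obtain A l m a where \<tau>: "\<tau> = (A, l, m, a)" by (cases \<tau>)
      have "emeasure gaussian_sequence (resonance_event s A l m a (\<epsilon> q)) \<le> ennreal (16 * \<epsilon> q * real (3 * M q) ^ S)"
        unfolding S_def using R[of A l m a q] t s \<epsilon>0 unfolding \<tau> by (intro resonance_event_probability) auto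
      thus "prob (case \<tau> of (A, l, m, a) \<Rightarrow> resonance_event s A l m a (\<epsilon> q)) \<le> 16 * \<epsilon> q * real (3 * M q) ^ S"
        unfolding \<tau> emeasure_eq_measure using \<epsilon>0[of q] by (subst (asm) ennreal_le_iff) (auto intro!: mult_nonneg_nonneg)
    qed
    also have "\<dots> = real (card (R q)) * (16 * \<epsilon> q * real (3 * M q) ^ S)" by simp
    also have "\<dots> \<le> (C * real (M q) ^ (r + 2)) * (16 * \<epsilon> q * real (3 * M q) ^ S)"
      unfolding C_def R_def by (intro mult_right_mono relations_count_polynomial M1) (use \<epsilon>0 in auto)
    also have "\<dots> = C * 16 * 3 ^ S * (real (M q) ^ (r + 2 + S) * \<epsilon> q)"
      by (simp add: power_add power_mult_distrib mult_ac)
    also have "real (M q) ^ (r + 2 + S) * \<epsilon> q = 1 / real (q + 1) ^ 2"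
    proof -
      have "real (M q) ^ (r + 2 + S) = real (q + 1) ^ (K * (r + 2 + S))"
        by (simp only: M_def of_nat_power power_mult)
      moreover have "real (q + 1) ^ \<alpha> = real (q + 1) ^ (K * (r + 2 + S)) * real (q + 1) ^ 2"
        unfolding \<alpha>_def by (rule power_add)
      moreover have "real (q + 1) ^ (K * (r + 2 + S)) > 0" by simp
      ultimately show ?thesis unfolding \<epsilon>_def by (simp del: of_nat_add of_nat_Suc)
    qed
    finally show ?thesis .
  qed
  have "AE v in gaussian_sequence. \<forall>\<^sub>F q in sequentially. v \<in> space gaussian_sequence - E q"
  proof (rule borel_cantelli_AE1[OF meas])
    show "emeasure gaussian_sequence (E q) < \<infinity>" for q by (simp add: emeasure_eq_measure)
    have "summable (\<lambda>q. 1 / real (q + 1) ^ 2)"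
      using summable_ignore_initial_segment[OF inverse_power_summable[of 2], of 1] by (simp add: field_simps)
    hence "summable (\<lambda>q. C * 16 * 3 ^ S * (1 / real (q + 1) ^ 2))" by (rule summable_mult)
    thus "summable (\<lambda>q. prob (E q))"
      by (rule summable_comparison_test'[where N = 0]) (use pE in auto)
  qed
  hence "AE v in gaussian_sequence. \<forall>\<^sub>F q in sequentially.
     \<forall>(A, l, m, a) \<in> R q. v \<notin> resonance_event s A l m a (\<epsilon> q)"
    by eventually_elim (auto simp: E_def elim!: eventually_mono)
  thus ?thesis unfolding R_def M_def \<epsilon>_def by blast
qed

text \<open>An exact resonance lies in near-resonance events of arbitrarily small probability. This disposes of
the finitely many smallest indices that the Borel-Cantelli lemma leaves open.\<close>

lemma AE_no_exact_resonance:
  assumes s: "s > 0" and adm: "admissible r A l m"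
  shows "AE v in gaussian_sequence. mass_bounded s v small_size \<longrightarrow> energy_combination A l m a (random_potential s v) \<noteq> 0"
proof -
  interpret prob_space gaussian_sequence by (rule prob_space_gaussian_sequence)
  define Z where "Z = (\<Inter>j. resonance_event s A l m a (1 / real (Suc j)))"
  have m: "resonance_event s A l m a \<epsilon> \<in> events" for \<epsilon>
    using resonance_event_measurable[OF adm] by (simp add: sets_gaussian_sequence)
  have Zm: "Z \<in> events" unfolding Z_def by (intro sets.countable_INT) (use m in auto)
  define D where "D = 16 * real (3 * Max A) ^ nat \<lceil>s\<rceil>"
  have "prob Z \<le> D * (1 / real (Suc j))" for j
  proof -
    have "emeasure gaussian_sequence Z \<le> emeasure gaussian_sequence (resonance_event s A l m a (1 / real (Suc j)))"
      by (rule emeasure_mono[OF _ m]) (auto simp: Z_def)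
    also have "\<dots> \<le> ennreal (16 * (1 / real (Suc j)) * real (3 * Max A) ^ nat \<lceil>s\<rceil>)"
      by (rule resonance_event_probability[OF adm order_refl s]) simp
    finally have "ennreal (prob Z) \<le> ennreal (D * (1 / real (Suc j)))" unfolding emeasure_eq_measure D_def by (simp add: mult_ac)
    thus ?thesis by (subst (asm) ennreal_le_iff) (auto simp: D_def)
  qed
  moreover have "(\<lambda>j. D * (1 / real (Suc j))) \<longlonglongrightarrow> D * 0"
    by (intro tendsto_mult tendsto_const lim_1_over_n[THEN LIMSEQ_Suc])
  ultimately have "prob Z \<le> D * 0" by (intro LIMSEQ_le_const) auto
  hence "prob Z = 0" using measure_nonneg[of gaussian_sequence Z] by simp
  hence "Z \<in> null_sets gaussian_sequence" using Zm by (simp add: null_sets_def emeasure_eq_measure)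
  hence "AE v in gaussian_sequence. v \<notin> Z" by (rule AE_not_in)
  thus ?thesis by eventually_elim (auto simp: Z_def resonance_event_def)
qed

lemma finite_positive_lower_bound:
  fixes f :: "'b \<Rightarrow> real"
  assumes "finite T" "\<And>\<tau>. \<tau> \<in> T \<Longrightarrow> f \<tau> > 0"
  shows "\<exists>c>0. c \<le> 1 \<and> (\<forall>\<tau>\<in>T. c \<le> f \<tau>)"
proof (intro exI conjI ballI)
  show "Min (insert 1 (f ` T)) > 0" using assms by (subst Min_gr_iff) auto
qed (use assms in auto)

lemma AE_nonresonant_in_range:
  assumes s: "s > 0"
  shows "AE v in gaussian_sequence. mass_bounded s v small_size \<longrightarrow>
     nonresonant_in_range (eigval (random_potential s v)) (integral {0..pi} (random_potential s v) / pi)"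
proof -
  let ?R = "\<lambda>r K q. relations r q ((q + 1) ^ K) (r * (((q + 1) ^ K)\<^sup>2 + 1) + 1)"
  define \<alpha> where "\<alpha> = (\<lambda>r K. SOME \<alpha>::nat. AE v in gaussian_sequence. \<forall>\<^sub>F q in sequentially.
     \<forall>(A, l, m, a) \<in> ?R r K q. v \<notin> resonance_event s A l m a (1 / real (q + 1) ^ \<alpha>))"
  have ev: "AE v in gaussian_sequence. \<forall>\<^sub>F q in sequentially.
     \<forall>(A, l, m, a) \<in> ?R r K q. v \<notin> resonance_event s A l m a (1 / real (q + 1) ^ \<alpha> r K)" for r K
    unfolding \<alpha>_def by (rule someI_ex[OF AE_eventually_no_resonance[OF s]])
  have ev': "AE v in gaussian_sequence. \<forall>r K. \<forall>\<^sub>F q in sequentially.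
     \<forall>(A, l, m, a) \<in> ?R r K q. v \<notin> resonance_event s A l m a (1 / real (q + 1) ^ \<alpha> r K)"
    unfolding AE_all_countable using ev by blast
  have "AE v in gaussian_sequence. \<forall>\<tau> \<in> ?R r K q. case \<tau> of (A, l, m, a) \<Rightarrow>
     mass_bounded s v small_size \<longrightarrow> energy_combination A l m a (random_potential s v) \<noteq> 0" for r K q
    unfolding AE_finite_all[OF card_relations(1)] 
    using AE_no_exact_resonance[OF s] by (auto simp: relations_def)
  hence nz: "AE v in gaussian_sequence. \<forall>r K q. \<forall>\<tau> \<in> ?R r K q. case \<tau> of (A, l, m, a) \<Rightarrow>
     mass_bounded s v small_size \<longrightarrow> energy_combination A l m a (random_potential s v) \<noteq> 0"
    unfolding AE_all_countable by blast
  from ev' nz show ?thesis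
  proof (eventually_elim, intro impI)
    case (elim v)
    assume ball: "mass_bounded s v small_size"
    let ?V = "random_potential s v"
    have V: "small_potential ?V" by (rule mass_bounded_small_potential(1)[OF ball])
    show "nonresonant_in_range (eigval ?V) (integral {0..pi} ?V / pi)"
      unfolding nonresonant_in_range_def
    proof (intro allI)
      fix r K :: nat
      obtain q0 where q0: "\<And>q A l m a. q \<ge> q0 \<Longrightarrow> (A, l, m, a) \<in> ?R r K q \<Longrightarrow> v \<notin> resonance_event s A l m a (1 / real (q + 1) ^ \<alpha> r K)"
        using elim(1) unfolding eventually_sequentially by fast
      let ?f = "\<lambda>(A, l, m, a). \<bar>energy_combination A l m a ?V\<bar>"
      have "finite (\<Union>q<q0. ?R r K q)" by (intro finite_UN_I card_relations(1)) auto
      moreover have "?f \<tau> > 0" if "\<tau> \<in> (\<Union>q<q0. ?R r K q)" for \<tau>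
        using that elim(2) ball by fastforce
      ultimately have "\<exists>c>0. c \<le> 1 \<and> (\<forall>\<tau>\<in>(\<Union>q<q0. ?R r K q). c \<le> ?f \<tau>)"
        by (rule finite_positive_lower_bound)
      then obtain c where c: "c > 0" "c \<le> 1" "\<And>\<tau>. \<tau> \<in> (\<Union>q<q0. ?R r K q) \<Longrightarrow> c \<le> ?f \<tau>"
        by blast
      show "\<exists>\<gamma>>0. \<exists>\<alpha>. \<forall>A l m a. admissible r A l m \<longrightarrow> Max A \<le> (Min A + 1) ^ K \<longrightarrow>
          \<gamma> / real (Min A + 1) ^ \<alpha> \<le> \<bar>combination (eigval ?V) (integral {0..pi} ?V / pi) A l m a\<bar>"
      proof (rule exI[of _ c], rule conjI[OF c(1)], rule exI[of _ "\<alpha> r K"], intro allI impI)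
        fix A l m a assume adm: "admissible r A l m" and MA: "Max A \<le> (Min A + 1) ^ K"
        define q where "q = Min A"
        \<comment> \<open>Only the values of \<open>l\<close> on \<open>A\<close> matter; this picks the normalised representative.\<close>
        define l' where "l' = (\<lambda>n. if n \<in> A then l n else 0)"
        have same: "energy_combination A l' m a ?V = energy_combination A l m a ?V"
          unfolding energy_combination_def combination_def l'_def by simp
        have adm': "admissible r A l' m" using adm unfolding admissible_def l'_def by simp
        have p1: "c / real (q + 1) ^ \<alpha> r K \<le> c"
          using c(1) by (simp add: divide_le_eq mult_le_cancel_left1)
        have "c / real (q + 1) ^ \<alpha> r K \<le> \<bar>energy_combination A l' m a ?V\<bar>"
        proof (cases "\<bar>a\<bar> \<le> int (r * (((q + 1) ^ K)\<^sup>2 + 1) + 1)")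
          case False
          have "1 \<le> \<bar>energy_combination A l' m a ?V\<bar>"
            by (rule energy_combination_large_shift[OF adm' MA V]) (use False in \<open>simp add: q_def\<close>)
          thus ?thesis using p1 c(2) by linarith
        next
          case True
          have mem: "(A, l', m, a) \<in> ?R r K q"
            using adm' MA True by (auto simp: relations_def q_def l'_def)
          show ?thesis
          proof (cases "q < q0")
            case True
            have "c \<le> ?f (A, l', m, a)" by (rule c(3)) (use True mem in auto)
            thus ?thesis using p1 by simp
          next
            case False
            have "v \<notin> resonance_event s A l' m a (1 / real (q + 1) ^ \<alpha> r K)"
              by (rule q0[OF _ mem]) (use False in simp)
            hence "1 / real (q + 1) ^ \<alpha> r K \<le> \<bar>energy_combination A l' m a ?V\<bar>"
              using ball by (simp add: resonance_event_def)
            moreover have "c / real (q + 1) ^ \<alpha> r K \<le> 1 / real (q + 1) ^ \<alpha> r K"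
              using c(2) by (intro divide_right_mono) auto
            ultimately show ?thesis by linarith
          qed
        qed
        thus "c / real (Min A + 1) ^ \<alpha> r K \<le> \<bar>combination (eigval ?V) (integral {0..pi} ?V / pi) A l m a\<bar>"
          unfolding same unfolding q_def energy_combination_def .
      qed
    qed
  qed
qed

lemma AE_strongly_nonresonant_spectrum:
  assumes s: "s > 3 / 2"
  shows "AE v in gaussian_sequence. H1_norm_torus (random_potential s v) < ereal (small_size / 10) \<longrightarrow>
     (\<exists>lam. is_dirichlet_spectrum (random_potential s v) lam \<and> strongly_nonresonant lam)"
proof -
  have "s > 0" "s - 1/2 > 1" using s by simp_all
  from AE_nonresonant_in_range[OF this(1)] AE_mass_bounded[OF this(2)]
  show ?thesis
  proof (eventually_elim, intro impI)
    case (elim v)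
    assume H1: "H1_norm_torus (random_potential s v) < ereal (small_size / 10)"
    let ?V = "random_potential s v"
    obtain B where B: "mass_bounded (s - 1/2) v B" using elim(2) by blast
    have ball: "mass_bounded s v small_size"
      by (rule H1_norm_controls_mass[OF mass_bounded_amplitude_mono[OF B] H1]) simp
    obtain C where C: "C > 0" "\<And>n. n \<ge> 1 \<Longrightarrow> \<bar>eigval ?V n - (real n)\<^sup>2 - integral {0..pi} ?V / pi\<bar> \<le> C / sqrt (real n)"
      using eigval_decay[OF ball B] by blast
    have "strongly_nonresonant (eigval ?V)"
      by (rule strongly_nonresonantI[OF _ C]) (use elim(1) ball in blast)
    thus "\<exists>lam. is_dirichlet_spectrum ?V lam \<and> strongly_nonresonant lam"
      using eigval_is_dirichlet_spectrum[OF mass_bounded_small_potential(1)[OF ball]] by blast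
  qed
qed

section \<open>Independent Gaussian families\<close>

lemma distr_gaussian_family:
  fixes X :: "int \<Rightarrow> 'a \<Rightarrow> real"
  assumes M: "prob_space M" and indep: "prob_space.indep_vars M (\<lambda>_. borel) X UNIV"
    and gauss: "\<And>n. distributed M lborel (X n) (\<lambda>x. ennreal (std_normal_density x))"
  shows "(\<lambda>w n. X n w) \<in> measurable M gaussian_sequence"
    and "distr M gaussian_sequence (\<lambda>w n. X n w) = gaussian_sequence"
proof -
  interpret prob_space M by (rule M)
  have Xm: "X n \<in> borel_measurable M" for n
    using distributed_measurable[OF gauss, of n] by simp
  have "(\<lambda>w. \<lambda>n\<in>UNIV. X n w) \<in> measurable M (Pi\<^sub>M UNIV (\<lambda>_. borel))"
    by (rule measurable_restrict) (rule Xm)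
  hence Xp: "(\<lambda>w n. X n w) \<in> measurable M (Pi\<^sub>M UNIV (\<lambda>_. borel))" by (simp add: restrict_UNIV)
  have sets: "sets gaussian_sequence = sets (Pi\<^sub>M UNIV (\<lambda>i::int. borel :: real measure))"
    unfolding gaussian_sequence_def by (rule sets_PiM_cong) auto
  show "(\<lambda>w n. X n w) \<in> measurable M gaussian_sequence"
    using Xp measurable_cong_sets[OF refl sets] by blast
  have d: "distr M borel (X n) = std_normal_distribution" for n
  proof -
    have "distr M borel (X n) = distr M lborel (X n)" by (rule distr_cong) auto
    thus ?thesis using distributed_distr_eq_density[OF gauss, of n] by simp
  qed
  have "distr M (Pi\<^sub>M UNIV (\<lambda>_. borel)) (\<lambda>w. \<lambda>n\<in>UNIV. X n w) = Pi\<^sub>M UNIV (\<lambda>n. distr M borel (X n))"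
    using indep_vars_iff_distr_eq_PiM[of UNIV X "\<lambda>_. borel"] indep Xm by simp
  hence "distr M (Pi\<^sub>M UNIV (\<lambda>_. borel)) (\<lambda>w n. X n w) = gaussian_sequence"
    unfolding d gaussian_sequence_def by (simp add: restrict_UNIV)
  moreover have "distr M gaussian_sequence (\<lambda>w n. X n w) = distr M (Pi\<^sub>M UNIV (\<lambda>_. borel)) (\<lambda>w n. X n w)"
    by (rule distr_cong[OF refl sets]) simp
  ultimately show "distr M gaussian_sequence (\<lambda>w n. X n w) = gaussian_sequence" by simp
qed

theorem proposition1p12:
  fixes s :: real
    and M :: "'a measure"
    and X :: "int \<Rightarrow> 'a \<Rightarrow> real"
  assumes s: "s > 3 / 2"
    and M: "prob_space M"
    and indep: "prob_space.indep_vars M (\<lambda>_. borel) X UNIV"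
    and gauss: "\<And>n. distributed M lborel (X n) (\<lambda>x. ennreal (std_normal_density x))"
  shows "\<exists>\<rho>>0. AE w in M.
           H1_norm_torus (random_potential s (\<lambda>n. X n w)) < ereal \<rho> \<longrightarrow>
           (\<exists>lam. is_dirichlet_spectrum (random_potential s (\<lambda>n. X n w)) lam \<and>
                 strongly_nonresonant lam)"
proof (intro exI conjI)
  show "small_size / 10 > 0" by (simp add: small_size_def)
  note X = distr_gaussian_family[OF M indep gauss]
  show "AE w in M. H1_norm_torus (random_potential s (\<lambda>n. X n w)) < ereal (small_size / 10) \<longrightarrow>
           (\<exists>lam. is_dirichlet_spectrum (random_potential s (\<lambda>n. X n w)) lam \<and> strongly_nonresonant lam)"
    by (rule AE_distrD[OF X(1)]) (unfold X(2), rule AE_strongly_nonresonant_spectrum[OF s])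
qed

end
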